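(* Let $n\ge 1$ and $0\le r\le n$ be integers, let $\gamma\in\mathbb C^*$, let $\lambda\in\mathfrak H^*$ and set $\lambda_i=\lambda(H_i)$ for $1\le i\le n$. Consider the scalar $\rho(c)$ and the following generating functions of operators on the Fock space $\mathbb C[\mathbf x]\otimes\mathbb C[\mathbf y]$, for $1\le i\le n$, where $a_{ij}$, $a^*_{ij}$, $b_i$ stand for $a_{ij}(z)$, $a^*_{ij}(z)$, $b_i(z)$, and sums over empty ranges are $0$: $$\rho(c)=\gamma^2-(r+1),$$ $$\rho(F_i)(z)=a_{ii}+\sum_{j=i+1}^n a_{ij}a^*_{i+1,j},$$ $$\rho(H_i)(z)=2:a_{ii}a_{ii}^*:+\sum_{j=1}^{i-1}\left(:a_{ji}a_{ji}^*:-:a_{j,i-1}a_{j,i-1}^*:\right)+\sum_{j=i+1}^n\left(:a_{ij}a_{ij}^*:-:a_{i+1,j}a_{i+1,j}^*:\right)+b_i,$$ $$\rho(E_i)(z)=\ :a_{ii}^*\left(\sum_{k=1}^{i-1}a_{k,i-1}a_{k,i-1}^*-\sum_{k=1}^{i}a_{ki}a_{ki}^*\right):\ +\sum_{k=i+1}^n a_{i+1,k}a_{ik}^*-\sum_{k=1}^{i-1}a_{k,i-1}a_{ki}^*-a_{ii}^*b_i-\left(\delta_{i>r}(r+1)+\delta_{i\le r}(i+1)-\gamma^2\right)\partial a_{ii}^*.$$ Then, writing $\rho(X)(z)=\sum_{m\in\mathbb Z}\rho(X_m)z^{-m-1}$ for $X\in\{E_i,F_i,H_i : 1\le i\le n\}$,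 these formulas define an action on $\mathbb C[\mathbf x]\otimes\mathbb C[\mathbf y]$ of the generators $E_{im},F_{im},H_{im}$ ($1\le i\le n$, $m\in\mathbb Z$) and $c$ of affine $\mathfrak{sl}(n+1)$. That is, there is a representation $\rho$ on $\mathbb C[\mathbf x]\otimes\mathbb C[\mathbf y]$ of the Lie algebra with these generators, $(\mathbb C[t,t^{-1}]\otimes\mathfrak{sl}(n+1,\mathbb C))\oplus\mathbb C c$, under which $E_{im},F_{im},H_{im}$ act by the operators $\rho(E_{im}),\rho(F_{im}),\rho(H_{im})$ and $c$ acts by the scalar $\gamma^2-(r+1)$.
   Context: **Lie algebra.** $\mathfrak g=\mathfrak{sl}(n+1,\mathbb C)$, with $E_{ij}$ the standard basis of $\mathfrak{gl}(n+1,\mathbb C)$; $H_i=E_{ii}-E_{i+1,i+1}$, $E_i=E_{i,i+1}$, $F_i=E_{i+1,i}$ for $1\le i\le n$; $\mathfrak H$ is the span of the $H_i$; $(X|Y)=\mathrm{tr}(XY)$. For $X\in\mathfrak g$, $m\in\mathbb Z$, put $X_m=t^m\otimes X$, and $E_{im}=(E_i)_m$, $F_{im}=(F_i)_m$, $H_{im}=(H_i)_m$. The bracket is $[X_m,Y_p]=t^{m+p}\otimes[X,Y]+\delta_{m+p,0}\,m\,(X|Y)c$, with $c$ central. $\alpha_1,\dots,\alpha_n$ are the simple roots and $((\alpha_i|\alpha_j))_{i,j}$ is the Cartan matrix of $\mathfrak{sl}(n+1,\mathbb C)$ ($2$ on the diagonal, $-1$ if $|i-j|=1$, $0$ otherwise).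 **Indicator notation.** $\delta_{i>r}=1$ if $i>r$ and $0$ otherwise; $\delta_{i\le r}=1$ if $i\le r$ and $0$ otherwise; $\delta_{i,j}$ is the Kronecker delta. **Operators on $\mathbb C[\mathbf x]$.** $\mathbb C[\mathbf x]$ is the polynomial algebra over $\mathbb C$ in the indeterminates $x_{ij,m}$, $1\le i\le j\le n$, $m\in\mathbb Z$. Define operators on it by: $a_{ij,m}=\partial/\partial x_{ij,m}$ if $m\ge0$ and $j\le r$, and $a_{ij,m}=$ multiplication by $x_{ij,m}$ otherwise; $a^*_{ij,m}=$ multiplication by $x_{ij,-m}$ if $m\le 0$ and $j\le r$, and $a^*_{ij,m}=-\partial/\partial x_{ij,-m}$ otherwise. They satisfy $[a_{ij,m},a^*_{kl,p}]=\delta_{ik}\delta_{jl}\delta_{m+p,0}$, with all $a$'s commuting with each other and all $a^*$'s commuting with each other. **Operators on $\mathbb C[\mathbf y]$.** $\mathbb C[\mathbf y]$ is the polynomial algebra over $\mathbb C$ in the indeterminates $y_{i,m}$, $1\le i\le n$, $m\ge1$. Let $$\mathfrak B_{ij}=(\alpha_i|\alpha_j)\left(\gamma^2-\delta_{i>r}\delta_{j>r}(r+1)+\tfrac r2\,\delta_{i,r+1}\delta_{j,r+1}\right),$$ and fix vectors $\mathbf e_1,\dots,\mathbf e_n\in\mathbb C^n$ with $\mathbf e_i\cdot\mathbf e_j=\mathfrak B_{ij}$ for the usual (bilinear) dot product; such vectors exist since $\mathfrak B$ is symmetric. With $\mathbf y_m=(y_{1,m},\dots,y_{n,m})$ and $\partial/\partial\mathbf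 y_m=(\partial/\partial y_{1,m},\dots,\partial/\partial y_{n,m})$, define $b_{i0}=\lambda_i$ (scalar), $b_{i,-m}=$ multiplication by $\mathbf e_i\cdot\mathbf y_m$, and $b_{im}=m\,\mathbf e_i\cdot\partial/\partial\mathbf y_m$ for $m>0$. Then $[b_{im},b_{jp}]=m\,\mathfrak B_{ij}\,\delta_{m+p,0}$. All these operators act on $\mathbb C[\mathbf x]\otimes\mathbb C[\mathbf y]$ through the respective tensor factor. **Formal distributions.** $a_{ij}(z)=\sum_{m\in\mathbb Z}a_{ij,m}z^{-m-1}$, $a^*_{ij}(z)=\sum_{m\in\mathbb Z}a^*_{ij,m}z^{-m}$, $b_i(z)=\sum_{m\in\mathbb Z}b_{im}z^{-m-1}$, and $\partial$ is the formal derivative with respect to $z$. **Normal ordering.** For $a(z)=\sum_m a_{(m)}z^{-m-1}$ put $a^-(z)=\sum_{m\ge0}a_{(m)}z^{-m-1}$ and $a^+(z)=\sum_{m<0}a_{(m)}z^{-m-1}$ (so for $j\le r$: $a^-_{ij}(z)=\sum_{m\ge0}a_{ij,m}z^{-m-1}$ and $a^{*-}_{ij}(z)=\sum_{m\ge1}a^*_{ij,m}z^{-m}$), except that for $j>r$ the convention is $a^-_{ij}(z)=0$, $a^+_{ij}(z)=a_{ij}(z)$, $a^{*-}_{ij}(z)=a^*_{ij}(z)$, $a^{*+}_{ij}(z)=0$. Then $:a(z)b(w):\,=a^+(z)b(w)+b(w)a^-(z)$, and longer normally ordered products are nested from the right, $:abc:\,=\,:a(:bc:):$, and extended linearly. 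*)

theory Defs
  imports
    Complex_Main
    "HOL-Library.Poly_Mapping"
    "HOL-Library.Groups_Big_Fun"
    "HOL-Library.Function_Algebras"
    "Jordan_Normal_Form.Matrix"
begin

section \<open>The affine Lie algebra\<close>

text \<open>
  Matrices of size \<open>n + 1\<close> are those of Jordan_Normal_Form, whose entries are indexed from 0;
  the indices of \<open>matE\<close>, \<open>genE\<close>, \<open>genF\<close>, \<open>genH\<close> start from 1.
\<close>

definition matE :: "nat \<Rightarrow> nat \<Rightarrow> nat \<Rightarrow> complex mat" where
  "matE n i j = mat (n + 1) (n + 1) (\<lambda>(k, l). if k + 1 = i \<and> l + 1 = j then 1 else 0)"

definition genE :: "nat \<Rightarrow> nat \<Rightarrow> complex mat" where
  "genE n i = matE n i (i + 1)"

definition genF :: "nat \<Rightarrow> nat \<Rightarrow> complex mat" where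
  "genF n i = matE n (i + 1) i"

definition genH :: "nat \<Rightarrow> nat \<Rightarrow> complex mat" where
  "genH n i = matE n i i - matE n (i + 1) (i + 1)"

definition mtrace :: "complex mat \<Rightarrow> complex" where
  "mtrace A = (\<Sum>i<dim_row A. A $$ (i, i))"

definition mcomm :: "complex mat \<Rightarrow> complex mat \<Rightarrow> complex mat" where
  "mcomm A B = A * B - B * A"

definition sl :: "nat \<Rightarrow> complex mat set" where
  "sl n = {A \<in> carrier_mat (n + 1) (n + 1). mtrace A = 0}"

definition cartan_subalgebra :: "nat \<Rightarrow> complex mat set" where
  "cartan_subalgebra n =
     range (\<lambda>h. mat (n + 1) (n + 1) (\<lambda>kl. \<Sum>i=1..n. h i * genH n i $$ kl))"

text \<open>Linear functionals are only constrained on the Cartan subalgebra itself.\<close>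

definition cartan_dual :: "nat \<Rightarrow> (complex mat \<Rightarrow> complex) set" where
  "cartan_dual n = {lam.
     (\<forall>A\<in>cartan_subalgebra n. \<forall>B\<in>cartan_subalgebra n. lam (A + B) = lam A + lam B) \<and>
     (\<forall>A\<in>cartan_subalgebra n. \<forall>s. lam (s \<cdot>\<^sub>m A) = s * lam A)}"

definition cartan_matrix :: "nat \<Rightarrow> nat \<Rightarrow> complex" where
  "cartan_matrix i j = (if i = j then 2 else if i + 1 = j \<or> j + 1 = i then -1 else 0)"

text \<open>
  The pair \<open>(f, s)\<close> stands for the finite sum of the \<open>t\<^sup>m \<otimes> f m\<close>, plus \<open>s c\<close>. The bracket is the
  bilinear extension of
  \<open>[X\<^sub>m, Y\<^sub>p] = t\<^sup>m\<^sup>+\<^sup>p \<otimes> [X, Y] + \<delta>\<^bsub>m+p,0\<^esub> m tr(XY) c\<close>;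
  see \<open>aff_bracket_loop_elem\<close> below.
\<close>

type_synonym aff = "(int \<Rightarrow> complex mat) \<times> complex"

definition loop_support :: "nat \<Rightarrow> (int \<Rightarrow> complex mat) \<Rightarrow> int set" where
  "loop_support n f = {m. f m \<noteq> 0\<^sub>m (n + 1) (n + 1)}"

definition affine_sl :: "nat \<Rightarrow> aff set" where
  "affine_sl n = {x. (\<forall>m. fst x m \<in> sl n) \<and> finite (loop_support n (fst x))}"

definition aff_add :: "aff \<Rightarrow> aff \<Rightarrow> aff" where
  "aff_add x y = ((\<lambda>m. fst x m + fst y m), snd x + snd y)"

definition aff_scale :: "complex \<Rightarrow> aff \<Rightarrow> aff" where
  "aff_scale s x = ((\<lambda>m. s \<cdot>\<^sub>m fst x m), s * snd x)"

definition aff_bracket :: "nat \<Rightarrow> aff \<Rightarrow> aff \<Rightarrow> aff" where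
  "aff_bracket n x y =
     ((\<lambda>m. mat (n + 1) (n + 1)
         (\<lambda>kl. \<Sum>p\<in>loop_support n (fst x). mcomm (fst x p) (fst y (m - p)) $$ kl)),
      (\<Sum>p\<in>loop_support n (fst x). of_int p * mtrace (fst x p * fst y (- p))))"

definition loop_elem :: "nat \<Rightarrow> complex mat \<Rightarrow> int \<Rightarrow> aff" where
  "loop_elem n A m = ((\<lambda>k. if k = m then A else 0\<^sub>m (n + 1) (n + 1)), 0)"

definition central_elem :: "nat \<Rightarrow> aff" where
  "central_elem n = ((\<lambda>k. 0\<^sub>m (n + 1) (n + 1)), 1)"

lemma aff_bracket_loop_elem:
  assumes A: "A \<in> carrier_mat (n + 1) (n + 1)" and B: "B \<in> carrier_mat (n + 1) (n + 1)"
  shows "aff_bracket n (loop_elem n A m) (loop_elem n B p) =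
    aff_add (loop_elem n (mcomm A B) (m + p))
      (aff_scale ((if m + p = 0 then 1 else 0) * of_int m * mtrace (A * B)) (central_elem n))"
proof -
  let ?Z = "0\<^sub>m (n + 1) (n + 1) :: complex mat"
  have cZ: "mcomm C ?Z = ?Z" "mcomm ?Z C = ?Z" if "C \<in> carrier_mat (n + 1) (n + 1)" for C
    using that by (auto simp: mcomm_def)
  have tZ: "mtrace (C * ?Z) = 0" "mtrace (?Z * C) = 0" if "C \<in> carrier_mat (n + 1) (n + 1)" for C
    using that by (auto simp: mtrace_def)
  have cAB: "mcomm A B \<in> carrier_mat (n + 1) (n + 1)"
    using A B by (auto simp: mcomm_def)
  have supp: "loop_support n (\<lambda>k. if k = m then A else ?Z) = (if A = ?Z then {} else {m})"
    by (auto simp: loop_support_def)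
  show ?thesis
  proof (cases "A = ?Z")
    case True
    then show ?thesis
      using B cZ(2)[OF B] tZ(2)[OF B] supp
      by (auto simp: aff_bracket_def loop_elem_def central_elem_def aff_add_def aff_scale_def
          fun_eq_iff intro!: eq_matI)
  next
    case False
    have E: "mat (n + 1) (n + 1) (\<lambda>kl. C $$ kl) = C" if "C \<in> carrier_mat (n + 1) (n + 1)"
      for C :: "complex mat"
      using that by (intro eq_matI) auto
    have "(\<lambda>k. mat (n + 1) (n + 1) (\<lambda>kl. mcomm A (if k - m = p then B else ?Z) $$ kl)) =
      (\<lambda>k. (if k = m + p then mcomm A B else ?Z) + s \<cdot>\<^sub>m ?Z)" for s :: complex
    proof (rule ext)
      fix k
      show "mat (n + 1) (n + 1) (\<lambda>kl. mcomm A (if k - m = p then B else ?Z) $$ kl) =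
        (if k = m + p then mcomm A B else ?Z) + s \<cdot>\<^sub>m ?Z"
      proof (cases "k = m + p")
        case True
        then show ?thesis using E[OF cAB] cAB by simp
      next
        case F: False
        then have "k - m \<noteq> p" by auto
        with F show ?thesis using E[of ?Z] cZ(1)[OF A] by simp
      qed
    qed
    moreover have "of_int m * mtrace (A * (if - m = p then B else ?Z)) =
        (if m + p = 0 then 1 else 0) * of_int m * mtrace (A * B)"
      using tZ(1)[OF A] by auto
    ultimately show ?thesis
      using False supp
      by (simp add: aff_bracket_def loop_elem_def central_elem_def aff_add_def aff_scale_def)
  qed
qed


section \<open>The Fock space\<close>

text \<open>
  \<open>\<complex>[x] \<otimes> \<complex>[y]\<close> is taken to be the polynomial algebra in the disjoint union of the two families of
  indeterminates. \<open>Xv i j m\<close> is \<open>x\<^bsub>ij,m\<^esub>\<close> and \<open>Yv i m\<close> is \<open>y\<^bsub>i,m\<^esub>\<close>; the type \<open>pol\<close> has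
  indeterminates with arbitrary indices, and \<open>fock n\<close> cuts out the polynomials in the admissible ones.
\<close>

datatype indet = Xv nat nat int | Yv nat nat

type_synonym pol = "(indet \<Rightarrow>\<^sub>0 nat) \<Rightarrow>\<^sub>0 complex"

definition indets :: "nat \<Rightarrow> indet set" where
  "indets n = {Xv i j m | i j m. 1 \<le> i \<and> i \<le> j \<and> j \<le> n} \<union> {Yv i m | i m. 1 \<le> i \<and> i \<le> n \<and> 1 \<le> m}"

definition fock :: "nat \<Rightarrow> pol set" where
  "fock n = {f. \<forall>\<mu>\<in>Poly_Mapping.keys f. Poly_Mapping.keys \<mu> \<subseteq> indets n}"

definition pscale :: "complex \<Rightarrow> pol \<Rightarrow> pol" where
  "pscale s f = Poly_Mapping.single 0 s * f"

definition pmult :: "indet \<Rightarrow> pol \<Rightarrow> pol" where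
  "pmult x f = Poly_Mapping.single (Poly_Mapping.single x 1) 1 * f"

definition pdiff :: "indet \<Rightarrow> pol \<Rightarrow> pol" where
  "pdiff x f = (\<Sum>\<mu>\<in>Poly_Mapping.keys f.
     Poly_Mapping.single (\<mu> - Poly_Mapping.single x 1)
       (of_nat (Poly_Mapping.lookup \<mu> x) * Poly_Mapping.lookup f \<mu>))"


section \<open>Formal distributions\<close>

text \<open>
  A formal distribution \<open>A(z)\<close> is given by its coefficients: \<open>A k\<close> is the coefficient of \<open>z\<^sup>k\<close>.
  Distributions are added, subtracted and negated pointwise. The infinite sum in a product is
  taken with \<open>Sum_any\<close>, which returns 0 for a sum with infinitely many nonzero terms; that this
  never happens below is the content of \<open>rho_products_locally_finite\<close>.
\<close>

type_synonym distr = "int \<Rightarrow> pol \<Rightarrow> pol"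

definition dscale :: "complex \<Rightarrow> distr \<Rightarrow> distr" where
  "dscale s A = (\<lambda>k v. pscale s (A k v))"

definition dmult :: "distr \<Rightarrow> distr \<Rightarrow> distr"  (infixl \<open>\<odot>\<close> 70) where
  "A \<odot> B = (\<lambda>k v. Sum_any (\<lambda>p. A p (B (k - p) v)))"

definition dderiv :: "distr \<Rightarrow> distr" where
  "dderiv A = (\<lambda>k v. pscale (of_int (k + 1)) (A (k + 1) v))"

text \<open>
  Normal ordering of \<open>A\<close> with \<open>B\<close>, where \<open>A\<close> is given by its two parts \<open>A\<^sup>+\<close> and \<open>A\<^sup>-\<close>; the
  splitting is not determined by the coefficients of \<open>A\<close> but depends on the index \<open>j\<close> of
  \<open>a\<^bsub>ij\<^esub>\<close>, \<open>a\<^sup>*\<^bsub>ij\<^esub>\<close>.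
\<close>

definition nord :: "distr \<Rightarrow> distr \<Rightarrow> distr \<Rightarrow> distr" where
  "nord Ap Am B = Ap \<odot> B + B \<odot> Am"

definition op_a :: "nat \<Rightarrow> nat \<Rightarrow> nat \<Rightarrow> int \<Rightarrow> pol \<Rightarrow> pol" where
  "op_a r i j m = (if m \<ge> 0 \<and> j \<le> r then pdiff (Xv i j m) else pmult (Xv i j m))"

definition op_as :: "nat \<Rightarrow> nat \<Rightarrow> nat \<Rightarrow> int \<Rightarrow> pol \<Rightarrow> pol" where
  "op_as r i j m = (if m \<le> 0 \<and> j \<le> r then pmult (Xv i j (- m)) else (\<lambda>v. - pdiff (Xv i j (- m)) v))"

definition op_b :: "nat \<Rightarrow> (nat \<Rightarrow> nat \<Rightarrow> complex) \<Rightarrow> (nat \<Rightarrow> complex) \<Rightarrow> nat \<Rightarrow> int \<Rightarrow> pol \<Rightarrow> pol" where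
  "op_b n e lam i m =
     (if m = 0 then pscale (lam i)
      else if m < 0 then (\<lambda>v. \<Sum>l=1..n. pscale (e i l) (pmult (Yv l (nat (- m))) v))
      else (\<lambda>v. pscale (of_int m) (\<Sum>l=1..n. pscale (e i l) (pdiff (Yv l (nat m)) v))))"

definition frakB :: "nat \<Rightarrow> complex \<Rightarrow> nat \<Rightarrow> nat \<Rightarrow> complex" where
  "frakB r \<gamma> i j = cartan_matrix i j *
     (\<gamma>\<^sup>2 - (if i > r \<and> j > r then of_nat (r + 1) else 0)
         + (if i = r + 1 \<and> j = r + 1 then of_nat r / 2 else 0))"

definition fa :: "nat \<Rightarrow> nat \<Rightarrow> nat \<Rightarrow> distr" where
  "fa r i j = (\<lambda>k. op_a r i j (- k - 1))"

definition fas :: "nat \<Rightarrow> nat \<Rightarrow> nat \<Rightarrow> distr" where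
  "fas r i j = (\<lambda>k. op_as r i j (- k))"

definition fb :: "nat \<Rightarrow> (nat \<Rightarrow> nat \<Rightarrow> complex) \<Rightarrow> (nat \<Rightarrow> complex) \<Rightarrow> nat \<Rightarrow> distr" where
  "fb n e lam i = (\<lambda>k. op_b n e lam i (- k - 1))"

text \<open>
  For \<open>j \<le> r\<close> the minus part consists of the negative powers of \<open>z\<close>, since the coefficient indexed
  by \<open>(m)\<close> belongs to \<open>z\<^sup>-\<^sup>m\<^sup>-\<^sup>1\<close>.
\<close>

definition a_minus :: "nat \<Rightarrow> nat \<Rightarrow> nat \<Rightarrow> distr" where
  "a_minus r i j = (\<lambda>k. if j \<le> r \<and> k < 0 then fa r i j k else 0)"

definition a_plus :: "nat \<Rightarrow> nat \<Rightarrow> nat \<Rightarrow> distr" where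
  "a_plus r i j = (\<lambda>k. if j \<le> r \<and> k < 0 then 0 else fa r i j k)"

definition as_minus :: "nat \<Rightarrow> nat \<Rightarrow> nat \<Rightarrow> distr" where
  "as_minus r i j = (\<lambda>k. if j \<le> r \<and> k \<ge> 0 then 0 else fas r i j k)"

definition as_plus :: "nat \<Rightarrow> nat \<Rightarrow> nat \<Rightarrow> distr" where
  "as_plus r i j = (\<lambda>k. if j \<le> r \<and> k \<ge> 0 then fas r i j k else 0)"

text \<open>The normally ordered product of \<open>a\<^bsub>ij\<^esub>(z)\<close> and \<open>a\<^sup>*\<^bsub>ij\<^esub>(z)\<close>.\<close>

definition aas :: "nat \<Rightarrow> nat \<Rightarrow> nat \<Rightarrow> distr" where
  "aas r i j = nord (a_plus r i j) (a_minus r i j) (fas r i j)"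


section \<open>The generating functions\<close>

definition rho_F :: "nat \<Rightarrow> nat \<Rightarrow> nat \<Rightarrow> distr" where
  "rho_F n r i = fa r i i + (\<Sum>j=i+1..n. fa r i j \<odot> fas r (i + 1) j)"

definition rho_H :: "nat \<Rightarrow> nat \<Rightarrow> (nat \<Rightarrow> nat \<Rightarrow> complex) \<Rightarrow> (nat \<Rightarrow> complex) \<Rightarrow> nat \<Rightarrow> distr" where
  "rho_H n r e lam i = dscale 2 (aas r i i)
     + (\<Sum>j=1..<i. aas r j i - aas r j (i - 1))
     + (\<Sum>j=i+1..n. aas r i j - aas r (i + 1) j)
     + fb n e lam i"

definition rho_E ::
  "nat \<Rightarrow> nat \<Rightarrow> complex \<Rightarrow> (nat \<Rightarrow> nat \<Rightarrow> complex) \<Rightarrow> (nat \<Rightarrow> complex) \<Rightarrow> nat \<Rightarrow> distr" where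
  "rho_E n r \<gamma> e lam i =
     nord (as_plus r i i) (as_minus r i i) ((\<Sum>k=1..<i. aas r k (i - 1)) - (\<Sum>k=1..i. aas r k i))
     + (\<Sum>k=i+1..n. fa r (i + 1) k \<odot> fas r i k)
     - (\<Sum>k=1..<i. fa r k (i - 1) \<odot> fas r k i)
     - fas r i i \<odot> fb n e lam i
     - dscale ((if i > r then of_nat (r + 1) else 0) + (if i \<le> r then of_nat (i + 1) else 0) - \<gamma>\<^sup>2)
         (dderiv (fas r i i))"

text \<open>The operator that is the coefficient of \<open>z\<^sup>-\<^sup>m\<^sup>-\<^sup>1\<close>.\<close>

definition mode :: "distr \<Rightarrow> int \<Rightarrow> pol \<Rightarrow> pol" where
  "mode A m = A (- m - 1)"


section \<open>Representations\<close>

definition affine_representation :: "nat \<Rightarrow> pol set \<Rightarrow> (aff \<Rightarrow> pol \<Rightarrow> pol) \<Rightarrow> bool" where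
  "affine_representation n V \<rho> \<longleftrightarrow>
     (\<forall>x\<in>affine_sl n. \<forall>v\<in>V. \<rho> x v \<in> V) \<and>
     (\<forall>x\<in>affine_sl n. \<forall>u\<in>V. \<forall>v\<in>V. \<rho> x (u + v) = \<rho> x u + \<rho> x v) \<and>
     (\<forall>x\<in>affine_sl n. \<forall>s. \<forall>v\<in>V. \<rho> x (pscale s v) = pscale s (\<rho> x v)) \<and>
     (\<forall>x\<in>affine_sl n. \<forall>y\<in>affine_sl n. \<forall>v\<in>V. \<rho> (aff_add x y) v = \<rho> x v + \<rho> y v) \<and>
     (\<forall>x\<in>affine_sl n. \<forall>s. \<forall>v\<in>V. \<rho> (aff_scale s x) v = pscale s (\<rho> x v)) \<and>
     (\<forall>x\<in>affine_sl n. \<forall>y\<in>affine_sl n. \<forall>v\<in>V.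
        \<rho> (aff_bracket n x y) v = \<rho> x (\<rho> y v) - \<rho> y (\<rho> x v))"


section \<open>The products above are locally finite\<close>

definition pvars :: "pol \<Rightarrow> indet set" where
  "pvars f = (\<Union>\<mu>\<in>Poly_Mapping.keys f. Poly_Mapping.keys \<mu>)"

lemma finite_pvars [simp]: "finite (pvars f)"
  by (simp add: pvars_def)

lemma pdiff_eq_0: "x \<notin> pvars f \<Longrightarrow> pdiff x f = 0"
  unfolding pdiff_def pvars_def
  by (rule sum.neutral) (auto simp: in_keys_iff)

lemma pvars_pmult: "pvars (pmult x f) \<subseteq> insert x (pvars f)"
proof
  fix y assume "y \<in> pvars (pmult x f)"
  then obtain \<mu> where \<mu>: "\<mu> \<in> Poly_Mapping.keys (pmult x f)" "y \<in> Poly_Mapping.keys \<mu>"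
    by (auto simp: pvars_def)
  from \<mu>(1) obtain s t where st: "\<mu> = s + t" "s \<in> Poly_Mapping.keys
      (Poly_Mapping.single (Poly_Mapping.single x (1::nat)) (1::complex))" "t \<in> Poly_Mapping.keys f"
    unfolding pmult_def using keys_mult by blast
  then have "s = Poly_Mapping.single x 1" by simp
  then have "Poly_Mapping.keys \<mu> \<subseteq> insert x (Poly_Mapping.keys t)"
    using st(1) Poly_Mapping.keys_add[of s t] by auto
  then show "y \<in> insert x (pvars f)" using \<mu>(2) st(3) by (auto simp: pvars_def)
qed

lemma pdiff_pmult_eq_0: "x \<noteq> y \<Longrightarrow> x \<notin> pvars f \<Longrightarrow> pdiff x (pmult y f) = 0"
  using pvars_pmult by (intro pdiff_eq_0) blast

lemma pvars_zero [simp]: "pvars 0 = {}"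
  by (simp add: pvars_def)

lemma pvars_uminus [simp]: "pvars (- f) = pvars f"
  by (simp add: pvars_def)

lemma pvars_add: "pvars (f + g) \<subseteq> pvars f \<union> pvars g"
  unfolding pvars_def using Poly_Mapping.keys_add[of f g] by blast

lemma pvars_sum: "finite I \<Longrightarrow> pvars (\<Sum>i\<in>I. f i) \<subseteq> (\<Union>i\<in>I. pvars (f i))"
proof (induction I rule: finite_induct)
  case (insert i I)
  then show ?case using pvars_add[of "f i" "\<Sum>i\<in>I. f i"] by auto
qed simp

lemma pvars_pscale: "pvars (pscale s f) \<subseteq> pvars f"
proof
  fix y assume "y \<in> pvars (pscale s f)"
  then obtain \<mu> where \<mu>: "\<mu> \<in> Poly_Mapping.keys (pscale s f)" "y \<in> Poly_Mapping.keys \<mu>"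
    by (auto simp: pvars_def)
  from \<mu>(1) obtain q t where st: "\<mu> = q + t" "q \<in> Poly_Mapping.keys
      (Poly_Mapping.single (0 :: indet \<Rightarrow>\<^sub>0 nat) s)" "t \<in> Poly_Mapping.keys f"
    unfolding pscale_def using keys_mult by blast
  then have "q = 0" by (simp split: if_splits)
  then show "y \<in> pvars f" using \<mu>(2) st by (auto simp: pvars_def)
qed

lemma pmult_0 [simp]: "pmult x 0 = 0"
  by (simp add: pmult_def)

lemma pdiff_0 [simp]: "pdiff x 0 = 0"
  by (simp add: pdiff_def)

lemma pscale_0 [simp]: "pscale s 0 = 0"
  by (simp add: pscale_def)

definition index_bound :: "int \<Rightarrow> pol \<Rightarrow> bool" where
  "index_bound N v \<longleftrightarrow> N > 0 \<and> (\<forall>i j m. Xv i j m \<in> pvars v \<longrightarrow> \<bar>m\<bar> < N) \<and>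
     (\<forall>i m. Yv i m \<in> pvars v \<longrightarrow> int m < N)"

lemma ex_index_bound: "\<exists>N. index_bound N v"
proof -
  define g where "g x = (case x of Xv i j m \<Rightarrow> \<bar>m\<bar> | Yv i m \<Rightarrow> int m)" for x
  define N where "N = Max (insert 0 (g ` pvars v)) + 1"
  have *: "g x < N" if "x \<in> pvars v" for x
    using that Max_ge[of "insert 0 (g ` pvars v)" "g x"] by (simp add: N_def)
  have "0 < N"
    using Max_ge[of "insert 0 (g ` pvars v)" 0] by (simp add: N_def)
  moreover have "\<bar>m\<bar> < N" if "Xv i j m \<in> pvars v" for i j m using *[OF that] by (simp add: g_def)
  moreover have "int m < N" if "Yv i m \<in> pvars v" for i m using *[OF that] by (simp add: g_def)
  ultimately show ?thesis unfolding index_bound_def by blast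
qed

lemma index_boundD:
  assumes "index_bound N v"
  shows "N > 0" "Xv i j m \<in> pvars v \<Longrightarrow> \<bar>m\<bar> < N" "Yv i l \<in> pvars v \<Longrightarrow> int l < N"
  using assms unfolding index_bound_def by blast+

definition locally_finite :: "distr \<Rightarrow> distr \<Rightarrow> bool" where
  "locally_finite A B \<longleftrightarrow> (\<forall>k v. finite {p. A p (B (k - p) v) \<noteq> 0})"

lemma locally_finiteI:
  assumes "\<And>k v. \<exists>M. \<forall>p. \<bar>p\<bar> > M \<longrightarrow> A p (B (k - p) v) = 0"
  shows "locally_finite A B"
  unfolding locally_finite_def
proof (intro allI)
  fix k v
  obtain M where "\<forall>p. \<bar>p\<bar> > M \<longrightarrow> A p (B (k - p) v) = 0" using assms by blast
  then have "\<not> \<bar>p\<bar> > M" if "A p (B (k - p) v) \<noteq> 0" for p using that by blast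
  then have "{p. A p (B (k - p) v) \<noteq> 0} \<subseteq> {- M..M}" by fastforce
  then show "finite {p. A p (B (k - p) v) \<noteq> 0}"
    by (rule finite_subset) simp
qed

lemma fa_0 [simp]: "fa r i j k 0 = 0"
  by (simp add: fa_def op_a_def)

lemma fas_0 [simp]: "fas r i j k 0 = 0"
  by (simp add: fas_def op_as_def)

lemma fb_0 [simp]: "fb n e lam i k 0 = 0"
  by (simp add: fb_def op_b_def)

lemma a_as_locally_finite:
  assumes "(i, j) \<noteq> (i', j')" "j \<le> j'"
  shows "locally_finite (fa r i j) (fas r i' j')"
proof (rule locally_finiteI)
  fix k v
  obtain N where "index_bound N v" using ex_index_bound by blast
  note N = index_boundD[OF this]
  have "fa r i j p (fas r i' j' (k - p) v) = 0" if "\<bar>p\<bar> > \<bar>k\<bar> + N + 1" for p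
  proof (cases "j' \<le> r \<and> k - p \<ge> 0")
    case True
    then have "p < 0" using that N(1) by linarith
    moreover have "Xv i j (- p - 1) \<notin> pvars v" using N(2)[of i j "- p - 1"] that by auto
    ultimately show ?thesis using True assms
      by (auto simp: fa_def fas_def op_a_def op_as_def intro!: pdiff_pmult_eq_0)
  next
    case False
    have "Xv i' j' (k - p) \<notin> pvars v" using N(2)[of i' j' "k - p"] that by auto
    then show ?thesis using False by (auto simp: fas_def op_as_def pdiff_eq_0)
  qed
  then show "\<exists>M. \<forall>p. \<bar>p\<bar> > M \<longrightarrow> fa r i j p (fas r i' j' (k - p) v) = 0" by blast
qed

lemma aas_locally_finite:
  "locally_finite (a_plus r i j) (fas r i j)" "locally_finite (fas r i j) (a_minus r i j)"
proof -
  show "locally_finite (a_plus r i j) (fas r i j)"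
  proof (rule locally_finiteI)
    fix k v
    obtain N where "index_bound N v" using ex_index_bound by blast
    note N = index_boundD[OF this]
    have "a_plus r i j p (fas r i j (k - p) v) = 0" if "\<bar>p\<bar> > \<bar>k\<bar> + N + 1" for p
    proof (cases "j \<le> r \<and> k - p \<ge> 0")
      case True
      then have "p < 0" using that N(1) by linarith
      then show ?thesis using True by (simp add: a_plus_def)
    next
      case False
      have "Xv i j (k - p) \<notin> pvars v" using N(2)[of i j "k - p"] that by auto
      then show ?thesis using False by (auto simp: fas_def op_as_def pdiff_eq_0 a_plus_def)
    qed
    then show "\<exists>M. \<forall>p. \<bar>p\<bar> > M \<longrightarrow> a_plus r i j p (fas r i j (k - p) v) = 0" by blast
  qed
  show "locally_finite (fas r i j) (a_minus r i j)"
  proof (rule locally_finiteI)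
    fix k v
    obtain N where "index_bound N v" using ex_index_bound by blast
    note N = index_boundD[OF this]
    have "fas r i j p (a_minus r i j (k - p) v) = 0" if "\<bar>p\<bar> > \<bar>k\<bar> + N + 1" for p
    proof -
      have "Xv i j (- (k - p) - 1) \<notin> pvars v" using N(2)[of i j "- (k - p) - 1"] that by auto
      then show ?thesis by (simp add: a_minus_def fa_def op_a_def pdiff_eq_0)
    qed
    then show "\<exists>M. \<forall>p. \<bar>p\<bar> > M \<longrightarrow> fas r i j p (a_minus r i j (k - p) v) = 0" by blast
  qed
qed

lemma aas_0 [simp]: "aas r i j k 0 = 0"
proof -
  have "a_plus r i j p 0 = 0" "a_minus r i j p 0 = 0" for p
    by (simp_all add: a_plus_def a_minus_def)
  then show ?thesis by (simp add: aas_def nord_def dmult_def)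
qed

lemma aas_lower:
  assumes j: "j \<le> r"
  shows "\<exists>M. \<forall>k < M. aas r i j k v = 0"
proof -
  obtain N where "index_bound N v" using ex_index_bound by blast
  note N = index_boundD[OF this]
  have "aas r i j k v = 0" if k: "k < - 2 * N - 2" for k
  proof -
    have "a_plus r i j p (fas r i j (k - p) v) = 0" for p
    proof (cases "p < 0")
      case False
      then have "Xv i j (k - p) \<notin> pvars v" using N(2)[of i j "k - p"] k N(1) by auto
      then show ?thesis using False k N(1) by (simp add: fas_def op_as_def pdiff_eq_0 a_plus_def)
    qed (use j in \<open>simp add: a_plus_def\<close>)
    moreover have "fas r i j p (a_minus r i j (k - p) v) = 0" for p
    proof (cases "Xv i j (- (k - p) - 1) \<in> pvars v \<and> k - p < 0")
      case False
      then show ?thesis by (auto simp: a_minus_def fa_def op_a_def pdiff_eq_0)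
    next
      case True
      then have p: "p < - N" using N(2)[of i j "- (k - p) - 1"] k N(1) by auto
      have d: "pdiff (Xv i j p) (pdiff x v) = 0" for x
      proof (rule pdiff_eq_0)
        have "pvars (pdiff x v) \<subseteq> pvars v"
        proof -
          have "pvars (Poly_Mapping.single (\<mu> - Poly_Mapping.single x 1) s) \<subseteq> Poly_Mapping.keys \<mu>"
            for \<mu> :: "indet \<Rightarrow>\<^sub>0 nat" and s :: complex
            by (auto simp: pvars_def in_keys_iff lookup_minus split: if_splits)
          then show ?thesis
            unfolding pdiff_def using pvars_sum[of "Poly_Mapping.keys v"]
            by (fastforce simp: pvars_def[of v])
        qed
        then show "Xv i j p \<notin> pvars (pdiff x v)" using N(2)[of i j p] p N(1) by auto
      qed
      show ?thesis using True p N(1) j d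
        by (auto simp: a_minus_def fa_def op_a_def fas_def op_as_def)
    qed
    ultimately show ?thesis by (simp add: aas_def nord_def dmult_def)
  qed
  then show ?thesis by blast
qed

lemma sum_distr_apply: "(\<Sum>i\<in>I. f i :: distr) k v = (\<Sum>i\<in>I. f i k v)"
  by (induction I rule: infinite_finite_induct) auto

lemma aas_sum_locally_finite:
  fixes i r :: nat
  defines "C \<equiv> (\<Sum>k=1..<i. aas r k (i - 1)) - (\<Sum>k=1..i. aas r k i)"
  shows "locally_finite (as_plus r i i) C" "locally_finite C (as_minus r i i)"
proof -
  have C: "C k v = (\<Sum>l=1..<i. aas r l (i - 1) k v) - (\<Sum>l=1..i. aas r l i k v)" for k v
    by (simp add: C_def sum_distr_apply)
  have C0: "C k 0 = 0" for k by (simp add: C)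
  have lower: "\<exists>M. \<forall>k < M. C k v = 0" if "i \<le> r" for v
  proof -
    have "\<forall>l. \<exists>M. \<forall>k < M. aas r l (i - 1) k v = 0" using aas_lower[of "i - 1" r _ v] that by auto
    then obtain f where f: "\<And>l k. k < f l \<Longrightarrow> aas r l (i - 1) k v = 0"
      using choice[of "\<lambda>l M. \<forall>k < M. aas r l (i - 1) k v = 0"] by auto
    have "\<forall>l. \<exists>M. \<forall>k < M. aas r l i k v = 0" using aas_lower[of i r _ v] that by auto
    then obtain g where g: "\<And>l k. k < g l \<Longrightarrow> aas r l i k v = 0"
      using choice[of "\<lambda>l M. \<forall>k < M. aas r l i k v = 0"] by auto
    define M where "M = Min (insert 0 (f ` {1..<i} \<union> g ` {1..i}))"
    have "C k v = 0" if "k < M" for k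
    proof -
      have "\<forall>l\<in>{1..<i}. k < f l" "\<forall>l\<in>{1..i}. k < g l" using that by (simp_all add: M_def)
      then show ?thesis using f g by (simp add: C)
    qed
    then show ?thesis by blast
  qed
  show "locally_finite (as_plus r i i) C"
  proof (rule locally_finiteI)
    fix k v
    show "\<exists>M. \<forall>p. \<bar>p\<bar> > M \<longrightarrow> as_plus r i i p (C (k - p) v) = 0"
    proof (cases "i \<le> r")
      case True
      then obtain M where M: "\<And>k. k < M \<Longrightarrow> C k v = 0" using lower by blast
      have "as_plus r i i p (C (k - p) v) = 0" if "\<bar>p\<bar> > \<bar>k\<bar> + \<bar>M\<bar>" for p
      proof (cases "p < 0")
        case False
        then show ?thesis using that by (simp add: M as_plus_def)
      qed (simp add: as_plus_def)
      then show ?thesis by blast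
    qed (simp add: as_plus_def)
  qed
  show "locally_finite C (as_minus r i i)"
  proof (rule locally_finiteI)
    fix k v
    obtain N where "index_bound N v" using ex_index_bound by blast
    note N = index_boundD[OF this]
    have "C p (as_minus r i i (k - p) v) = 0" if "\<bar>p\<bar> > \<bar>k\<bar> + N + 1" for p
    proof -
      have "Xv i i (k - p) \<notin> pvars v" using N(2)[of i i "k - p"] that by auto
      then show ?thesis by (auto simp: as_minus_def fas_def op_as_def pdiff_eq_0 C0)
    qed
    then show "\<exists>M. \<forall>p. \<bar>p\<bar> > M \<longrightarrow> C p (as_minus r i i (k - p) v) = 0" by blast
  qed
qed

lemma as_b_locally_finite: "locally_finite (fas r i i) (fb n e lam i)"
proof (rule locally_finiteI)
  fix k v
  obtain N where "index_bound N v" using ex_index_bound by blast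
  note N = index_boundD[OF this]
  have "fas r i i p (fb n e lam i (k - p) v) = 0" if p: "\<bar>p\<bar> > \<bar>k\<bar> + N + 1" for p
  proof (cases "p < 0")
    case True
    define w where "w = (\<Sum>l=1..n. pscale (e i l) (pmult (Yv l (nat (1 - (p - k)))) v))"
    have bw: "fb n e lam i (k - p) v = w"
      using True p N(1) by (auto simp: fb_def op_b_def w_def)
    have "pvars w \<subseteq> (\<Union>l\<in>{1..n}. pvars (pscale (e i l) (pmult (Yv l (nat (1 - (p - k)))) v)))"
      unfolding w_def by (rule pvars_sum) simp
    also have "\<dots> \<subseteq> pvars v \<union> range (\<lambda>l. Yv l (nat (1 - (p - k))))"
      using pvars_pscale pvars_pmult by blast
    finally have "Xv i i p \<notin> pvars w" using N(2)[of i i p] p by auto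
    then show ?thesis using True by (simp add: bw fas_def op_as_def pdiff_eq_0)
  next
    case False
    have "pdiff (Yv l (nat (- (k - p) - 1))) v = 0" for l
      using N(3)[of l "nat (- (k - p) - 1)"] p False
      by (intro pdiff_eq_0) (auto split: if_splits)
    then have "fb n e lam i (k - p) v = 0"
      using False p N(1) by (auto simp: fb_def op_b_def)
    then show ?thesis by simp
  qed
  then show "\<exists>M. \<forall>p. \<bar>p\<bar> > M \<longrightarrow> fas r i i p (fb n e lam i (k - p) v) = 0" by blast
qed

text \<open>One line for each occurrence of \<open>\<odot>\<close> in \<open>aas\<close>, \<open>rho_F\<close>, \<open>rho_E\<close>.\<close>

theorem rho_products_locally_finite:
  "locally_finite (a_plus r i j) (fas r i j)"
  "locally_finite (fas r i j) (a_minus r i j)"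
  "locally_finite (fa r i j) (fas r (i + 1) j)"
  "locally_finite (as_plus r i i) ((\<Sum>k=1..<i. aas r k (i - 1)) - (\<Sum>k=1..i. aas r k i))"
  "locally_finite ((\<Sum>k=1..<i. aas r k (i - 1)) - (\<Sum>k=1..i. aas r k i)) (as_minus r i i)"
  "locally_finite (fa r (i + 1) k) (fas r i k)"
  "1 \<le> i \<Longrightarrow> locally_finite (fa r k (i - 1)) (fas r k i)"
  "locally_finite (fas r i i) (fb n e lam i)"
  by (simp_all add: aas_locally_finite a_as_locally_finite aas_sum_locally_finite
      as_b_locally_finite del: One_nat_def)

end

theory Submission
  imports Defs
begin

text \<open>
  The formulas are the end result of \<open>n + 1\<close> induction steps, one for each column \<open>N\<close> of free fields
  \<open>a\<^bsub>pN\<^esub>, a\<^sup>*\<^bsub>pN\<^esub>\<close>. Given currents of affine \<open>gl(N)\<close>, with an arbitrary invariant form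
  \<open>\<kappa> tr(XY) + \<mu> tr(X) tr(Y)\<close> as cocycle, column \<open>N\<close> and one more Heisenberg field yield currents of
  affine \<open>gl(N + 1)\<close>: \<open>E\<^bsub>N+1,p\<^esub>\<close> acts by \<open>a\<^bsub>pN\<^esub>\<close>, a bilinear term is added on \<open>gl(N)\<close>, and only
  \<open>E\<^bsub>q,N+1\<^esub>\<close> is cubic. The form changes from \<open>\<kappa>\<close> to \<open>\<kappa> - 1\<close> if \<open>N \<le> r\<close>, because only then do double
  contractions occur, which explains the shift \<open>r + 1\<close> of the level.

  All brackets with the \<open>a\<^bsub>pN\<^esub>\<close> involve single contractions only. The remaining brackets with
  \<open>E\<^bsub>q,N+1\<^esub>\<close> follow without computation: by the Jacobi identity, the difference of the two sides commutes
  with all \<open>a\<^bsub>pN,m\<^esub>\<close>, and it has positive charge (number of \<open>a\<^sup>*\<close> minus number of \<open>a\<close>), which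
  forces it to vanish on the Fock space.

  The matrix \<open>frakB\<close> is the restriction to \<open>sl(n + 1)\<close> of the Gram matrix that this induction needs, if
  \<open>\<mu>\<close> is chosen such that the identity matrix acts by zero.
\<close>

section \<open>The algebra of linear operators\<close>

text \<open>The charge argument has a limit, which fixes what must be computed by hand: scalars
  commute with all the \<open>a\<close> and have charge 0, and the \<open>a\<close> themselves have
  charge -1. So it says nothing about brackets of total charge at most 0, namely those among
  \<open>cur_G\<close>, \<open>cur_D\<close> and the \<open>a\<close>, and those of
  \<open>cur_U\<close> with the \<open>a\<close>. All central terms come from there. The algebra is
  gl because passing from gl(N) to gl(N + 1) adds a single diagonal matrix unit, hence one
  Heisenberg field per column. That field cannot be independent of the earlier currents: the
  bilinear terms have double contractions with their own trace, and brackets of the new field with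
  the diagonal of gl(N) must compensate for them. This is the origin of the -1 in the off-diagonal
  entries of \<open>gram\<close>. Column 0 contributes no fields, yet it counts among the r + 1
  drops of the level: on gl(1) only \<open>\<kappa> + \<mu>\<close> matters, so its drop just
  normalises the first Heisenberg field.\<close>

lemma lookup_pscale: "Poly_Mapping.lookup (pscale s f) \<mu> = s * Poly_Mapping.lookup f \<mu>"
  by (simp add: pscale_def flip: mult_map_scale_conv_mult) (simp add: Poly_Mapping.map.rep_eq when_def)

lemma pscale_add_right: "pscale s (u + v) = pscale s u + pscale s v"
  by (simp add: pscale_def distrib_left)

lemma pscale_diff_right: "pscale s (u - v) = pscale s u - pscale s v"
  by (rule poly_mapping_eqI) (simp add: lookup_pscale lookup_minus algebra_simps)

lemma pscale_add_left: "pscale (s + t) u = pscale s u + pscale t u"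
  by (simp add: pscale_def single_add distrib_right)

lemma pscale_pscale: "pscale s (pscale t u) = pscale (s * t) u"
  by (rule poly_mapping_eqI) (simp add: lookup_pscale)

lemma pscale_1 [simp]: "pscale 1 u = u"
  by (rule poly_mapping_eqI) (simp add: lookup_pscale)

lemma pscale_zero_left [simp]: "pscale 0 u = 0"
  by (rule poly_mapping_eqI) (simp add: lookup_pscale)

definition linop :: "(pol \<Rightarrow> pol) \<Rightarrow> bool" where
  "linop f \<longleftrightarrow> (\<forall>u v. f (u + v) = f u + f v) \<and> (\<forall>s v. f (pscale s v) = pscale s (f v))"

text \<open>The operators act on all of \<open>pol\<close> and not only on \<open>fock n\<close>, so
  that operator identities are plain equations in a ring. The Fock space comes back through
  \<open>preserves\<close>.\<close>

typedef lop = "{f. linop f}" morphisms app Lop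
  by (rule exI[of _ "\<lambda>v. v"]) (simp add: linop_def)

setup_lifting type_definition_lop

lemma app_add: "app X (u + v) = app X u + app X v"
  using app[of X] by (simp add: linop_def)

lemma app_pscale: "app X (pscale s v) = pscale s (app X v)"
  using app[of X] by (simp add: linop_def)

lemma app_0 [simp]: "app X 0 = 0"
  using app_pscale[of X 0 0] by simp

lemma app_sum: "app X (sum f A) = (\<Sum>i\<in>A. app X (f i))"
  by (induction A rule: infinite_finite_induct) (simp_all add: app_add)

lemma lop_eqI: "(\<And>v. app X v = app Y v) \<Longrightarrow> X = Y"
  by (metis app_inverse ext)

instantiation lop :: ring_1
begin

lift_definition zero_lop :: lop is "\<lambda>v. 0" by (simp add: linop_def)
lift_definition one_lop :: lop is "\<lambda>v. v" by (simp add: linop_def)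
lift_definition plus_lop :: "lop \<Rightarrow> lop \<Rightarrow> lop" is "\<lambda>f g v. f v + g v"
  by (simp add: linop_def pscale_add_right)
lift_definition minus_lop :: "lop \<Rightarrow> lop \<Rightarrow> lop" is "\<lambda>f g v. f v - g v"
  by (simp add: linop_def pscale_diff_right)
lift_definition uminus_lop :: "lop \<Rightarrow> lop" is "\<lambda>f v. - f v"
  by (simp add: linop_def) (metis pscale_diff_right diff_0 pscale_0)
lift_definition times_lop :: "lop \<Rightarrow> lop \<Rightarrow> lop" is "\<lambda>f g v. f (g v)"
  by (simp add: linop_def)

instance
proof
  have "app 0 1 \<noteq> app 1 1" by (simp add: zero_lop.rep_eq one_lop.rep_eq)
  then show "(0 :: lop) \<noteq> 1" by metis
qed (transfer; simp add: linop_def fun_eq_iff)+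

end

lift_definition sc :: "complex \<Rightarrow> lop" is pscale
  by (simp add: linop_def pscale_add_right pscale_pscale mult.commute)

lemma app_simps [simp]:
  "app 0 v = 0" "app 1 v = v" "app (X + Y) v = app X v + app Y v"
  "app (X - Y) v = app X v - app Y v" "app (- X) v = - app X v"
  "app (X * Y) v = app X (app Y v)" "app (sc s) v = pscale s v"
  by (transfer; simp)+

lemma app_sum_left: "app (sum F A) v = (\<Sum>i\<in>A. app (F i) v)"
  by (induction A rule: infinite_finite_induct) simp_all

lemma sc_0 [simp]: "sc 0 = 0" and sc_1 [simp]: "sc 1 = 1"
  by (rule lop_eqI; simp)+

lemma sc_add: "sc (s + t) = sc s + sc t" and sc_mult: "sc (s * t) = sc s * sc t"
  by (rule lop_eqI; simp add: pscale_add_left pscale_pscale)+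

lemma sc_uminus: "sc (- s) = - sc s"
  using sc_add[of s "- s"] by (simp add: eq_neg_iff_add_eq_0 add.commute)

lemma sc_diff: "sc (s - t) = sc s - sc t"
  using sc_add[of s "- t"] by (simp add: sc_uminus)

lemma sc_commute: "X * sc s = sc s * X"
  by (rule lop_eqI) (simp add: app_pscale)

lemma sc_left_commute: "X * (sc s * Y) = sc s * (X * Y)"
  by (metis sc_commute mult.assoc)

lemma sc_sum: "sc (sum f A) = (\<Sum>i\<in>A. sc (f i))"
  by (induction A rule: infinite_finite_induct) (simp_all add: sc_add)

lemma sc_of_nat: "sc (of_nat k) = of_nat k"
  by (induction k) (simp_all add: sc_add)

definition cm :: "lop \<Rightarrow> lop \<Rightarrow> lop" where
  "cm X Y = X * Y - Y * X"

lemma cm_simps [simp]: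
  "cm X 0 = 0" "cm 0 X = 0" "cm X X = 0" "cm 1 X = 0" "cm X 1 = 0"
  "cm (sc s) X = 0" "cm X (sc s) = 0"
  by (simp_all add: cm_def sc_commute)

lemma cm_add_left: "cm (X + Y) Z = cm X Z + cm Y Z"
  and cm_add_right: "cm Z (X + Y) = cm Z X + cm Z Y"
  and cm_diff_left: "cm (X - Y) Z = cm X Z - cm Y Z"
  and cm_diff_right: "cm Z (X - Y) = cm Z X - cm Z Y"
  and cm_minus_left: "cm (- X) Z = - cm X Z"
  and cm_minus_right: "cm Z (- X) = - cm Z X"
  by (simp_all add: cm_def algebra_simps)

lemmas cm_linear = cm_add_left cm_add_right cm_diff_left cm_diff_right cm_minus_left cm_minus_right

lemma cm_sc_left: "cm (sc s * X) Y = sc s * cm X Y"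
  and cm_sc_right: "cm X (sc s * Y) = sc s * cm X Y"
  by (simp_all add: cm_def algebra_simps sc_left_commute)

lemma cm_sum_left: "cm (sum F A) Y = (\<Sum>i\<in>A. cm (F i) Y)"
  and cm_sum_right: "cm Y (sum F A) = (\<Sum>i\<in>A. cm Y (F i))"
  by (induction A rule: infinite_finite_induct) (simp_all add: cm_linear)

lemma cm_if_left: "cm (if P then X else X') Y = (if P then cm X Y else cm X' Y)"
  and cm_if_right: "cm Y (if P then X else X') = (if P then cm Y X else cm Y X')"
  by simp_all

lemma cm_swap: "cm Y X = - cm X Y"
  by (simp add: cm_def)

lemma cm_mult_left: "cm (X * Y) Z = X * cm Y Z + cm X Z * Y"
  by (simp add: cm_def algebra_simps)

lemma cm_jacobi: "cm X (cm Y Z) = cm (cm X Y) Z + cm Y (cm X Z)"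
  by (simp add: cm_def algebra_simps)

lemma cm_eq_0_iff: "cm X Y = 0 \<longleftrightarrow> X * Y = Y * X"
  by (simp add: cm_def)


section \<open>Locally finite sums of operators\<close>

definition lf :: "('i \<Rightarrow> lop) \<Rightarrow> bool" where
  "lf F \<longleftrightarrow> (\<forall>v. finite {i. app (F i) v \<noteq> 0})"

text \<open>Infinite sums over modes are taken vector by vector, with 0 as default for families that
  are not locally finite. Reindexing cannot be spoilt by the default, since both families are
  locally finite or neither is.\<close>

lift_definition lsum :: "('i \<Rightarrow> lop) \<Rightarrow> lop" is
  "\<lambda>F v. if lf F then Sum_any (\<lambda>i. app (F i) v) else 0"
proof -
  fix F :: "'i \<Rightarrow> lop"
  show "linop (\<lambda>v. if lf F then Sum_any (\<lambda>i. app (F i) v) else 0)"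
  proof (cases "lf F")
    case True
    then have fin: "finite {i. app (F i) v \<noteq> 0}" for v by (simp add: lf_def)
    have "Sum_any (\<lambda>i. app (F i) (pscale s v)) = pscale s (Sum_any (\<lambda>i. app (F i) v))" for s v
    proof -
      have "Sum_any (\<lambda>i. app (F i) (pscale s v)) =
          (\<Sum>i\<in>{i. app (F i) v \<noteq> 0}. app (F i) (pscale s v))"
        by (rule Sum_any.expand_superset) (auto simp: fin app_pscale)
      also have "\<dots> = app (sc s) (\<Sum>i\<in>{i. app (F i) v \<noteq> 0}. app (F i) v)"
        by (subst app_sum) (simp add: app_pscale)
      finally show ?thesis by (simp add: Sum_any.expand_set)
    qed
    then show ?thesis
      using True by (simp add: linop_def app_add Sum_any.distrib[OF fin fin])
  qed (simp add: linop_def)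
qed

lemma lfD: "lf F \<Longrightarrow> finite {i. app (F i) v \<noteq> 0}"
  by (simp add: lf_def)

lemma app_lsum: "lf F \<Longrightarrow> app (lsum F) v = Sum_any (\<lambda>i. app (F i) v)"
  by transfer simp

lemma app_Sum_any: "finite {i. g i \<noteq> 0} \<Longrightarrow> app Y (Sum_any g) = Sum_any (\<lambda>i. app Y (g i))"
  by (subst Sum_any.expand_superset[of "{i. g i \<noteq> 0}" "\<lambda>i. app Y (g i)"])
    (auto simp: Sum_any.expand_set app_sum)

lemma lf_0 [simp]: "lf (\<lambda>i. 0)"
  by (simp add: lf_def)

lemma lf_mult_right: "lf F \<Longrightarrow> lf (\<lambda>i. F i * Y)"
  by (simp add: lf_def)

lemma lf_mult_left: "lf F \<Longrightarrow> lf (\<lambda>i. Y * F i)"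
  unfolding lf_def by (metis (mono_tags, lifting) app_0 app_simps(6) finite_subset mem_Collect_eq subsetI)

lemma lf_add: "lf F \<Longrightarrow> lf G \<Longrightarrow> lf (\<lambda>i. F i + G i)"
  unfolding lf_def
proof
  fix v assume "\<forall>v. finite {i. app (F i) v \<noteq> 0}" "\<forall>v. finite {i. app (G i) v \<noteq> 0}"
  then have "finite ({i. app (F i) v \<noteq> 0} \<union> {i. app (G i) v \<noteq> 0})" by simp
  then show "finite {i. app (F i + G i) v \<noteq> 0}" by (rule finite_subset[rotated]) auto
qed

lemma lf_minus: "lf F \<Longrightarrow> lf (\<lambda>i. - F i)"
  by (simp add: lf_def)

lemma lf_diff: "lf F \<Longrightarrow> lf G \<Longrightarrow> lf (\<lambda>i. F i - G i)"
  using lf_add[OF _ lf_minus, of F G] by simp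

lemma lf_finite: "finite {i. F i \<noteq> 0} \<Longrightarrow> lf F"
  unfolding lf_def
proof
  fix v assume "finite {i. F i \<noteq> 0}"
  then show "finite {i. app (F i) v \<noteq> 0}" by (rule finite_subset[rotated]) auto
qed

text \<open>Serves to change the normal ordering rule at finitely many modes.\<close>

lemma lf_cong_finite:
  assumes "lf F" "finite {i. F i \<noteq> G i}"
  shows "lf G"
proof -
  have "{i. G i - F i \<noteq> 0} = {i. F i \<noteq> G i}" by auto
  then show ?thesis using lf_add[OF assms(1) lf_finite, of "\<lambda>i. G i - F i"] assms(2) by simp
qed

lemma lsum_0 [simp]: "lsum (\<lambda>i. 0) = 0"
  by (rule lop_eqI) (simp add: app_lsum)

lemma lsum_mult_right: "lf F \<Longrightarrow> lsum F * Y = lsum (\<lambda>i. F i * Y)"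
  by (rule lop_eqI) (simp add: app_lsum lf_mult_right)

lemma lsum_mult_left: "lf F \<Longrightarrow> Y * lsum F = lsum (\<lambda>i. Y * F i)"
  by (rule lop_eqI) (simp add: app_lsum lf_mult_left app_Sum_any lfD)

lemma lsum_add: "lf F \<Longrightarrow> lf G \<Longrightarrow> lsum (\<lambda>i. F i + G i) = lsum F + lsum G"
  by (rule lop_eqI) (simp add: app_lsum lf_add Sum_any.distrib lfD)

lemma lsum_minus: "lf F \<Longrightarrow> lsum (\<lambda>i. - F i) = - lsum F"
  using lsum_mult_left[of F "- 1"] by simp

lemma lsum_diff: "lf F \<Longrightarrow> lf G \<Longrightarrow> lsum (\<lambda>i. F i - G i) = lsum F - lsum G"
  using lsum_add[OF _ lf_minus, of F G] by (simp add: lsum_minus)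

lemma lsum_finite: "finite A \<Longrightarrow> (\<And>i. i \<notin> A \<Longrightarrow> F i = 0) \<Longrightarrow> lsum F = sum F A"
proof (rule lop_eqI)
  fix v assume A: "finite A" "\<And>i. i \<notin> A \<Longrightarrow> F i = 0"
  then have "lf F" by (intro lf_finite finite_subset[OF _ A(1)]) auto
  then have "app (lsum F) v = Sum_any (\<lambda>i. app (F i) v)" by (rule app_lsum)
  also have "\<dots> = (\<Sum>i\<in>A. app (F i) v)"
    by (rule Sum_any.expand_superset) (use A in \<open>auto, metis app_simps(1)\<close>)
  finally show "app (lsum F) v = app (sum F A) v" by (simp add: app_sum_left)
qed

lemma lsum_delta [simp]: "lsum (\<lambda>i. if i = c then F i else 0) = F c"
  by (subst lsum_finite[of "{c}"]) auto

lemma lf_reindex: "bij h \<Longrightarrow> lf (\<lambda>i. F (h i)) \<longleftrightarrow> lf F"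
proof -
  assume h: "bij h"
  have "{i. app (F (h i)) v \<noteq> 0} = h -` {i. app (F i) v \<noteq> 0}" for v by auto
  moreover have "finite (h -` A) \<longleftrightarrow> finite A" for A
    using h by (metis bij_betw_def finite_imageI finite_vimageI surj_image_vimage_eq)
  ultimately show ?thesis unfolding lf_def by metis
qed

lemma lsum_reindex: "bij h \<Longrightarrow> lsum (\<lambda>i. F (h i)) = lsum F"
proof -
  assume h: "bij h"
  have "Sum_any (\<lambda>i. app (F (h i)) v) = Sum_any (\<lambda>i. app (F i) v)" for v
    using h by (intro Sum_any.reindex_cong[of h, symmetric]) (auto simp: bij_def comp_def)
  then show ?thesis
    by (intro lop_eqI; cases "lf F") (simp_all add: app_lsum lf_reindex[OF h] lsum.rep_eq)
qed

lemma lf_cm_left: "lf F \<Longrightarrow> lf (\<lambda>i. cm (F i) Y)"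
  unfolding cm_def by (intro lf_diff lf_mult_left lf_mult_right)

lemma cm_lsum_left: "lf F \<Longrightarrow> cm (lsum F) Y = lsum (\<lambda>i. cm (F i) Y)"
  by (simp add: cm_def lsum_mult_left lsum_mult_right lsum_diff lf_mult_left lf_mult_right)

section \<open>Adding one column of free fields\<close>

lemma sc_of_int: "sc (of_int k) = of_int k"
proof (cases k)
  case (nonneg n) then show ?thesis by (simp add: sc_of_nat)
next
  case (neg n)
  then have "sc (of_int k) = - sc (of_nat (Suc n))" by (simp flip: sc_uminus)
  then show ?thesis using neg by (simp add: sc_of_nat del: of_nat_Suc)
qed

lemma bij_int_plus: "bij (\<lambda>j :: int. m + j)"
  by (rule o_bij[of "\<lambda>j. j - m"]) (auto simp: fun_eq_iff)

text \<open>The condition known from smooth modules of affine algebras: high modes kill each vector.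
  It is weaker than \<open>lf\<close>, so products of smooth fields need normal ordering to
  converge.\<close>

definition smooth :: "(int \<Rightarrow> lop) \<Rightarrow> bool" where
  "smooth F \<longleftrightarrow> (\<forall>v. \<exists>M. \<forall>m > M. app (F m) v = 0)"

lemma smooth_0 [simp]: "smooth (\<lambda>m. 0)"
  by (simp add: smooth_def)

lemma smooth_add: "smooth F \<Longrightarrow> smooth G \<Longrightarrow> smooth (\<lambda>m. F m + G m)"
  unfolding smooth_def
proof
  fix v assume "\<forall>v. \<exists>M. \<forall>m>M. app (F m) v = 0" "\<forall>v. \<exists>M. \<forall>m>M. app (G m) v = 0"
  then obtain M M' where "\<forall>m>M. app (F m) v = 0" "\<forall>m>M'. app (G m) v = 0" by meson
  then have "\<forall>m > max M M'. app (F m + G m) v = 0" by simp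
  then show "\<exists>M. \<forall>m>M. app (F m + G m) v = 0" by blast
qed

lemma smooth_mult_left: "smooth F \<Longrightarrow> smooth (\<lambda>m. Z m * F m)"
  unfolding smooth_def by (metis app_0 app_simps(6))

lemma smooth_mult_right: "smooth F \<Longrightarrow> smooth (\<lambda>m. F m * Z)"
  by (simp add: smooth_def)

lemma smooth_minus: "smooth F \<Longrightarrow> smooth (\<lambda>m. - F m)"
  by (simp add: smooth_def)

lemma smooth_diff: "smooth F \<Longrightarrow> smooth G \<Longrightarrow> smooth (\<lambda>m. F m - G m)"
  using smooth_add[OF _ smooth_minus, of F G] by simp

lemma smooth_sum: "(\<And>i. i \<in> A \<Longrightarrow> smooth (F i)) \<Longrightarrow> smooth (\<lambda>m. \<Sum>i\<in>A. F i m)"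
  by (induction A rule: infinite_finite_induct) (simp_all add: smooth_add)

lemma smooth_cm: "smooth F \<Longrightarrow> smooth (\<lambda>m. cm (F m) Z)"
  unfolding cm_def by (intro smooth_diff smooth_mult_left smooth_mult_right)

lemma smooth_shift:
  assumes "smooth F" shows "smooth (\<lambda>m. F (m + l))"
  unfolding smooth_def
proof
  fix v
  obtain M where "\<forall>m>M. app (F m) v = 0" using assms unfolding smooth_def by blast
  then have "\<forall>m > M - l. app (F (m + l)) v = 0" by simp
  then show "\<exists>M. \<forall>m>M. app (F (m + l)) v = 0" by blast
qed

text \<open>\<open>R p q m\<close> stands for the matrix unit E_pq at t^m. The two conditions in the
  central term are the values of tr(E_pq E_st) and tr(E_pq) tr(E_st).\<close>

definition gl_currents :: "nat \<Rightarrow> complex \<Rightarrow> complex \<Rightarrow> (nat \<Rightarrow> nat \<Rightarrow> int \<Rightarrow> lop) \<Rightarrow> bool" where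
  "gl_currents N \<kappa> \<mu> R \<longleftrightarrow> (\<forall>p\<in>{1..N}. \<forall>q\<in>{1..N}. \<forall>s\<in>{1..N}. \<forall>t\<in>{1..N}. \<forall>m l.
     cm (R p q m) (R s t l) = (if q = s then R p t (m + l) else 0) - (if p = t then R s q (m + l) else 0)
       + (if m + l = 0 then sc (of_int m * ((if q = s \<and> p = t then \<kappa> else 0)
           + (if p = q \<and> s = t then \<mu> else 0))) else 0))"

text \<open>
  Here the ordering is decided by the mode \<open>j\<close> of \<open>a\<^sup>*\<close> (the factor \<open>X\<close>), whereas \<open>nord\<close> in \<open>aas\<close>
  uses the mode of \<open>a\<close>. The results agree because \<open>a\<^bsub>i\<^esub>\<close> and \<open>a\<^sup>*\<^bsub>j\<^esub>\<close> commute unless \<open>i + j = 0\<close>.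
\<close>

definition ordered :: "bool \<Rightarrow> int \<Rightarrow> lop \<Rightarrow> lop \<Rightarrow> lop" where
  "ordered std j X Y = (if std \<and> j \<le> 0 then X * Y else Y * X)"

lemma ordered_simps [simp]: "ordered std j 0 Y = 0" "ordered std j X 0 = 0"
  "ordered std j (- X) Y = - ordered std j X Y" "ordered std j X (- Y) = - ordered std j X Y"
  by (simp_all add: ordered_def)

lemma ordered_add_right: "ordered std j X (Y + Z) = ordered std j X Y + ordered std j X Z"
  by (simp add: ordered_def algebra_simps)

definition nprod :: "bool \<Rightarrow> (int \<Rightarrow> lop) \<Rightarrow> (int \<Rightarrow> lop) \<Rightarrow> int \<Rightarrow> lop" where
  "nprod std X Y m = lsum (\<lambda>j. ordered std j (X j) (Y (m - j)))"

text \<open>The condition for a product with \<open>d\<close> to converge. With \<open>std\<close>,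
  the terms with j far below 0 vanish only because high modes of \<open>Y\<close> do. Otherwise
  \<open>d\<close> acts first and is itself locally finite; \<open>Y\<close> must then be arbitrary,
  because the \<open>a\<close> of such a column are multiplications and not smooth.\<close>

definition admissible :: "bool \<Rightarrow> (int \<Rightarrow> lop) \<Rightarrow> bool" where
  "admissible std Y \<longleftrightarrow> (std \<longrightarrow> smooth Y)"

text \<open>\<open>std\<close> tells whether modes of \<open>a\<close> with m \<ge> 0 are
  annihilators. Apart from commutation relations and convergence, \<open>charge_uniq\<close> is the
  only fact about the polynomial realisation that the brackets rely on.\<close>

locale column =
  fixes N :: nat and std :: bool
    and a d :: "nat \<Rightarrow> int \<Rightarrow> lop"
    and K :: lop
  assumes cm_a_a: "cm (a p m) (a q l) = 0"
    and cm_d_d: "cm (d p m) (d q l) = 0"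
    and cm_a_d: "cm (a p m) (d q l) = (if p = q \<and> m + l = 0 then 1 else 0)"
    and smooth_a: "std \<Longrightarrow> smooth (a p)"
    and smooth_d: "smooth (d p)"
    and lf_d: "\<not> std \<Longrightarrow> lf (d p)"
    and cm_K_a: "p \<in> {1..N} \<Longrightarrow> cm K (a p m) = - a p m"
    and cm_K_d: "p \<in> {1..N} \<Longrightarrow> cm K (d p m) = d p m"
    and charge_uniq: "0 < c \<Longrightarrow> cm K X = of_nat c * X \<Longrightarrow>
      (\<And>p m. p \<in> {1..N} \<Longrightarrow> cm (a p m) X = 0) \<Longrightarrow> X = 0"
begin

abbreviation ord :: "int \<Rightarrow> lop \<Rightarrow> lop \<Rightarrow> lop" where
  "ord \<equiv> ordered std"

abbreviation wick :: "nat \<Rightarrow> (int \<Rightarrow> lop) \<Rightarrow> int \<Rightarrow> lop" where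
  "wick q \<equiv> nprod std (d q)"

abbreviation adm :: "(int \<Rightarrow> lop) \<Rightarrow> bool" where
  "adm \<equiv> admissible std"

lemma adm_intros: "adm (\<lambda>i. 0)" "adm Y \<Longrightarrow> adm Z \<Longrightarrow> adm (\<lambda>i. Y i + Z i)" "adm Y \<Longrightarrow> adm (\<lambda>i. - Y i)"
  "adm Y \<Longrightarrow> adm (\<lambda>i. cm (Y i) Z')" "adm Y \<Longrightarrow> adm (\<lambda>i. cm Z' (Y i))" "adm (a p)" "adm (d p)"
  "adm Y \<Longrightarrow> adm Z \<Longrightarrow> adm (\<lambda>i. Y i - Z i)"
  using smooth_minus[OF smooth_cm, of Y Z']
  by (auto simp: admissible_def smooth_add smooth_minus smooth_diff smooth_cm smooth_a smooth_d cm_swap[of _ Z'])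

lemma lf_ord: "adm Y \<Longrightarrow> lf (\<lambda>j. ord j (d q j) (Y (m - j)))"
proof (cases std)
  case False
  have "{j. app (ord j (d q j) (Y (m - j))) v \<noteq> 0} \<subseteq> {j. app (d q j) v \<noteq> 0}" for v
    using False by (auto simp: ordered_def)
  then show ?thesis
    using lf_d[OF False, of q] unfolding lf_def by (blast intro: finite_subset)
next
  case True
  assume "adm Y"
  then have Y: "smooth Y" using True by (simp add: admissible_def)
  show ?thesis
    unfolding lf_def
  proof
    fix v
    obtain M where M: "\<And>j. j > M \<Longrightarrow> app (d q j) v = 0" using smooth_d unfolding smooth_def by meson
    obtain M' where M': "\<And>j. j > M' \<Longrightarrow> app (Y j) v = 0" using Y unfolding smooth_def by meson
    have "{j. app (ord j (d q j) (Y (m - j))) v \<noteq> 0} \<subseteq> {min 0 (m - M')..max 0 M}"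
    proof
      fix j assume j: "j \<in> {j. app (ord j (d q j) (Y (m - j))) v \<noteq> 0}"
      show "j \<in> {min 0 (m - M')..max 0 M}"
      proof (cases "j \<le> 0")
        case True
        then have "\<not> m - j > M'" using j M' \<open>std\<close> by (auto simp: ordered_def)
        then show ?thesis using True by simp
      next
        case False
        then have "\<not> j > M" using j M by (auto simp: ordered_def)
        then show ?thesis using False by simp
      qed
    qed
    then show "finite {j. app (ord j (d q j) (Y (m - j))) v \<noteq> 0}" by (rule finite_subset) simp
  qed
qed

lemma smooth_wick:
  assumes std and "smooth Y"
  shows "smooth (wick q Y)"
  unfolding smooth_def
proof
  fix v
  have Y: "adm Y" using assms unfolding admissible_def by blast
  obtain M where M: "\<And>j. j > M \<Longrightarrow> app (d q j) v = 0" using smooth_d unfolding smooth_def by meson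
  have "\<forall>v. \<exists>M. \<forall>j > M. app (Y j) v = 0" using assms unfolding smooth_def by simp
  then obtain f where f: "\<And>v j. j > f v \<Longrightarrow> app (Y j) v = 0" by metis
  \<comment> \<open>For j \<le> 0 the mode of \<open>Y\<close> meets \<open>v\<close> itself, for 1
    \<le> j \<le> M it meets \<open>app (d q j) v\<close>, and beyond \<open>M\<close> the factor
    \<open>d q j\<close> kills \<open>v\<close>. So finitely many bounds suffice.\<close>
  define T where "T = Max (insert (f v) ((\<lambda>j. f (app (d q j) v)) ` {1..M}))"
  have "app (wick q Y m) v = 0" if m: "m > T + \<bar>M\<bar>" for m
  proof -
    have "app (ord j (d q j) (Y (m - j))) v = 0" for j
    proof (cases "j \<le> 0")
      case True
      have "f v \<le> T" by (simp add: T_def)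
      then have "app (Y (m - j)) v = 0" using True m by (intro f) simp
      then show ?thesis using True \<open>std\<close> by (simp add: ordered_def)
    next
      case j: False
      show ?thesis
      proof (cases "j \<le> M")
        case True
        then have "f (app (d q j) v) \<le> T" using j unfolding T_def by (intro Max_ge) auto
        then have "app (Y (m - j)) (app (d q j) v) = 0" using True m by (intro f) simp
        then show ?thesis using j by (simp add: ordered_def)
      next
        case False
        then show ?thesis using j M by (simp add: ordered_def)
      qed
    qed
    then show ?thesis by (simp add: nprod_def app_lsum lf_ord[OF Y])
  qed
  then show "\<exists>M. \<forall>m>M. app (wick q Y m) v = 0" by blast
qed

lemma adm_wick: "adm Y \<Longrightarrow> adm (wick q Y)"
  unfolding admissible_def using smooth_wick by blast

lemma adm_sum: "(\<And>i. i \<in> A \<Longrightarrow> adm (F i)) \<Longrightarrow> adm (\<lambda>m. \<Sum>i\<in>A. F i m)"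
  by (simp add: admissible_def smooth_sum)

lemma wick_0 [simp]: "wick q (\<lambda>i. 0) m = 0"
  by (simp add: nprod_def)

lemma wick_minus: "adm Y \<Longrightarrow> wick q (\<lambda>i. - Y i) m = - wick q Y m"
  by (simp add: nprod_def lsum_minus lf_ord)

lemma wick_add: "adm Y \<Longrightarrow> adm Z \<Longrightarrow> wick q (\<lambda>i. Y i + Z i) m = wick q Y m + wick q Z m"
  by (simp add: nprod_def ordered_add_right lsum_add lf_ord)

lemma wick_diff: "adm Y \<Longrightarrow> adm Z \<Longrightarrow> wick q (\<lambda>i. Y i - Z i) m = wick q Y m - wick q Z m"
  using wick_add[OF _ adm_intros(3), of Y Z] by (simp add: wick_minus)

lemma wick_shift: "wick q (\<lambda>i. Y (i + l)) m = wick q Y (m + l)"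
  by (simp add: nprod_def algebra_simps)

lemma cm_wick_left:
  assumes "adm Y"
  shows "cm (wick q Y m) Z =
    wick q (\<lambda>i. cm (Y i) Z) m + lsum (\<lambda>j. ord j (cm (d q j) Z) (Y (m - j)))"
proof -
  have 1: "cm (wick q Y m) Z = lsum (\<lambda>j. cm (ord j (d q j) (Y (m - j))) Z)"
    unfolding nprod_def by (rule cm_lsum_left[OF lf_ord[OF assms]])
  have 2: "cm (ord j (d q j) (Y (m - j))) Z =
      ord j (d q j) (cm (Y (m - j)) Z) + ord j (cm (d q j) Z) (Y (m - j))" for j
    by (simp add: ordered_def cm_mult_left)
  have l1: "lf (\<lambda>j. ord j (d q j) (cm (Y (m - j)) Z))"
    by (rule lf_ord[OF adm_intros(4)[OF assms]])
  \<comment> \<open>\<open>lf_ord\<close> does not cover the family with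
    \<open>cm (d q j) Z\<close>; it is locally finite as a difference of two families that
    are.\<close>
  have "lf (\<lambda>j. cm (ord j (d q j) (Y (m - j))) Z)" by (rule lf_cm_left[OF lf_ord[OF assms]])
  then have "lf (\<lambda>j. ord j (cm (d q j) Z) (Y (m - j)))"
    using lf_diff[OF _ l1, of "\<lambda>j. ord j (d q j) (cm (Y (m - j)) Z) + ord j (cm (d q j) Z) (Y (m - j))"]
    unfolding 2 by simp
  from lsum_add[OF l1 this] show ?thesis unfolding 1 2 by (simp add: nprod_def)
qed

lemma cm_wick_left_0:
  assumes "adm Y" "\<And>j. cm (d q j) Z = 0"
  shows "cm (wick q Y m) Z = wick q (\<lambda>i. cm (Y i) Z) m"
  using assms by (simp add: cm_wick_left)

section \<open>Single and double contractions within one column\<close>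

lemma cm_d_a: "cm (d q l) (a p m) = - (if p = q \<and> m + l = 0 then 1 else 0)"
  by (subst cm_swap) (simp add: cm_a_d)

lemma cm_wick_a:
  assumes "adm Y"
  shows "cm (wick q Y m) (a p l) =
    wick q (\<lambda>i. cm (Y i) (a p l)) m - (if q = p then Y (m + l) else 0)"
proof -
  have "ord j (cm (d q j) (a p l)) (Y (m - j)) =
      (if j = - l then - (if q = p then Y (m + l) else 0) else 0)" for j
    by (auto simp: ordered_def cm_d_a)
  then show ?thesis by (simp add: cm_wick_left[OF assms])
qed

text \<open>As \<open>a s\<close> is to represent E_(N+1,s), the relation [E_qp, E_(N+1,s)] =
  -\<delta>_qs E_(N+1,p) dictates this bilinear term; compare \<open>cm_Q_a\<close>.\<close>

definition Q :: "nat \<Rightarrow> nat \<Rightarrow> int \<Rightarrow> lop" where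
  "Q q p m = wick q (a p) m"

lemma adm_Q: "adm (Q q p)"
  by (simp add: Q_def[abs_def] adm_wick adm_intros)

lemma cm_Q_a: "cm (Q q p m) (a s l) = - (if q = s then a p (m + l) else 0)"
  by (simp add: Q_def cm_wick_a adm_intros cm_a_a)

lemma cm_a_Q: "cm (a s l) (Q q p m) = (if q = s then a p (l + m) else 0)"
  by (subst cm_swap) (simp add: cm_Q_a add.commute)

lemma cm_Q_d: "cm (Q q p m) (d s l) = (if p = s then d q (m + l) else 0)"
proof -
  have "ord j (d q j) (cm (a p (m - j)) (d s l)) =
      (if j = m + l then if p = s then d q (m + l) else 0 else 0)" for j
    by (auto simp: ordered_def cm_a_d)
  then have "wick q (\<lambda>i. cm (a p i) (d s l)) m = (if p = s then d q (m + l) else 0)"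
    by (simp add: nprod_def)
  then show ?thesis by (simp add: Q_def cm_wick_left_0 adm_intros cm_d_d)
qed

text \<open>A signed count of the modes between the thresholds 0 and \<open>m\<close>, where two
  ordering rules disagree; the window contains both thresholds.\<close>

lemma sum_le_diff: "(\<Sum>j\<in>{- \<bar>m\<bar>..\<bar>m\<bar>}. (if j \<le> 0 then 1 else 0) - (if j \<le> m then 1 else 0) :: int) = - m"
proof -
  have "(\<Sum>j\<in>{- \<bar>m\<bar>..\<bar>m\<bar>}. (if j \<le> k then 1 else 0) :: int) = k + \<bar>m\<bar> + 1" if "\<bar>k\<bar> \<le> \<bar>m\<bar>" for k
  proof -
    have "(\<Sum>j\<in>{- \<bar>m\<bar>..\<bar>m\<bar>}. (if j \<le> k then 1 else 0) :: int) = (\<Sum>j\<in>{- \<bar>m\<bar>..k}. 1)"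
      using that by (intro sum.mono_neutral_cong_right) auto
    also have "\<dots> = k + \<bar>m\<bar> + 1" using that by simp
    finally show ?thesis .
  qed
  from this[of 0] this[of m] show ?thesis by (simp add: sum_subtractf)
qed

(* Normal ordering by the sign of j and of j - m differ in finitely many terms, each off by a commutator 1. *)
lemma lsum_ord_shift:
  "lsum (\<lambda>j. ord j (d q (m + j)) (a t (l - j))) =
     Q q t (m + l) + (if std \<and> q = t \<and> m + l = 0 then sc (- of_int m) else 0)"
proof -
  define W where "W \<longleftrightarrow> std \<and> q = t \<and> m + l = 0"
  define \<epsilon> :: "int \<Rightarrow> int" where "\<epsilon> j = (if W then (if j \<le> 0 then 1 else 0) - (if j \<le> m then 1 else 0) else 0)" for j
  have fin: "\<epsilon> j = 0" if "j \<notin> {- \<bar>m\<bar>..\<bar>m\<bar>}" for j using that by (auto simp: \<epsilon>_def)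
  have sub: "{j. of_int (\<epsilon> j) \<noteq> (0 :: lop)} \<subseteq> {- \<bar>m\<bar>..\<bar>m\<bar>}" 
  proof (rule subsetI)
    fix j assume "j \<in> {j. of_int (\<epsilon> j) \<noteq> (0 :: lop)}"
    then have "\<epsilon> j \<noteq> 0" by auto
    then show "j \<in> {- \<bar>m\<bar>..\<bar>m\<bar>}" using fin by blast
  qed
  have ad: "a t (m + l - j) * d q j = d q j * a t (m + l - j) + (if t = q \<and> m + l = 0 then 1 else 0)" for j
    using cm_a_d[of t "m + l - j" q j] by (simp add: cm_def algebra_simps)
  have "ord (j - m) (d q j) (a t (m + l - j)) = ord j (d q j) (a t (m + l - j)) + of_int (\<epsilon> j)" for j
    by (auto simp: ordered_def \<epsilon>_def W_def ad)
  moreover have "lsum (\<lambda>j. ord j (d q (m + j)) (a t (l - j))) =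
      lsum (\<lambda>j. ord (j - m) (d q j) (a t (m + l - j)))"
    using lsum_reindex[OF bij_int_plus, of "\<lambda>j. ord (j - m) (d q j) (a t (m + l - j))" m]
    by (simp add: algebra_simps)
  moreover have "lsum (\<lambda>j. of_int (\<epsilon> j)) = (if W then sc (- of_int m) else 0)"
  proof -
    have "lsum (\<lambda>j. of_int (\<epsilon> j)) = (of_int (\<Sum>j\<in>{- \<bar>m\<bar>..\<bar>m\<bar>}. \<epsilon> j) :: lop)"
      unfolding of_int_sum by (rule lsum_finite) (auto simp: fin)
    also have "(\<Sum>j\<in>{- \<bar>m\<bar>..\<bar>m\<bar>}. \<epsilon> j) = (if W then - m else 0)"
      using sum_le_diff[of m] by (cases W) (simp_all add: \<epsilon>_def)
    finally show ?thesis by (simp add: sc_uminus sc_of_int)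
  qed
  ultimately show ?thesis
    by (simp add: lsum_add lf_ord adm_intros lf_finite[OF finite_subset[OF sub]] Q_def nprod_def W_def)
qed

text \<open>Of the two single contractions, one leaves a product that is ordered correctly, the
  other a product ordered at a shifted threshold. Restoring the order is the double contraction,
  evaluated by \<open>lsum_ord_shift\<close>. Without \<open>std\<close> there is no threshold and
  hence no central term.\<close>

lemma cm_Q_Q:
  "cm (Q q p m) (Q s t l) = (if p = s then Q q t (m + l) else 0) - (if q = t then Q s p (m + l) else 0)
     + (if std \<and> p = s \<and> q = t \<and> m + l = 0 then sc (- of_int m) else 0)"
proof -
  have "cm (Q s t l) (Q q p m) = wick s (\<lambda>i. cm (a t i) (Q q p m)) l
      + lsum (\<lambda>j. ord j (cm (d s j) (Q q p m)) (a t (l - j)))"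
    by (simp add: Q_def[of s] cm_wick_left adm_intros)
  moreover have "wick s (\<lambda>i. cm (a t i) (Q q p m)) l = (if q = t then Q s p (m + l) else 0)"
    using wick_shift[of s "a p" m l]
    by (simp add: cm_a_Q) (simp add: Q_def add.commute)
  moreover have "lsum (\<lambda>j. ord j (cm (d s j) (Q q p m)) (a t (l - j))) =
      - (if p = s then Q q t (m + l) + (if std \<and> q = t \<and> m + l = 0 then sc (- of_int m) else 0) else 0)"
  proof (cases "p = s")
    case True
    have "lf (\<lambda>j. ord j (cm (d s j) (Q q p m)) (a t (l - j)))"
    proof -
      \<comment> \<open>After reindexing, the ordering threshold is at \<open>m\<close> instead of
        0, which affects finitely many terms of a locally finite family.\<close>
      have "lf (\<lambda>j. ord (j - m) (d q j) (a t (m + l - j)))"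
      proof (rule lf_cong_finite[OF lf_ord[of "a t" q "m + l"]])
        show "adm (a t)" by (rule adm_intros)
        have "{j. ord j (d q j) (a t (m + l - j)) \<noteq> ord (j - m) (d q j) (a t (m + l - j))} \<subseteq> {- \<bar>m\<bar>..\<bar>m\<bar>}"
          by (auto simp: ordered_def split: if_splits)
        then show "finite {j. ord j (d q j) (a t (m + l - j)) \<noteq> ord (j - m) (d q j) (a t (m + l - j))}"
          by (rule finite_subset) simp
      qed
      then have "lf (\<lambda>j. ord j (d q (m + j)) (a t (l - j)))"
        using lf_reindex[OF bij_int_plus, of "\<lambda>j. ord (j - m) (d q j) (a t (m + l - j))" m]
        by (simp add: algebra_simps)
      then have "lf (\<lambda>j. - ord j (d q (m + j)) (a t (l - j)))" by (rule lf_minus)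
      then show ?thesis using True by (simp add: cm_swap[of "d _ _" "Q _ _ _"] cm_Q_d)
    qed
    note * = lf_minus[OF this]
    have "ord j (cm (d s j) (Q q p m)) (a t (l - j)) = - ord j (d q (m + j)) (a t (l - j))" for j
      using True by (simp add: cm_swap[of "d _ _" "Q _ _ _"] cm_Q_d)
    then have "lsum (\<lambda>j. ord j (cm (d s j) (Q q p m)) (a t (l - j))) =
        - lsum (\<lambda>j. ord j (d q (m + j)) (a t (l - j)))"
      using * by (simp add: lsum_minus)
    then show ?thesis using True by (simp add: lsum_ord_shift)
  next
    case False
    then show ?thesis by (simp add: cm_swap[of "d _ _" "Q _ _ _"] cm_Q_d)
  qed
  ultimately show ?thesis
    using cm_swap[of "Q q p m" "Q s t l"] by simp
qed

text \<open>The free field current of the identity matrix of gl(N). Its double contractions are what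
  the brackets of \<open>B\<close> in \<open>column_step\<close> compensate.\<close>

definition C :: "int \<Rightarrow> lop" where
  "C m = (\<Sum>s=1..N. Q s s m)"

lemma adm_C: "adm C"
  unfolding C_def[abs_def] by (intro adm_sum adm_Q)

lemma cm_C_a: "p \<in> {1..N} \<Longrightarrow> cm (C m) (a p l) = - a p (m + l)"
  by (simp add: C_def cm_sum_left cm_Q_a sum_negf)

lemma cm_C_Q:
  assumes "q \<in> {1..N}" "p \<in> {1..N}"
  shows "cm (C m) (Q q p l) = (if std \<and> q = p \<and> m + l = 0 then sc (- of_int m) else 0)"
proof -
  have "(\<Sum>s=1..N. if std \<and> s = q \<and> s = p \<and> m + l = 0 then sc (- of_int m) else 0) =
      (\<Sum>s=1..N. if s = q then if std \<and> q = p \<and> m + l = 0 then sc (- of_int m) else 0 else 0)"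
    by (rule sum.cong) auto
  then show ?thesis using assms
    by (simp add: C_def cm_sum_left cm_Q_Q sum.distrib sum_subtractf)
qed

lemma cm_C_C: "cm (C m) (C l) = (if std \<and> m + l = 0 then sc (- of_int m * of_nat N) else 0)"
proof -
  have "cm (C m) (C l) = (\<Sum>s=1..N. if std \<and> m + l = 0 then sc (- of_int m) else 0)"
    unfolding C_def[of l] cm_sum_right by (rule sum.cong[OF refl]) (simp only: cm_C_Q simp_thms)
  also have "\<dots> = sc (of_nat N) * (if std \<and> m + l = 0 then sc (- of_int m) else 0)"
    by (simp add: sc_of_nat)
  finally show ?thesis by (simp add: mult.commute flip: sc_mult)
qed

lemma cm_K_wick:
  assumes "adm Y" and q: "q \<in> {1..N}"
  shows "(\<And>i. cm K (Y i) = 0) \<Longrightarrow> cm K (wick q Y m) = wick q Y m"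
    and "(\<And>i. cm K (Y i) = - Y i) \<Longrightarrow> cm K (wick q Y m) = 0"
proof -
  have *: "lsum (\<lambda>j. ord j (cm (d q j) K) (Y (m - j))) = - wick q Y m"
    using lsum_minus[OF lf_ord[OF assms(1)], of q m]
    by (simp add: cm_swap[of _ K] cm_K_d[OF q] nprod_def)
  show "cm K (wick q Y m) = wick q Y m" if "\<And>i. cm K (Y i) = 0"
    using that cm_wick_left[OF assms(1), of q m K] cm_swap[of _ K] * by simp
  show "cm K (wick q Y m) = 0" if "\<And>i. cm K (Y i) = - Y i"
    using that cm_wick_left[OF assms(1), of q m K] cm_swap[of _ K] * by simp
qed

lemma cm_K_Q: "q \<in> {1..N} \<Longrightarrow> p \<in> {1..N} \<Longrightarrow> cm K (Q q p m) = 0"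
  unfolding Q_def by (intro cm_K_wick adm_intros cm_K_a)

lemma cm_K_C: "cm K (C m) = 0"
  by (simp add: C_def cm_sum_right cm_K_Q)

end

section \<open>The induction step from gl(N) to gl(N + 1)\<close>

lemma if_diff_add:
  "((if P then a else 0) - (if P' then b else 0) + z) + ((if P then a' else 0) - (if P' then b' else 0) + z') =
    (if P then a + a' else 0) - (if P' then b + b' else 0) + (z + (z' :: lop))"
  by (cases P; cases P') (simp_all add: algebra_simps)

text \<open>The brackets of \<open>B\<close> are forced by the requirement that
  \<open>B m - C m\<close> represent E_(N+1,N+1). If \<open>std\<close> holds, \<open>C\<close>
  contributes -m to the bracket with each diagonal \<open>Q q q\<close> and -m N to the bracket with
  itself, and \<open>cm_B_J\<close> and \<open>cm_B_B\<close> cancel both.\<close>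

locale column_step = column +
  fixes J :: "nat \<Rightarrow> nat \<Rightarrow> int \<Rightarrow> lop" and B :: "int \<Rightarrow> lop" and \<kappa> \<mu> :: complex
  assumes cm_J_a: "cm (J q p m) (a s l) = 0" and cm_J_d: "cm (J q p m) (d s l) = 0"
    and cm_K_J: "cm K (J q p m) = 0"
    and cm_B_a: "cm (B m) (a s l) = 0" and cm_B_d: "cm (B m) (d s l) = 0"
    and cm_K_B: "cm K (B m) = 0"
    and smooth_J: "std \<Longrightarrow> smooth (J q p)" and smooth_B: "std \<Longrightarrow> smooth B"
    and J: "gl_currents N \<kappa> \<mu> J"
    and cm_B_J: "q \<in> {1..N} \<Longrightarrow> p \<in> {1..N} \<Longrightarrow> cm (B m) (J q p l) =
      (if m + l = 0 then sc (of_int m * (if q = p then \<mu> - of_bool std else 0)) else 0)"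
    and cm_B_B: "cm (B m) (B l) =
      (if m + l = 0 then sc (of_int m * (\<kappa> - of_bool std + \<mu> + of_nat N * of_bool std)) else 0)"
begin

definition \<kappa>' :: complex where
  "\<kappa>' = \<kappa> - of_bool std"

definition cur_G :: "nat \<Rightarrow> nat \<Rightarrow> int \<Rightarrow> lop" where
  "cur_G q p m = J q p m + Q q p m"

definition cur_D :: "int \<Rightarrow> lop" where
  "cur_D m = B m - C m"

text \<open>Each term accounts for one part of the bracket with \<open>a p l\<close> in
  \<open>cm_U_a\<close>: the first for \<open>Q q p\<close> and the \<open>C\<close> in
  \<open>cur_D\<close>, the second for \<open>J q p\<close>, the third for the \<open>B\<close> in
  \<open>cur_D\<close>, and the last, a mode of the derivative of a*, for the central term.\<close>

definition cur_U :: "nat \<Rightarrow> int \<Rightarrow> lop" where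
  "cur_U q m = - wick q C m - (\<Sum>s=1..N. wick s (J q s) m) + wick q B m
     - sc (\<kappa>' * of_int m) * d q m"

definition cur :: "nat \<Rightarrow> nat \<Rightarrow> int \<Rightarrow> lop" where
  "cur q p m =
     (if q = Suc N then if p = Suc N then cur_D m else a p m
      else if p = Suc N then cur_U q m else cur_G q p m)"

lemma adm_J: "adm (J q p)" and adm_B: "adm B"
  by (simp_all add: admissible_def smooth_J smooth_B)

lemma cm_J_Q: "cm (J q p m) (Q s t l) = 0" and cm_B_Q: "cm (B m) (Q s t l) = 0"
proof -
  have "cm (Q s t l) Z = 0" if "\<And>p m. cm (a p m) Z = 0" "\<And>p m. cm (d p m) Z = 0" for Z
    by (simp add: Q_def cm_wick_left_0 adm_intros that)
  from this[of "J q p m"] this[of "B m"] show "cm (J q p m) (Q s t l) = 0" "cm (B m) (Q s t l) = 0"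
    by (simp_all add: cm_swap[of _ "J _ _ _"] cm_swap[of _ "B _"] cm_J_a cm_J_d cm_B_a cm_B_d)
qed

lemma cm_J_C: "cm (J q p m) (C l) = 0" and cm_B_C: "cm (B m) (C l) = 0"
  by (simp_all add: C_def cm_sum_right cm_J_Q cm_B_Q)

lemma cm_G_G:
  assumes "q \<in> {1..N}" "p \<in> {1..N}" "s \<in> {1..N}" "t \<in> {1..N}"
  shows "cm (cur_G q p m) (cur_G s t l) =
    (if p = s then cur_G q t (m + l) else 0) - (if q = t then cur_G s p (m + l) else 0)
       + (if m + l = 0 then sc (of_int m * ((if p = s \<and> q = t then \<kappa>' else 0)
           + (if q = p \<and> s = t then \<mu> else 0))) else 0)"
proof -
  have QJ: "cm (Q q p m) (J s t l) = 0" by (subst cm_swap) (simp add: cm_J_Q)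
  have JJ: "cm (J q p m) (J s t l) = (if p = s then J q t (m + l) else 0) - (if q = t then J s p (m + l) else 0)
       + (if m + l = 0 then sc (of_int m * ((if p = s \<and> q = t then \<kappa> else 0)
           + (if q = p \<and> s = t then \<mu> else 0))) else 0)"
    using J assms unfolding gl_currents_def by blast
  have "cm (cur_G q p m) (cur_G s t l) = cm (J q p m) (J s t l) + cm (Q q p m) (Q s t l)"
    by (simp add: cur_G_def cm_linear cm_J_Q QJ)
  also have "\<dots> = (if p = s then cur_G q t (m + l) else 0) - (if q = t then cur_G s p (m + l) else 0)
      + ((if m + l = 0 then sc (of_int m * ((if p = s \<and> q = t then \<kappa> else 0)
           + (if q = p \<and> s = t then \<mu> else 0))) else 0)
        + (if std \<and> p = s \<and> q = t \<and> m + l = 0 then sc (- of_int m) else 0))"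
    unfolding JJ cm_Q_Q cur_G_def by (rule if_diff_add)
  also have "(if m + l = 0 then sc (of_int m * ((if p = s \<and> q = t then \<kappa> else 0)
           + (if q = p \<and> s = t then \<mu> else 0))) else 0)
        + (if std \<and> p = s \<and> q = t \<and> m + l = 0 then sc (- of_int m) else 0) =
      (if m + l = 0 then sc (of_int m * ((if p = s \<and> q = t then \<kappa>' else 0)
           + (if q = p \<and> s = t then \<mu> else 0))) else 0)"
    unfolding \<kappa>'_def
    by (cases "p = s"; cases "q = t"; cases "m + l = 0"; cases std; cases "s = t"; cases "q = p")
      (simp_all add: algebra_simps flip: sc_add)
  finally show ?thesis .
qed

lemma cm_a_G: "cm (a t i) (cur_G q p m) = (if q = t then a p (i + m) else 0)"
  using cm_swap[of "a t i" "J q p m"] by (simp add: cur_G_def cm_add_right cm_J_a cm_a_Q)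

lemma cm_a_D: "p \<in> {1..N} \<Longrightarrow> cm (a p l) (cur_D m) = - a p (m + l)"
  using cm_C_a[of p m l] cm_swap[of "a p l" "B m"] cm_swap[of "a p l" "C m"]
  by (simp add: cur_D_def cm_diff_right cm_B_a)

lemma cm_G_D:
  assumes "q \<in> {1..N}" "p \<in> {1..N}"
  shows "cm (cur_G q p m) (cur_D l) = (if m + l = 0 \<and> q = p then sc (of_int m * \<mu>) else 0)"
proof -
  have "cm (cur_D l) (cur_G q p m) = (if m + l = 0 \<and> q = p then sc (of_int l * \<mu>) else 0)"
    using assms cm_swap[of "C l" "J q p m"]
    by (auto simp: cur_D_def cur_G_def cm_linear cm_B_Q cm_J_C cm_C_Q cm_B_J algebra_simps sc_diff sc_uminus)
  then show ?thesis
    using cm_swap[of "cur_G q p m" "cur_D l"] by (auto simp: add_eq_0_iff simp flip: sc_uminus)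
qed

lemma cm_D_D: "cm (cur_D m) (cur_D l) = (if m + l = 0 then sc (of_int m * (\<kappa>' + \<mu>)) else 0)"
  using cm_swap[of "C m" "B l"]
  by (auto simp: cur_D_def cm_linear cm_B_C cm_B_B cm_C_C \<kappa>'_def algebra_simps sc_diff sc_uminus sc_add)

lemma cm_U_a:
  assumes p: "p \<in> {1..N}"
  shows "cm (cur_U q m) (a p l) = cur_G q p (m + l) - (if q = p then cur_D (m + l) else 0)
    + (if q = p \<and> m + l = 0 then sc (of_int m * \<kappa>') else 0)"
proof -
  have 1: "cm (wick q C m) (a p l) = - Q q p (m + l) - (if q = p then C (m + l) else 0)"
  proof -
    have "adm (\<lambda>i. a p (i + l))" by (simp add: admissible_def smooth_shift smooth_a)
    then show ?thesis
      using p wick_shift[of q "a p" l m] by (simp add: cm_wick_a adm_C cm_C_a wick_minus Q_def)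
  qed
  have 2: "(\<Sum>s=1..N. cm (wick s (J q s) m) (a p l)) = - J q p (m + l)"
  proof -
    have "(\<Sum>s=1..N. cm (wick s (J q s) m) (a p l)) = (\<Sum>s=1..N. if s = p then - J q p (m + l) else 0)"
      by (rule sum.cong) (auto simp: cm_wick_a adm_J cm_J_a)
    then show ?thesis using p by simp
  qed
  have 3: "cm (wick q B m) (a p l) = - (if q = p then B (m + l) else 0)"
    by (simp add: cm_wick_a adm_B cm_B_a)
  show ?thesis
    by (simp add: cur_U_def cm_linear cm_sum_left cm_sc_left 1 2 3 cm_d_a cur_G_def cur_D_def mult.commute
        add.commute del: One_nat_def)
qed

lemma cm_a_U:
  assumes "p \<in> {1..N}"
  shows "cm (a p l) (cur_U q m) = - cur_G q p (m + l) + (if q = p then cur_D (m + l) else 0)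
    - (if q = p \<and> m + l = 0 then sc (of_int m * \<kappa>') else 0)"
  by (subst cm_swap) (simp add: cm_U_a[OF assms])

lemma cm_K_G: "q \<in> {1..N} \<Longrightarrow> p \<in> {1..N} \<Longrightarrow> cm K (cur_G q p m) = 0"
  and cm_K_D: "cm K (cur_D m) = 0"
  by (simp_all add: cur_G_def cur_D_def cm_linear cm_K_J cm_K_Q cm_K_B cm_K_C)

lemma cm_K_U: "q \<in> {1..N} \<Longrightarrow> cm K (cur_U q m) = cur_U q m"
  by (simp add: cur_U_def cm_linear cm_sum_right cm_sc_right cm_K_wick(1) adm_C adm_J adm_B
      cm_K_C cm_K_J cm_K_B cm_K_d)

section \<open>Brackets with the cubic current, obtained from their charge\<close>

lemma cm_if_sc [simp]: "cm (if P then sc s else 0) X = 0"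
  by simp

lemma cm_G_U:
  assumes q: "q \<in> {1..N}" and p: "p \<in> {1..N}" and s: "s \<in> {1..N}"
  shows "cm (cur_G q p m) (cur_U s l) = (if p = s then cur_U q (m + l) else 0)"
proof -
  let ?X = "cm (cur_G q p m) (cur_U s l) - (if p = s then cur_U q (m + l) else 0)"
  have "?X = 0"
  proof (rule charge_uniq[of 1])
    show "cm K ?X = of_nat 1 * ?X"
      using q p s by (simp add: cm_diff_right cm_jacobi[of K] cm_K_G cm_K_U cm_if_right)
    fix t i assume t: "t \<in> {1..N}"
    note br = cm_linear cm_jacobi[of "a t _"] cm_a_G cm_a_U cm_if_right cm_if_left cm_G_G cm_G_D
    have z: "i + (l + m) = m" if "i + l = 0" using that by simp
    show "cm (a t i) ?X = 0"
    \<comment> \<open>Central terms are present only for total mode 0, and there they have to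
      cancel; otherwise only the currents themselves are compared.\<close>
    proof (cases "m + l + i = 0")
      case True
      then have i: "i = - m - l" by simp
      show ?thesis
        unfolding i using t q p s by (auto simp: br sc_add sc_diff sc_uminus algebra_simps)
    next
      case False
      then show ?thesis
        using t q p s by (auto simp: br z algebra_simps)
    qed
  qed simp
  then show ?thesis by simp
qed

lemma cm_D_U:
  assumes s: "s \<in> {1..N}"
  shows "cm (cur_D m) (cur_U s l) = - cur_U s (m + l)"
proof -
  let ?X = "cm (cur_D m) (cur_U s l) + cur_U s (m + l)"
  have "?X = 0"
  proof (rule charge_uniq[of 1])
    show "cm K ?X = of_nat 1 * ?X"
      using s by (simp add: cm_linear cm_jacobi[of K] cm_K_D cm_K_U cm_if_right)
    fix t i assume t: "t \<in> {1..N}"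
    have GD: "cm (cur_D m) (cur_G q p l) = - (if m + l = 0 \<and> q = p then sc (of_int l * \<mu>) else 0)"
      if "q \<in> {1..N}" "p \<in> {1..N}" for q p m l
      using that by (subst cm_swap) (simp add: cm_G_D add.commute)
    note br = cm_linear cm_jacobi[of "a t _"] cm_a_D cm_a_U cm_if_right cm_if_left GD cm_D_D
    have z: "i + (l + m) = m" if "i + l = 0" using that by simp
    show "cm (a t i) ?X = 0"
    proof (cases "m + l + i = 0")
      case True
      then have i: "i = - m - l" by simp
      show ?thesis
        unfolding i using t s by (auto simp: br sc_add sc_diff sc_uminus algebra_simps)
    next
      case False
      then show ?thesis
        using t s by (auto simp: br z algebra_simps)
    qed
  qed simp
  then show ?thesis by (simp add: eq_neg_iff_add_eq_0)
qed

text \<open>A bracket of charge 2. Its brackets with the \<open>a\<close> lead back to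
  \<open>cm_G_U\<close> and \<open>cm_D_U\<close>, which is why those are proved first.\<close>

lemma cm_U_U:
  assumes q: "q \<in> {1..N}" and s: "s \<in> {1..N}"
  shows "cm (cur_U q m) (cur_U s l) = 0"
proof (rule charge_uniq[of 2])
  show "cm K (cm (cur_U q m) (cur_U s l)) = of_nat 2 * cm (cur_U q m) (cur_U s l)"
    using q s by (simp add: cm_jacobi[of K] cm_K_U mult_2)
  fix t i assume t: "t \<in> {1..N}"
  have UG: "cm (cur_U q m) (cur_G s p l) = - (if p = q then cur_U s (m + l) else 0)"
    if "p \<in> {1..N}" for p m l
    using that q s by (subst cm_swap) (simp add: cm_G_U add.commute)
  have UD: "cm (cur_U q m) (cur_D l) = cur_U q (m + l)" for m l
    using q by (subst cm_swap) (simp add: cm_D_U add.commute)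
  have z: "i + (l + m) = m" if "i + l = 0" using that by simp
  have z': "i + (l + m) = l" if "i + m = 0" using that by simp
  show "cm (a t i) (cm (cur_U q m) (cur_U s l)) = 0"
    using t q s
    by (auto simp: cm_linear cm_jacobi[of "a t _"] cm_a_U cm_if_right cm_if_left UG UD cm_G_U cm_D_U
        z z' algebra_simps)
qed simp

theorem gl_currents_cur: "gl_currents (Suc N) \<kappa>' \<mu> cur"
proof -
  have S: "p \<in> {1..Suc N} \<longleftrightarrow> p \<in> {1..N} \<or> p = Suc N" for p by auto
  have aG: "cm (cur_G q p m) (a t i) = - (if q = t then a p (m + i) else 0)" for q p t m i
    by (subst cm_swap) (simp add: cm_a_G add.commute)
  have aD: "cm (cur_D m) (a p l) = a p (m + l)" if "p \<in> {1..N}" for p m l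
    using that by (subst cm_swap) (simp add: cm_a_D add.commute)
  have DG: "cm (cur_D m) (cur_G q p l) = (if m + l = 0 \<and> q = p then sc (of_int m * \<mu>) else 0)"
    if "q \<in> {1..N}" "p \<in> {1..N}" for q p m l
    using that by (subst cm_swap) (auto simp: cm_G_D add.commute add_eq_0_iff simp flip: sc_uminus)
  have UG: "cm (cur_U q m) (cur_G s p l) = - (if p = q then cur_U s (m + l) else 0)"
    if "p \<in> {1..N}" "q \<in> {1..N}" "s \<in> {1..N}" for p q s m l
    using that by (subst cm_swap) (simp add: cm_G_U add.commute)
  have UD: "cm (cur_U q m) (cur_D l) = cur_U q (m + l)" if "q \<in> {1..N}" for q m l
    using that by (subst cm_swap) (simp add: cm_D_U add.commute)
  show ?thesis
    unfolding gl_currents_def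
  proof (intro ballI allI)
    fix p q s t m l
    assume "p \<in> {1..Suc N}" "q \<in> {1..Suc N}" "s \<in> {1..Suc N}" "t \<in> {1..Suc N}"
    then have *: "p \<in> {1..N} \<or> p = Suc N" "q \<in> {1..N} \<or> q = Suc N"
        "s \<in> {1..N} \<or> s = Suc N" "t \<in> {1..N} \<or> t = Suc N"
      by (simp_all only: S)
    let ?goal = "cm (cur p q m) (cur s t l) =
        (if q = s then cur p t (m + l) else 0) - (if p = t then cur s q (m + l) else 0)
       + (if m + l = 0 then sc (of_int m * ((if q = s \<and> p = t then \<kappa>' else 0)
           + (if p = q \<and> s = t then \<mu> else 0))) else 0)"
    have ne: "p \<noteq> Suc N" "Suc N \<noteq> p" if "p \<in> {1..N}" for p using that by auto
    note [simp del] = atLeastAtMost_iff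
    note br = cm_G_G cm_a_a cm_a_G cm_a_D cm_a_U cm_G_D cm_D_D cm_U_a cm_G_U cm_D_U cm_U_U
          aG aD DG UG UD cur_def
    consider (GG) "p \<in> {1..N}" "q \<in> {1..N}" | (GL) "p = Suc N" "q \<in> {1..N}"
       | (GU) "p \<in> {1..N}" "q = Suc N" | (D) "p = Suc N" "q = Suc N" using * by blast
    then show ?goal
    proof cases
      case GG
      consider (GG) "s \<in> {1..N}" "t \<in> {1..N}" | (GL) "s = Suc N" "t \<in> {1..N}"
       | (GU) "s \<in> {1..N}" "t = Suc N" | (D) "s = Suc N" "t = Suc N" using * by blast
      then show ?goal
      proof cases
        case GG' : GG
        then show ?thesis using GG ne by (simp add: br)
      next
        case GL
        then show ?thesis using GG ne by (simp add: br)
      next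
        case GU
        then show ?thesis using GG ne by (simp add: br)
      next
        case D
        then show ?thesis using GG ne by (simp add: br)
      qed
    next
      case GL
      consider (GG) "s \<in> {1..N}" "t \<in> {1..N}" | (GL) "s = Suc N" "t \<in> {1..N}"
       | (GU) "s \<in> {1..N}" "t = Suc N" | (D) "s = Suc N" "t = Suc N" using * by blast
      then show ?goal
      proof cases
        case GG
        then show ?thesis using GL ne by (simp add: br)
      next
        case GL' : GL
        then show ?thesis using GL ne by (simp add: br)
      next
        case GU
        then show ?thesis using GL ne by (auto simp add: br sc_uminus add.commute add_eq_0_iff)
      next
        case D
        then show ?thesis using GL ne by (simp add: br add.commute)
      qed
    next
      case GU
      consider (GG) "s \<in> {1..N}" "t \<in> {1..N}" | (GL) "s = Suc N" "t \<in> {1..N}"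
       | (GU) "s \<in> {1..N}" "t = Suc N" | (D) "s = Suc N" "t = Suc N" using * by blast
      then show ?goal
      proof cases
        case GG
        then show ?thesis using GU ne by (simp add: br)
      next
        case GL
        then show ?thesis using GU ne by (auto simp add: br)
      next
        case GU' : GU
        then show ?thesis using GU ne by (simp add: br)
      next
        case D
        then show ?thesis using GU ne by (simp add: br)
      qed
    next
      case D
      consider (GG) "s \<in> {1..N}" "t \<in> {1..N}" | (GL) "s = Suc N" "t \<in> {1..N}"
       | (GU) "s \<in> {1..N}" "t = Suc N" | (D) "s = Suc N" "t = Suc N" using * by blast
      then show ?goal
      proof cases
        case GG
        then show ?thesis using D ne by (simp add: br)
      next
        case GL
        then show ?thesis using D ne by (simp add: br)
      next
        case GU
        then show ?thesis using D ne by (simp add: br)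
      next
        case D' : D
        then show ?thesis using D ne by (simp add: br distrib_left)
      qed
    qed
  qed
qed

text \<open>Carries brackets with operators not yet used through one step: with f = 0 for the fields
  and charges of later columns, with scalar f for later Heisenberg fields. The cubic current
  commutes with such \<open>Z\<close> because the contributions of \<open>J q q\<close> and of
  \<open>B\<close> to it cancel.\<close>

lemma cm_cur:
  assumes Z: "\<And>s l. cm (a s l) Z = 0" "\<And>s l. cm (d s l) Z = 0"
    and J: "\<And>q p m. q \<in> {1..N} \<Longrightarrow> p \<in> {1..N} \<Longrightarrow> cm (J q p m) Z = (if q = p then sc (f m) else 0)"
    and B: "\<And>m. cm (B m) Z = sc (f m)"
    and q: "q \<in> {1..Suc N}" and p: "p \<in> {1..Suc N}"
  shows "cm (cur q p m) Z = (if q = p then sc (f m) else 0)"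
proof -
  have QZ: "cm (Q s t l) Z = 0" for s t l
    by (simp add: Q_def cm_wick_left_0 adm_intros Z)
  have CZ: "cm (C l) Z = 0" for l
    by (simp add: C_def cm_sum_left QZ)
  have UZ: "cm (cur_U s l) Z = 0" if s: "s \<in> {1..N}" for s l
  proof -
    have "(\<Sum>t=1..N. cm (wick t (J s t) l) Z) = (\<Sum>t=1..N. if t = s then wick s (\<lambda>i. sc (f i)) l else 0)"
      using s by (intro sum.cong) (auto simp: cm_wick_left_0 adm_J Z J cong: if_cong)
    then show ?thesis using s
      by (simp add: cur_U_def cm_linear cm_sum_left cm_sc_left cm_wick_left_0 adm_C adm_B Z CZ B)
  qed
  show ?thesis
    using q p UZ[of q] by (auto simp: cur_def cur_D_def cur_G_def cm_linear B CZ QZ Z J)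
qed

lemma smooth_cur: "std \<Longrightarrow> smooth (cur q p)"
proof -
  assume std
  have J: "smooth (J s t)" for s t using \<open>std\<close> by (rule smooth_J)
  have C: "smooth C" and Q: "smooth (Q s t)" for s t
    using adm_C adm_Q \<open>std\<close> unfolding admissible_def by blast+
  have B: "smooth B" using \<open>std\<close> by (rule smooth_B)
  note w = smooth_wick[OF \<open>std\<close>]
  have "smooth (cur_D)" unfolding cur_D_def[abs_def] by (intro smooth_diff B C)
  moreover have "smooth (cur_G q p)" unfolding cur_G_def[abs_def] by (intro smooth_add J Q)
  moreover have "smooth (cur_U q)" unfolding cur_U_def[abs_def]
    by (intro smooth_diff smooth_add smooth_minus smooth_sum w B C J smooth_mult_left smooth_d)
  moreover have "smooth (a p)" using \<open>std\<close> by (rule smooth_a)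
  ultimately show ?thesis unfolding cur_def[abs_def]
    by (cases "q = Suc N"; cases "p = Suc N") simp_all
qed

end

section \<open>Multiplication and differentiation operators\<close>

abbreviation lk where "lk \<equiv> Poly_Mapping.lookup"

lemma sum_monomials: "f = (\<Sum>\<mu>\<in>Poly_Mapping.keys f. pscale (lk f \<mu>) (Poly_Mapping.single \<mu> 1))"
  by (rule poly_mapping_eqI)
    (simp add: lookup_sum lookup_pscale lookup_single when_def in_keys_iff if_distrib[of "(*) _"] cong: if_cong)

lemma lop_eq_monomialsI: "(\<And>\<mu>. app X (Poly_Mapping.single \<mu> 1) = app Y (Poly_Mapping.single \<mu> 1)) \<Longrightarrow> X = Y"
proof (rule lop_eqI)
  fix v assume *: "\<And>\<mu>. app X (Poly_Mapping.single \<mu> 1) = app Y (Poly_Mapping.single \<mu> 1)"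
  show "app X v = app Y v"
    by (subst (1 2) sum_monomials[of v]) (simp add: app_sum app_pscale *)
qed

lift_definition Mul :: "indet \<Rightarrow> lop" is pmult
  by (simp add: linop_def pmult_def pscale_def algebra_simps)

lemma lookup_pdiff: "lk (pdiff x f) \<mu> = of_nat (lk \<mu> x + 1) * lk f (\<mu> + Poly_Mapping.single x 1)"
proof -
  have *: "of_nat (lk \<nu> x) * lk f \<nu> * (if \<nu> - Poly_Mapping.single x 1 = \<mu> then 1 else 0) =
      (if \<nu> = \<mu> + Poly_Mapping.single x 1 then of_nat (lk \<mu> x + 1) * lk f \<nu> else 0)" for \<nu>
  \<comment> \<open>Here truncated subtraction leaves \<open>\<nu>\<close> unchanged, but the factor
    \<open>lk \<nu> x\<close> makes the left side 0.\<close>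
  proof (cases "lk \<nu> x = 0")
    case True
    then show ?thesis by (auto simp: lookup_add)
  next
    case False
    then have "\<nu> - Poly_Mapping.single x 1 + Poly_Mapping.single x 1 = \<nu>"
      by (intro poly_mapping_eqI) (auto simp: lookup_add lookup_minus lookup_single when_def)
    then show ?thesis by (auto simp: lookup_add)
  qed
  have "lk (pdiff x f) \<mu> = (\<Sum>\<nu>\<in>Poly_Mapping.keys f.
      of_nat (lk \<nu> x) * lk f \<nu> * (if \<nu> - Poly_Mapping.single x 1 = \<mu> then 1 else 0))"
    by (auto simp: pdiff_def lookup_sum lookup_single when_def intro!: sum.cong)
  also have "\<dots> = of_nat (lk \<mu> x + 1) * lk f (\<mu> + Poly_Mapping.single x 1)"
    unfolding * by (simp add: in_keys_iff)
  finally show ?thesis .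
qed

lift_definition Der :: "indet \<Rightarrow> lop" is pdiff
  by (auto simp: linop_def lookup_pdiff lookup_add lookup_pscale algebra_simps intro!: poly_mapping_eqI)

section \<open>Weights of monomials and the charge operator\<close>

definition wt :: "(indet \<Rightarrow> int) \<Rightarrow> (indet \<Rightarrow>\<^sub>0 nat) \<Rightarrow> int" where
  "wt w \<mu> = (\<Sum>x\<in>Poly_Mapping.keys \<mu>. int (lk \<mu> x) * w x)"

lemma wt_add: "wt w (\<mu> + \<nu>) = wt w \<mu> + wt w \<nu>"
  unfolding wt_def by (rule setsum_keys_plus_distrib) (simp_all add: algebra_simps)

lemma wt_single [simp]: "wt w (Poly_Mapping.single x k) = int k * w x"
  by (simp add: wt_def)

text \<open>The Euler operator, the sum of w(x) x d/dx over all x. It is defined on coefficients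
  because \<open>w\<close> may be nonzero at infinitely many indeterminates.\<close>

lift_definition Chg :: "(indet \<Rightarrow> int) \<Rightarrow> lop" is
  "\<lambda>w. Poly_Mapping.mapp (\<lambda>\<mu> c. of_int (wt w \<mu>) * c)"
proof -
  have *: "lk (Poly_Mapping.mapp (\<lambda>\<mu> c. z \<mu> * c) f) \<mu> = z \<mu> * lk f \<mu>"
    for z :: "(indet \<Rightarrow>\<^sub>0 nat) \<Rightarrow> complex" and f \<mu>
    by (simp add: lookup_mapp when_def in_keys_iff)
  show "linop (Poly_Mapping.mapp (\<lambda>\<mu> c. of_int (wt w \<mu>) * c))" for w
    by (auto simp: linop_def * lookup_add lookup_pscale distrib_left mult.left_commute
        intro!: poly_mapping_eqI)
qed

lemma lookup_Chg: "lk (app (Chg w) f) \<mu> = of_int (wt w \<mu>) * lk f \<mu>"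
  by (simp add: Chg.rep_eq lookup_mapp when_def in_keys_iff)

lemma pscale_single: "pscale s (Poly_Mapping.single \<mu> c) = Poly_Mapping.single \<mu> (s * c)"
  by (simp add: pscale_def mult_single)

lemma app_Mul_single: "app (Mul x) (Poly_Mapping.single \<mu> c) = Poly_Mapping.single (\<mu> + Poly_Mapping.single x 1) c"
  by (simp add: Mul.rep_eq pmult_def mult_single add.commute)

lemma app_Der_single: "app (Der x) (Poly_Mapping.single \<mu> c) =
    Poly_Mapping.single (\<mu> - Poly_Mapping.single x 1) (of_nat (lk \<mu> x) * c)"
  by (cases "c = 0") (simp_all add: Der.rep_eq pdiff_def)

lemma app_Chg_single: "app (Chg w) (Poly_Mapping.single \<mu> c) = Poly_Mapping.single \<mu> (of_int (wt w \<mu>) * c)"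
  by (rule poly_mapping_eqI) (simp add: lookup_Chg lookup_single when_def)

lemma minus_single_add_single:
  "lk \<mu> x \<noteq> 0 \<Longrightarrow> \<mu> - Poly_Mapping.single x (Suc 0) + Poly_Mapping.single x (Suc 0) = \<mu>"
  by (rule poly_mapping_eqI) (auto simp: lookup_add lookup_minus lookup_single when_def)

lemma wt_minus_single:
  "lk \<mu> x \<noteq> 0 \<Longrightarrow> wt w \<mu> = wt w (\<mu> - Poly_Mapping.single x (Suc 0)) + w x"
  using wt_add[of w "\<mu> - Poly_Mapping.single x (Suc 0)" "Poly_Mapping.single x (Suc 0)"]
  by (simp add: minus_single_add_single)

lemma cm_Mul_Mul: "cm (Mul x) (Mul y) = 0"
  by (rule lop_eq_monomialsI) (simp add: cm_def app_Mul_single add_ac)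

lemma cm_Der_Der: "cm (Der x) (Der y) = 0"
proof (rule lop_eq_monomialsI)
  fix \<mu>
  have "\<mu> - Poly_Mapping.single x (Suc 0) - Poly_Mapping.single y (Suc 0) =
      \<mu> - Poly_Mapping.single y (Suc 0) - Poly_Mapping.single x (Suc 0)"
    by (rule poly_mapping_eqI) (simp add: lookup_minus)
  then show "app (cm (Der x) (Der y)) (Poly_Mapping.single \<mu> 1) = app 0 (Poly_Mapping.single \<mu> 1)"
    by (auto simp: cm_def app_Der_single lookup_minus lookup_single when_def mult.commute)
qed

lemma cm_Der_Mul: "cm (Der x) (Mul y) = (if x = y then 1 else 0)"
proof (rule lop_eq_monomialsI)
  fix \<mu>
  show "app (cm (Der x) (Mul y)) (Poly_Mapping.single \<mu> 1) =
      app (if x = y then 1 else 0) (Poly_Mapping.single \<mu> 1)"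
  proof (cases "lk \<mu> x = 0")
    case True
    then show ?thesis
      by (auto simp: cm_def app_Der_single app_Mul_single lookup_add lookup_single when_def)
  next
    case False
    have "\<mu> + Poly_Mapping.single y (Suc 0) - Poly_Mapping.single x (Suc 0) =
        \<mu> - Poly_Mapping.single x (Suc 0) + Poly_Mapping.single y (Suc 0)"
      using False by (intro poly_mapping_eqI) (auto simp: lookup_add lookup_minus lookup_single when_def)
    then show ?thesis
      by (auto simp: cm_def app_Der_single app_Mul_single lookup_add lookup_single when_def
          simp flip: single_diff)
  qed
qed

lemma cm_Mul_Der: "cm (Mul y) (Der x) = - (if x = y then 1 else 0)"
  by (subst cm_swap) (simp add: cm_Der_Mul)

lemma cm_Chg_Mul: "cm (Chg w) (Mul x) = sc (of_int (w x)) * Mul x"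
  by (rule lop_eq_monomialsI)
    (simp add: cm_def app_Mul_single app_Chg_single wt_add pscale_single flip: single_diff)

lemma cm_Chg_Der: "cm (Chg w) (Der x) = - (sc (of_int (w x)) * Der x)"
proof (rule lop_eq_monomialsI)
  fix \<mu>
  show "app (cm (Chg w) (Der x)) (Poly_Mapping.single \<mu> 1) =
      app (- (sc (of_int (w x)) * Der x)) (Poly_Mapping.single \<mu> 1)"
  proof (cases "lk \<mu> x = 0")
    case True
    then show ?thesis by (simp add: cm_def app_Der_single app_Chg_single)
  next
    case False
    have "wt w \<mu> = wt w (\<mu> - Poly_Mapping.single x (Suc 0)) + w x"
      using False by (rule wt_minus_single)
    then show ?thesis
      by (simp add: cm_def app_Der_single app_Chg_single pscale_single algebra_simps flip: single_diff single_uminus)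
  qed
qed

text \<open>
  Variables of weight \<open>1\<close> are those differentiated, and those of weight \<open>-1\<close> those multiplied by, among the
  operators that \<open>X\<close> commutes with. Up to induction it suffices to apply \<open>X\<close> to a monomial without variables
  of weight \<open>-1\<close>; the result has positive charge but is annihilated by the derivatives, so it contains no
  variable that could account for the charge.
\<close>

lemma charge_zero:
  assumes w: "\<And>x. w x \<in> {-1, 0, 1}" and c: "0 < c" and K: "cm (Chg w) X = of_nat c * X"
    and Mul: "\<And>x. w x = -1 \<Longrightarrow> cm (Mul x) X = 0" and Der: "\<And>x. w x = 1 \<Longrightarrow> cm (Der x) X = 0"
  shows "X = 0"
proof (rule lop_eq_monomialsI)
  fix \<mu>
  have "app X (Poly_Mapping.single \<mu> 1) = 0"
  \<comment> \<open>The measure counts the factors of nonzero weight, so it drops both when a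
    variable of weight -1 is split off and when one of weight 1 is differentiated.\<close>
  proof (induction "nat (wt (\<lambda>x. \<bar>w x\<bar>) \<mu>)" arbitrary: \<mu> rule: less_induct)
    case less
    have IH: "app X (Poly_Mapping.single (\<mu> - Poly_Mapping.single x (Suc 0)) 1) = 0"
      if x: "lk \<mu> x \<noteq> 0" "w x \<noteq> 0" for x
    proof (rule less)
      let ?\<nu> = "\<mu> - Poly_Mapping.single x (Suc 0)"
      have "wt (\<lambda>x. \<bar>w x\<bar>) \<mu> = wt (\<lambda>x. \<bar>w x\<bar>) ?\<nu> + \<bar>w x\<bar>"
        using x(1) by (rule wt_minus_single)
      moreover have "0 \<le> wt (\<lambda>x. \<bar>w x\<bar>) ?\<nu>" by (simp add: wt_def sum_nonneg)
      ultimately show "nat (wt (\<lambda>x. \<bar>w x\<bar>) ?\<nu>) < nat (wt (\<lambda>x. \<bar>w x\<bar>) \<mu>)"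
        using x(2) by simp
    qed
    show ?case
    proof (cases "\<exists>x. lk \<mu> x \<noteq> 0 \<and> w x = -1")
      case True
      then obtain x where x: "lk \<mu> x \<noteq> 0" "w x = -1" by blast
      have "app X (Poly_Mapping.single \<mu> 1) =
          app (X * Mul x) (Poly_Mapping.single (\<mu> - Poly_Mapping.single x (Suc 0)) 1)"
        using minus_single_add_single[OF x(1)] by (simp add: app_Mul_single)
      also have "X * Mul x = Mul x * X" using Mul[OF x(2)] by (simp add: cm_eq_0_iff)
      finally show ?thesis using IH[of x] x by simp
    next
      case False
      let ?v = "app X (Poly_Mapping.single \<mu> 1)"
      have \<mu>: "0 \<le> wt w \<mu>"
        unfolding wt_def
      proof (rule sum_nonneg)
        fix x assume "x \<in> Poly_Mapping.keys \<mu>"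
        then have "w x \<noteq> -1" using False unfolding in_keys_iff by blast
        then have "0 \<le> w x" using w[of x] by auto
        then show "0 \<le> int (lk \<mu> x) * w x" by simp
      qed
      show ?thesis
      proof (rule poly_mapping_eqI)
        fix \<nu>
        have "lk ?v \<nu> = 0"
        proof (rule ccontr)
          assume v: "lk ?v \<nu> \<noteq> 0"
          have "w x \<noteq> 1" if "lk \<nu> x \<noteq> 0" for x
          proof
            assume x: "w x = 1"
            have "app (Der x) ?v = app (X * Der x) (Poly_Mapping.single \<mu> 1)"
              using Der[OF x] by (simp add: cm_eq_0_iff flip: app_simps(6))
            also have "\<dots> = pscale (of_nat (lk \<mu> x))
                (app X (Poly_Mapping.single (\<mu> - Poly_Mapping.single x (Suc 0)) 1))"
              by (simp add: app_Der_single pscale_single flip: app_pscale)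
            also have "\<dots> = 0" using IH[of x] x by (cases "lk \<mu> x = 0") auto
            finally have "lk (pdiff x ?v) (\<nu> - Poly_Mapping.single x (Suc 0)) = 0"
              by (simp add: Der.rep_eq)
            then show False using v minus_single_add_single[OF that]
              by (simp add: lookup_pdiff del: of_nat_add of_nat_Suc)
          qed
          then have \<nu>: "wt w \<nu> \<le> 0"
            unfolding wt_def
          proof (intro sum_nonpos)
            fix x assume x: "\<And>x. lk \<nu> x \<noteq> 0 \<Longrightarrow> w x \<noteq> 1" "x \<in> Poly_Mapping.keys \<nu>"
            then have "w x \<noteq> 1" by (simp add: in_keys_iff)
            then have "w x \<le> 0" using w[of x] by auto
            then show "int (lk \<nu> x) * w x \<le> 0" by (simp add: mult_nonneg_nonpos)
          qed
          \<comment> \<open>Comparing coefficients at \<open>\<nu>\<close> shows that the charge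
            \<open>c\<close> is the weight of \<open>\<nu>\<close> minus that of
            \<open>\<mu>\<close>. The former is at most 0 and the latter at least 0.\<close>
          have "lk (app (cm (Chg w) X) (Poly_Mapping.single \<mu> 1)) \<nu> = of_nat c * lk ?v \<nu>"
            unfolding K by (simp add: lookup_pscale flip: sc_of_nat)
          moreover have "app X (app (Chg w) (Poly_Mapping.single \<mu> 1)) = pscale (of_int (wt w \<mu>)) ?v"
            by (simp add: app_Chg_single pscale_single flip: app_pscale)
          ultimately have "(of_int (wt w \<nu>) - of_int (wt w \<mu>)) * lk ?v \<nu> = of_nat c * lk ?v \<nu>"
            by (simp add: cm_def lookup_minus lookup_Chg lookup_pscale algebra_simps)
          then have "complex_of_int (wt w \<nu> - wt w \<mu>) = of_int (int c)" using v by simp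
          then show False using \<mu> \<nu> c by (simp only: of_int_eq_iff)
        qed
        then show "lk ?v \<nu> = lk 0 \<nu>" by simp
      qed
    qed
  qed
  then show "app X (Poly_Mapping.single \<mu> 1) = app 0 (Poly_Mapping.single \<mu> 1)" by simp
qed

section \<open>The free fields\<close>

definition opa :: "nat \<Rightarrow> nat \<Rightarrow> nat \<Rightarrow> int \<Rightarrow> lop" where
  "opa r i j m = (if 0 \<le> m \<and> j \<le> r then Der (Xv i j m) else Mul (Xv i j m))"

definition opd :: "nat \<Rightarrow> nat \<Rightarrow> nat \<Rightarrow> int \<Rightarrow> lop" where
  "opd r i j m = (if m \<le> 0 \<and> j \<le> r then Mul (Xv i j (- m)) else - Der (Xv i j (- m)))"

definition opb :: "nat \<Rightarrow> (nat \<Rightarrow> nat \<Rightarrow> complex) \<Rightarrow> (nat \<Rightarrow> complex) \<Rightarrow> nat \<Rightarrow> int \<Rightarrow> lop" where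
  "opb n e lam i m =
     (if m = 0 then sc (lam i)
      else if m < 0 then (\<Sum>l=1..n. sc (e i l) * Mul (Yv l (nat (- m))))
      else sc (of_int m) * (\<Sum>l=1..n. sc (e i l) * Der (Yv l (nat m))))"

lemma app_opa: "app (opa r i j m) = op_a r i j m"
  by (auto simp: opa_def op_a_def Der.rep_eq Mul.rep_eq)

lemma app_opd: "app (opd r i j m) = op_as r i j m"
  by (auto simp: opd_def op_as_def Der.rep_eq Mul.rep_eq fun_eq_iff)

lemma app_opb: "app (opb n e lam i m) = op_b n e lam i m"
  by (auto simp: opb_def op_b_def Der.rep_eq Mul.rep_eq fun_eq_iff app_sum_left)

lemma cm_opa_opa: "cm (opa r i j m) (opa r k l p) = 0"
  by (auto simp: opa_def cm_Mul_Mul cm_Der_Der cm_Der_Mul cm_Mul_Der)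

lemma cm_opd_opd: "cm (opd r i j m) (opd r k l p) = 0"
  by (auto simp: opd_def cm_Mul_Mul cm_Der_Der cm_Der_Mul cm_Mul_Der cm_linear)

lemma cm_opa_opd: "cm (opa r i j m) (opd r k l p) = (if i = k \<and> j = l \<and> m + p = 0 then 1 else 0)"
  by (auto simp: opa_def opd_def cm_Mul_Mul cm_Der_Der cm_Der_Mul cm_Mul_Der cm_linear)

lemma cm_opd_opa: "cm (opd r k l p) (opa r i j m) = - (if i = k \<and> j = l \<and> m + p = 0 then 1 else 0)"
  by (subst cm_swap) (simp add: cm_opa_opd)

lemma app_Der_eq_0: "x \<notin> pvars v \<Longrightarrow> app (Der x) v = 0"
  by (simp add: Der.rep_eq pdiff_eq_0)

lemma ex_bound: "\<exists>M \<ge> 0. \<forall>m > M. (\<forall>i j. app (Der (Xv i j m)) v = 0 \<and> app (Der (Xv i j (- m))) v = 0) \<and>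
    (\<forall>i. app (Der (Yv i (nat m))) v = 0)"
proof -
  obtain N where "index_bound N v" using ex_index_bound by blast
  note N = index_boundD[OF this]
  have "(\<forall>i j. app (Der (Xv i j m)) v = 0 \<and> app (Der (Xv i j (- m))) v = 0) \<and>
    (\<forall>i. app (Der (Yv i (nat m))) v = 0)" if "m > N" for m
  proof (intro conjI allI)
    fix i j
    show "app (Der (Xv i j m)) v = 0" using N(2)[of i j m] that by (intro app_Der_eq_0) auto
    show "app (Der (Xv i j (- m))) v = 0" using N(2)[of i j "- m"] that by (intro app_Der_eq_0) auto
    show "app (Der (Yv i (nat m))) v = 0" using N(3)[of i "nat m"] N(1) that by (intro app_Der_eq_0) auto
  qed
  then show ?thesis using N(1) by (intro exI[of _ N]) auto
qed

lemma smooth_opa: "j \<le> r \<Longrightarrow> smooth (opa r i j)"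
  unfolding smooth_def
proof
  fix v assume j: "j \<le> r"
  obtain M where M: "0 \<le> M" "\<And>m. m > M \<Longrightarrow> app (Der (Xv i j m)) v = 0" using ex_bound by meson
  show "\<exists>M. \<forall>m>M. app (opa r i j m) v = 0"
    using M j by (intro exI[of _ M]) (auto simp: opa_def)
qed

lemma smooth_opd: "smooth (opd r i j)"
  unfolding smooth_def
proof
  fix v
  obtain M where M: "0 \<le> M" "\<And>m. m > M \<Longrightarrow> app (Der (Xv i j (- m))) v = 0" using ex_bound by meson
  show "\<exists>M. \<forall>m>M. app (opd r i j m) v = 0"
    using M by (intro exI[of _ M]) (auto simp: opd_def)
qed

lemma lf_opd: "\<not> j \<le> r \<Longrightarrow> lf (opd r i j)"
  unfolding lf_def
proof
  fix v assume j: "\<not> j \<le> r"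
  obtain M where M: "0 \<le> M" "\<And>m i j. m > M \<Longrightarrow> app (Der (Xv i j (- m))) v = 0"
    "\<And>m i j. m > M \<Longrightarrow> app (Der (Xv i j m)) v = 0" using ex_bound by meson
  have "{m. app (opd r i j m) v \<noteq> 0} \<subseteq> {- M..M}"
  proof
    fix m assume m: "m \<in> {m. app (opd r i j m) v \<noteq> 0}"
    then have d: "app (Der (Xv i j (- m))) v \<noteq> 0" using j by (simp add: opd_def)
    show "m \<in> {- M..M}" using M(2)[of m i j] M(3)[of "- m" i j] d by force
  qed
  then show "finite {m. app (opd r i j m) v \<noteq> 0}" by (rule finite_subset) simp
qed

lemma smooth_opb: "smooth (opb n e lam i)"
  unfolding smooth_def
proof
  fix v
  obtain M where M: "0 \<le> M" "\<And>m i. m > M \<Longrightarrow> app (Der (Yv i (nat m))) v = 0" using ex_bound by meson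
  show "\<exists>M. \<forall>m>M. app (opb n e lam i m) v = 0"
    using M by (intro exI[of _ M]) (auto simp: opb_def app_sum_left)
qed

lemma cm_opb_opb:
  "cm (opb n e lam i m) (opb n e lam j l) = (if m + l = 0 then sc (of_int m * (\<Sum>t=1..n. e i t * e j t)) else 0)"
proof -
  have DM: "cm (\<Sum>s=1..n. sc (e i s) * Der (Yv s k)) (\<Sum>t=1..n. sc (e j t) * Mul (Yv t k')) =
      (if k = k' then sc (\<Sum>t=1..n. e i t * e j t) else 0)" for i j k k'
  proof -
    have "cm (\<Sum>s=1..n. sc (e i s) * Der (Yv s k)) (\<Sum>t=1..n. sc (e j t) * Mul (Yv t k')) =
      (\<Sum>t=1..n. \<Sum>s=1..n. if s = t then if k = k' then sc (e i t * e j t) else 0 else 0)"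
      unfolding cm_sum_left cm_sum_right cm_sc_left cm_sc_right cm_Der_Mul sum_distrib_left
      by (intro sum.cong refl) (auto simp: mult.commute simp flip: sc_mult)
    then show ?thesis by (simp add: sc_sum)
  qed
  have MD: "cm (\<Sum>s=1..n. sc (e i s) * Mul (Yv s k)) (\<Sum>t=1..n. sc (e j t) * Der (Yv t k')) =
      - (if k = k' then sc (\<Sum>t=1..n. e i t * e j t) else 0)" for i j k k'
    by (subst cm_swap, subst DM) (auto simp: mult.commute)
  have MM: "cm (\<Sum>s=1..n. sc (e i s) * Mul (Yv s k)) (\<Sum>t=1..n. sc (e j t) * Mul (Yv t k')) = 0" for i j k k'
    by (simp add: cm_sum_left cm_sum_right cm_sc_left cm_sc_right cm_Mul_Mul)
  have DD: "cm (\<Sum>s=1..n. sc (e i s) * Der (Yv s k)) (\<Sum>t=1..n. sc (e j t) * Der (Yv t k')) = 0" for i j k k'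
    by (simp add: cm_sum_left cm_sum_right cm_sc_left cm_sc_right cm_Der_Der)
  consider "m = 0" | "l = 0" | "m < 0" "l < 0" | "0 < m" "0 < l" | "m < 0" "0 < l" | "0 < m" "l < 0"
    by linarith
  then show ?thesis
  proof cases
    case 5
    then have "nat (- m) = nat l \<longleftrightarrow> m = - l" "m + l = 0 \<longleftrightarrow> m = - l" by auto
    then show ?thesis using 5
      by (auto simp: opb_def cm_sc_right MD simp del: One_nat_def simp flip: sc_mult sc_uminus)
  next
    case 6
    then have "nat m = nat (- l) \<longleftrightarrow> m + l = 0" by auto
    then show ?thesis using 6
      by (auto simp: opb_def cm_sc_left DM simp del: One_nat_def simp flip: sc_mult)
  qed (simp_all add: opb_def cm_sc_left cm_sc_right MM DD del: One_nat_def)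
qed

lemma cm_opb_X:
  "cm (opb n e lam i m) (Mul (Xv s j l)) = 0" "cm (opb n e lam i m) (Der (Xv s j l)) = 0"
  by (auto simp: opb_def cm_sum_left cm_sc_left cm_Mul_Mul cm_Der_Der cm_Der_Mul cm_Mul_Der)

lemma cm_opb_opa: "cm (opb n e lam i m) (opa r s j l) = 0"
  and cm_opb_opd: "cm (opb n e lam i m) (opd r s j l) = 0"
  by (auto simp: opa_def opd_def cm_opb_X cm_linear)

text \<open>Weight 1 where \<open>opa\<close> differentiates and -1 where it multiplies, so that in
  column \<open>N\<close> every \<open>opa\<close> lowers and every \<open>opd\<close> raises the
  charge by 1, on either side of \<open>r\<close>.\<close>

definition charge :: "nat \<Rightarrow> nat \<Rightarrow> indet \<Rightarrow> int" where
  "charge r N x = (case x of Xv i j m \<Rightarrow>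
     if j = N \<and> i \<in> {1..N} then if 0 \<le> m \<and> N \<le> r then 1 else - 1 else 0 | Yv i m \<Rightarrow> 0)"

lemma cm_Chg_opa: "cm (Chg (charge r N)) (opa r i j m) = (if j = N \<and> i \<in> {1..N} then - opa r i j m else 0)"
  by (auto simp: opa_def cm_Chg_Mul cm_Chg_Der charge_def sc_uminus)

lemma cm_Chg_opd: "cm (Chg (charge r N)) (opd r i j m) = (if j = N \<and> i \<in> {1..N} then opd r i j m else 0)"
  by (auto simp: opd_def cm_linear cm_Chg_Mul cm_Chg_Der charge_def sc_uminus)

lemma cm_Chg_opb: "cm (Chg (charge r N)) (opb n e lam i m) = 0"
  by (auto simp: opb_def cm_sum_right cm_sc_right cm_Chg_Mul cm_Chg_Der charge_def)

lemma column: "column N (N \<le> r) (\<lambda>p. opa r p N) (\<lambda>p. opd r p N) (Chg (charge r N))"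
proof
  show "X = 0" if "0 < c" "cm (Chg (charge r N)) X = of_nat c * X"
      "\<And>p m. p \<in> {1..N} \<Longrightarrow> cm (opa r p N m) X = 0" for c X
  proof (rule charge_zero[OF _ that(1,2)])
    show "charge r N x \<in> {- 1, 0, 1}" for x
      by (auto simp: charge_def split: indet.split)
    show "cm (Mul x) X = 0" if "charge r N x = - 1" for x
    proof -
      obtain p m where "x = Xv p N m" "p \<in> {1..N}" "\<not> (0 \<le> m \<and> N \<le> r)"
        using \<open>charge r N x = - 1\<close> by (auto simp: charge_def split: indet.splits if_splits)
      then show ?thesis using \<open>\<And>p m. p \<in> {1..N} \<Longrightarrow> cm (opa r p N m) X = 0\<close>[of p m]
        by (auto simp: opa_def split: if_splits)
    qed
    show "cm (Der x) X = 0" if "charge r N x = 1" for x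
    proof -
      obtain p m where "x = Xv p N m" "p \<in> {1..N}" "0 \<le> m \<and> N \<le> r"
        using \<open>charge r N x = 1\<close> by (auto simp: charge_def split: indet.splits if_splits)
      then show ?thesis using \<open>\<And>p m. p \<in> {1..N} \<Longrightarrow> cm (opa r p N m) X = 0\<close>[of p m]
        by (auto simp: opa_def split: if_splits)
    qed
  qed
qed (auto simp: cm_opa_opa cm_opd_opd cm_opa_opd smooth_opa smooth_opd lf_opd cm_Chg_opa cm_Chg_opd)

section \<open>The orthogonal decomposition of the Heisenberg fields\<close>

definition level :: "nat \<Rightarrow> complex \<Rightarrow> nat \<Rightarrow> complex" where
  "level r \<gamma> N = \<gamma>\<^sup>2 - of_nat (min N (r + 1))"

definition trace_level :: "nat \<Rightarrow> nat \<Rightarrow> complex \<Rightarrow> complex" where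
  "trace_level n r \<gamma> = - (\<gamma>\<^sup>2 - of_nat (r + 1)) / of_nat (n + 1)"

text \<open>
  \<open>level r \<gamma> N\<close> and \<open>trace_level n r \<gamma>\<close> are the coefficients \<open>\<kappa>\<close> and \<open>\<mu>\<close> of the form on \<open>gl(N)\<close>. The form \<open>gram\<close>
  is forced by the induction, and its rows sum to zero. Hence it is determined by its restriction \<open>frakB\<close> to
  the differences \<open>b\<^bsub>i\<^esub> = B\<^bsub>i\<^esub> - B\<^bsub>i+1\<^esub>\<close>, and the fields \<open>B\<^bsub>p\<^esub>\<close> are recovered from the \<open>b\<^bsub>i\<^esub>\<close> by \<open>\<Sum>\<^sub>p B\<^bsub>p\<^esub> = 0\<close>.
\<close>

definition gram :: "nat \<Rightarrow> nat \<Rightarrow> complex \<Rightarrow> nat \<Rightarrow> nat \<Rightarrow> complex" where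
  "gram n r \<gamma> p q = (if p = q then if p \<le> r + 1 then \<gamma>\<^sup>2 else \<gamma>\<^sup>2 - of_nat (r + 1) else 0)
     - (if p \<le> r + 1 \<and> q \<le> r + 1 then 1 else 0) + trace_level n r \<gamma>"

text \<open>The p-th coordinate of the i-th fundamental weight of sl(n + 1). These weights are dual
  to the simple coroots, so they invert the passage to differences of neighbours, up to the
  mean.\<close>

definition coef :: "nat \<Rightarrow> nat \<Rightarrow> nat \<Rightarrow> complex" where
  "coef n p i = of_bool (p \<le> i) - of_nat i / of_nat (n + 1)"

text \<open>\<open>trace_level\<close> cancels in the second difference. Up to it, the diagonal
  entry of \<open>gram\<close> is \<gamma>^2 - 1 for p \<le> r + 1 and \<gamma>^2 - (r + 1) beyond.
  For i = j = r + 1 both kinds occur, without a cross term, and their sum 2 \<gamma>^2 - r - 2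
  explains the correction r/2 in \<open>frakB\<close>.\<close>

lemma frakB_gram: "frakB r \<gamma> i j =
    (gram n r \<gamma> i j - gram n r \<gamma> i (j + 1)) - (gram n r \<gamma> (i + 1) j - gram n r \<gamma> (i + 1) (j + 1))"
  by (auto simp: frakB_def cartan_matrix_def gram_def algebra_simps)

text \<open>Rows on both sides of r + 1 have the sum \<gamma>^2 - (r + 1) + (n + 1) \<mu>, with
  \<mu> the \<open>trace_level\<close>, which is chosen to make this 0.\<close>

lemma sum_gram:
  assumes "r \<le> n" "p \<in> {1..n + 1}"
  shows "(\<Sum>q=1..n+1. gram n r \<gamma> p q) = 0"
proof -
  have "(\<Sum>q=1..n+1. if p \<le> r + 1 \<and> q \<le> r + 1 then 1 else (0::complex)) =
      (if p \<le> r + 1 then of_nat (r + 1) else 0)"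
  proof -
    have "(\<Sum>q=1..n+1. if q \<le> r + 1 then 1 else (0::complex)) = (\<Sum>q=1..r+1. 1)"
      using assms(1) by (intro sum.mono_neutral_cong_right) auto
    then show ?thesis by simp
  qed
  moreover have "of_nat (n + 1) * trace_level n r \<gamma> = - (\<gamma>\<^sup>2 - of_nat (r + 1))"
    by (simp add: trace_level_def del: of_nat_Suc of_nat_add)
  ultimately show ?thesis
    using assms(2) by (auto simp: gram_def sum.distrib sum_subtractf algebra_simps)
qed

lemma sum_coef_diff:
  fixes x :: "nat \<Rightarrow> complex"
  assumes "p \<in> {1..n + 1}"
  shows "(\<Sum>i=1..n. coef n p i * (x i - x (i + 1))) = x p - (\<Sum>q=1..n+1. x q) / of_nat (n + 1)"
proof -
  have "(\<Sum>i=1..n. of_bool (p \<le> i) * (x i - x (i + 1))) = (\<Sum>i=p..n. x i - x (Suc i))"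
    using assms by (intro sum.mono_neutral_cong_right) auto
  also have "\<dots> = x p - x (n + 1)"
    using assms sum_Suc_diff'[of p "n + 1" "\<lambda>i. - x i"] by (simp add: atLeastLessThanSuc_atLeastAtMost)
  finally have 1: "(\<Sum>i=1..n. of_bool (p \<le> i) * (x i - x (i + 1))) = x p - x (n + 1)" .
  have "(\<Sum>i=1..n. of_nat i * (x i - x (i + 1))) = (\<Sum>q=1..n+1. x q) - of_nat (n + 1) * x (n + 1)"
    by (induction n) (simp_all add: algebra_simps)
  then have "(\<Sum>i=1..n. of_nat i / of_nat (n + 1) * (x i - x (i + 1))) =
      ((\<Sum>q=1..n+1. x q) - of_nat (n + 1) * x (n + 1)) / of_nat (n + 1)"
    by (simp only: times_divide_eq_left sum_divide_distrib[symmetric])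
  also have "\<dots> = (\<Sum>q=1..n+1. x q) / of_nat (n + 1) - x (n + 1)"
    by (simp add: diff_divide_distrib del: of_nat_Suc of_nat_add)
  finally have 2: "(\<Sum>i=1..n. of_nat i / of_nat (n + 1) * (x i - x (i + 1))) =
      (\<Sum>q=1..n+1. x q) / of_nat (n + 1) - x (n + 1)" .
  have "coef n p i * (x i - x (i + 1)) =
      of_bool (p \<le> i) * (x i - x (i + 1)) - of_nat i / of_nat (n + 1) * (x i - x (i + 1))" for i
    by (simp add: coef_def left_diff_distrib)
  then have "(\<Sum>i=1..n. coef n p i * (x i - x (i + 1))) =
      (x p - x (n + 1)) - ((\<Sum>q=1..n+1. x q) / of_nat (n + 1) - x (n + 1))"
    by (simp only: sum_subtractf 1 2)
  then show ?thesis by simp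
qed

lemma gram_commute: "gram n r \<gamma> p q = gram n r \<gamma> q p"
  by (auto simp: gram_def)

text \<open>By \<open>frakB_gram\<close>, \<open>sum_coef_diff\<close> applies once in each index,
  and the means that it subtracts are row sums of \<open>gram\<close>.\<close>

lemma sum_coef_frakB:
  assumes "r \<le> n" "p \<in> {1..n + 1}" "q \<in> {1..n + 1}"
  shows "(\<Sum>i=1..n. \<Sum>j=1..n. coef n p i * coef n q j * frakB r \<gamma> i j) = gram n r \<gamma> p q"
proof -
  have "(\<Sum>j=1..n. coef n q j * frakB r \<gamma> i j) = gram n r \<gamma> i q - gram n r \<gamma> (i + 1) q" if "i \<in> {1..n}" for i
  proof -
    have "(\<Sum>j=1..n. coef n q j * frakB r \<gamma> i j) =
        (\<Sum>j=1..n. coef n q j * (gram n r \<gamma> i j - gram n r \<gamma> i (j + 1)))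
        - (\<Sum>j=1..n. coef n q j * (gram n r \<gamma> (i + 1) j - gram n r \<gamma> (i + 1) (j + 1)))"
      unfolding frakB_gram[of r \<gamma> _ _ n] right_diff_distrib sum_subtractf ..
    then show ?thesis
      unfolding sum_coef_diff[OF assms(3)] using that assms(1) sum_gram[of r n i] sum_gram[of r n "i + 1"] by simp
  qed
  then have "(\<Sum>i=1..n. \<Sum>j=1..n. coef n p i * coef n q j * frakB r \<gamma> i j) =
      (\<Sum>i=1..n. coef n p i * (gram n r \<gamma> i q - gram n r \<gamma> (i + 1) q))"
    by (auto simp: mult.assoc sum_distrib_left[symmetric] intro!: sum.cong)
  also have "\<dots> = gram n r \<gamma> p q"
    using sum_coef_diff[OF assms(2), of "\<lambda>i. gram n r \<gamma> i q"] sum_gram[OF assms(1,3)]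
    by (simp only: gram_commute[of _ _ _ q]) simp
  finally show ?thesis .
qed

definition opB :: "nat \<Rightarrow> (nat \<Rightarrow> nat \<Rightarrow> complex) \<Rightarrow> (nat \<Rightarrow> complex) \<Rightarrow> nat \<Rightarrow> int \<Rightarrow> lop" where
  "opB n e lam p m = (\<Sum>i=1..n. sc (coef n p i) * opb n e lam i m)"

lemma opB_diff:
  assumes "i \<in> {1..n}"
  shows "opB n e lam i m - opB n e lam (i + 1) m = opb n e lam i m"
proof -
  have "opB n e lam i m - opB n e lam (i + 1) m = (\<Sum>j=1..n. if j = i then opb n e lam i m else 0)"
    unfolding opB_def sum_subtractf[symmetric]
    by (intro sum.cong refl) (auto simp: coef_def simp flip: left_diff_distrib sc_diff)
  then show ?thesis using assms by simp
qed

lemma cm_opB_opB: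
  assumes e: "\<And>i j. i \<in> {1..n} \<Longrightarrow> j \<in> {1..n} \<Longrightarrow> (\<Sum>l=1..n. e i l * e j l) = frakB r \<gamma> i j"
    and r: "r \<le> n" and p: "p \<in> {1..n + 1}" and q: "q \<in> {1..n + 1}"
  shows "cm (opB n e lam p m) (opB n e lam q l) = (if m + l = 0 then sc (of_int m * gram n r \<gamma> p q) else 0)"
proof -
  have bb: "cm (opb n e lam i m) (opb n e lam j l) = (if m + l = 0 then sc (of_int m * frakB r \<gamma> i j) else 0)"
    if "i \<in> {1..n}" "j \<in> {1..n}" for i j
    unfolding cm_opb_opb e[OF that] ..
  have "cm (opB n e lam p m) (opB n e lam q l) =
      (\<Sum>j=1..n. \<Sum>i=1..n. if m + l = 0 then sc (of_int m * (coef n p i * coef n q j * frakB r \<gamma> i j)) else 0)"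
    unfolding opB_def cm_sum_left cm_sum_right cm_sc_left cm_sc_right sum_distrib_left
    by (intro sum.cong refl) (auto simp: bb[simplified] mult_ac simp flip: sc_mult)
  also have "\<dots> = (if m + l = 0 then sc (of_int m * gram n r \<gamma> p q) else 0)"
    unfolding sum_coef_frakB[OF r p q, symmetric]
    by (subst sum.swap) (simp add: sc_sum sum_distrib_left)
  finally show ?thesis .
qed

lemma cm_opB_opa: "cm (opB n e lam p m) (opa r s j l) = 0"
  and cm_opB_opd: "cm (opB n e lam p m) (opd r s j l) = 0"
  and cm_Chg_opB: "cm (Chg (charge r N)) (opB n e lam p m) = 0"
  by (simp_all add: opB_def cm_sum_left cm_sc_left cm_opb_opa cm_opb_opd cm_sum_right cm_sc_right cm_Chg_opb)

lemma smooth_opB: "smooth (opB n e lam p)"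
  unfolding opB_def[abs_def] by (intro smooth_sum smooth_mult_left smooth_opb)

section \<open>The currents of gl(n + 1)\<close>

lemma cm_eq_0_swap: "cm X Y = 0 \<Longrightarrow> cm Y X = 0"
  by (simp add: cm_def)

lemma level_Suc: "level r \<gamma> (Suc N) = level r \<gamma> N - of_bool (N \<le> r)"
  by (auto simp: level_def min_def le_Suc_eq)

lemma gl_currents_cong:
  assumes "\<And>q p m. q \<in> {1..N} \<Longrightarrow> p \<in> {1..N} \<Longrightarrow> R q p m = R' q p m" "gl_currents N \<kappa> \<mu> R'"
  shows "gl_currents N \<kappa> \<mu> R"
  using assms(2) unfolding gl_currents_def by (simp add: assms(1) del: atLeastAtMost_iff)

locale wakimoto =
  fixes n r :: nat and \<gamma> :: complex and lam :: "nat \<Rightarrow> complex" and e :: "nat \<Rightarrow> nat \<Rightarrow> complex"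
  assumes r: "r \<le> n"
    and e: "\<And>i j. i \<in> {1..n} \<Longrightarrow> j \<in> {1..n} \<Longrightarrow> (\<Sum>l=1..n. e i l * e j l) = frakB r \<gamma> i j"
begin

text \<open>The parameters of \<open>column_step.cur\<close> are explicit because the locale can be
  entered only once \<open>invariant N\<close> is known. The value 0 out of range lets
  \<open>invariant\<close> speak of all q and p where it asks for commutation and
  smoothness.\<close>

primrec gl_cur :: "nat \<Rightarrow> nat \<Rightarrow> nat \<Rightarrow> int \<Rightarrow> lop" where
  "gl_cur 0 = (\<lambda>q p m. 0)"
| "gl_cur (Suc N) = (\<lambda>q p m. if q \<in> {1..Suc N} \<and> p \<in> {1..Suc N} then
     column_step.cur N (N \<le> r) (\<lambda>p. opa r p N) (\<lambda>p. opd r p N) (gl_cur N)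
       (opB n e lam (Suc N)) (level r \<gamma> N) q p m else 0)"

abbreviation "\<mu> \<equiv> trace_level n r \<gamma>"

definition invariant :: "nat \<Rightarrow> bool" where
  "invariant N \<longleftrightarrow> gl_currents N (level r \<gamma> N) \<mu> (gl_cur N)
     \<and> (\<forall>q p m j s l. N \<le> j \<longrightarrow> cm (gl_cur N q p m) (opa r s j l) = 0
          \<and> cm (gl_cur N q p m) (opd r s j l) = 0 \<and> cm (gl_cur N q p m) (Chg (charge r j)) = 0)
     \<and> (\<forall>q p m j l. N < j \<longrightarrow> j \<le> n + 1 \<longrightarrow> q \<in> {1..N} \<longrightarrow> p \<in> {1..N} \<longrightarrow>
          cm (gl_cur N q p m) (opB n e lam j l) =
            (if q = p then sc (if m + l = 0 then of_int m * (\<mu> - of_bool (j \<le> r + 1)) else 0) else 0))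
     \<and> (N \<le> r + 1 \<longrightarrow> (\<forall>q p. smooth (gl_cur N q p)))"

lemma column_step:
  assumes N: "N \<le> n" and inv: "invariant N"
  shows "column_step N (N \<le> r) (\<lambda>p. opa r p N) (\<lambda>p. opd r p N) (Chg (charge r N)) (gl_cur N)
       (opB n e lam (Suc N)) (level r \<gamma> N) \<mu>"
proof -
  interpret column N "N \<le> r" "\<lambda>p. opa r p N" "\<lambda>p. opd r p N" "Chg (charge r N)"
    by (rule column)
  show ?thesis
  proof
    fix q p m s l
    show "cm (gl_cur N q p m) (opa r s N l) = 0" "cm (gl_cur N q p m) (opd r s N l) = 0"
      using inv by (simp_all add: invariant_def)
    show "cm (Chg (charge r N)) (gl_cur N q p m) = 0"
      using inv by (auto intro!: cm_eq_0_swap[of _ "Chg _"] simp add: invariant_def)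
    show "cm (opB n e lam (Suc N) m) (opa r s N l) = 0" "cm (opB n e lam (Suc N) m) (opd r s N l) = 0"
      "cm (Chg (charge r N)) (opB n e lam (Suc N) m) = 0"
      by (simp_all add: cm_opB_opa cm_opB_opd cm_Chg_opB)
    show "smooth (gl_cur N q p)" if "N \<le> r" using inv that by (simp add: invariant_def)
    show "smooth (opB n e lam (Suc N))" by (rule smooth_opB)
    show "gl_currents N (level r \<gamma> N) \<mu> (gl_cur N)" using inv by (simp add: invariant_def)
    show "cm (opB n e lam (Suc N) m) (gl_cur N q p l) =
        (if m + l = 0 then sc (of_int m * (if q = p then \<mu> - of_bool (N \<le> r) else 0)) else 0)"
      if "q \<in> {1..N}" "p \<in> {1..N}"
    proof -
      have "cm (gl_cur N q p l) (opB n e lam (Suc N) m) =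
          (if q = p then sc (if l + m = 0 then of_int l * (\<mu> - of_bool (Suc N \<le> r + 1)) else 0) else 0)"
        using inv that N unfolding invariant_def by (metis Suc_eq_plus1 add_le_mono1 lessI)
      then show ?thesis
        by (subst cm_swap) (auto simp: add_eq_0_iff simp flip: sc_uminus)
    qed
    show "cm (opB n e lam (Suc N) m) (opB n e lam (Suc N) l) = (if m + l = 0 then
        sc (of_int m * (level r \<gamma> N - of_bool (N \<le> r) + \<mu> + of_nat N * of_bool (N \<le> r))) else 0)"
    proof -
      \<comment> \<open>For N \<le> r the summand N, due to the double contractions of
        \<open>C\<close>, cancels the drop of the level so far, so the entry does not depend on
        N.\<close>
      have "gram n r \<gamma> (Suc N) (Suc N) =
          level r \<gamma> N - of_bool (N \<le> r) + \<mu> + of_nat N * of_bool (N \<le> r)"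
        by (auto simp: gram_def level_def)
      then show ?thesis using N cm_opB_opB[OF e r, of "Suc N" "Suc N" lam m l] by simp
    qed
  qed
qed

lemma invariant:
  assumes "N \<le> n + 1"
  shows "invariant N"
  using assms
proof (induction N)
  case 0
  show ?case by (simp add: invariant_def gl_currents_def)
next
  case (Suc N)
  then have N: "N \<le> n" and inv: "invariant N" by simp_all
  interpret column_step N "N \<le> r" "\<lambda>p. opa r p N" "\<lambda>p. opd r p N" "Chg (charge r N)" "gl_cur N"
    "opB n e lam (Suc N)" "level r \<gamma> N" \<mu>
    by (rule column_step[OF N inv])
  have cur: "gl_cur (Suc N) q p m = cur q p m" if "q \<in> {1..Suc N}" "p \<in> {1..Suc N}" for q p m
    using that by simp
  have out: "gl_cur (Suc N) q p m = 0" if "\<not> (q \<in> {1..Suc N} \<and> p \<in> {1..Suc N})" for q p m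
    using that by auto
  have lev: "level r \<gamma> (Suc N) = \<kappa>'" by (simp only: \<kappa>'_def level_Suc)
  have Z: "cm (gl_cur (Suc N) q p m) Z = 0"
    if "\<And>s l. cm (opa r s N l) Z = 0" "\<And>s l. cm (opd r s N l) Z = 0"
      "\<And>q p m. cm (gl_cur N q p m) Z = 0" "\<And>m. cm (opB n e lam (Suc N) m) Z = 0" for Z q p m
    using cm_cur[of Z "\<lambda>m. 0" q p m] that cur[of q p m] out[of q p m]
    by (cases "q \<in> {1..Suc N} \<and> p \<in> {1..Suc N}") (simp_all del: gl_cur.simps)
  show ?case
    unfolding invariant_def
  proof (intro conjI allI impI)
    show "gl_currents (Suc N) (level r \<gamma> (Suc N)) \<mu> (gl_cur (Suc N))"
      unfolding lev using cur gl_currents_cur by (rule gl_currents_cong)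
    fix q p m j s l
    show "cm (gl_cur (Suc N) q p m) (opa r s j l) = 0" if "Suc N \<le> j"
      using inv that by (intro Z) (auto simp: invariant_def cm_opa_opa cm_opd_opa cm_opB_opa)
    show "cm (gl_cur (Suc N) q p m) (opd r s j l) = 0" if "Suc N \<le> j"
      using inv that by (intro Z) (auto simp: invariant_def cm_opa_opd cm_opd_opd cm_opB_opd)
    show "cm (gl_cur (Suc N) q p m) (Chg (charge r j)) = 0" if "Suc N \<le> j"
      using inv that
      by (intro Z) (auto simp: invariant_def cm_Chg_opa cm_Chg_opd cm_Chg_opB intro!: cm_eq_0_swap[of "Chg _"])
    show "cm (gl_cur (Suc N) q p m) (opB n e lam j l) =
        (if q = p then sc (if m + l = 0 then of_int m * (\<mu> - of_bool (j \<le> r + 1)) else 0) else 0)"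
      if j: "Suc N < j" "j \<le> n + 1" and qp: "q \<in> {1..Suc N}" "p \<in> {1..Suc N}"
      unfolding cur[OF qp]
    proof (rule cm_cur[OF _ _ _ _ qp])
      show "cm (opa r s N l') (opB n e lam j l) = 0" for s l' by (rule cm_eq_0_swap[OF cm_opB_opa])
      show "cm (opd r s N l') (opB n e lam j l) = 0" for s l' by (rule cm_eq_0_swap[OF cm_opB_opd])
      show "cm (gl_cur N q p m) (opB n e lam j l) =
          (if q = p then sc (if m + l = 0 then of_int m * (\<mu> - of_bool (j \<le> r + 1)) else 0) else 0)"
        if "q \<in> {1..N}" "p \<in> {1..N}" for q p m
        using inv that j unfolding invariant_def by (metis Suc_lessD)
      have "gram n r \<gamma> (Suc N) j = \<mu> - of_bool (j \<le> r + 1)" using j(1) by (auto simp: gram_def)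
      then show "cm (opB n e lam (Suc N) m) (opB n e lam j l) =
          sc (if m + l = 0 then of_int m * (\<mu> - of_bool (j \<le> r + 1)) else 0)" for m
        using j cm_opB_opB[OF e r, of "Suc N" j lam m l] by simp
    qed
    show "smooth (gl_cur (Suc N) q p)" if "Suc N \<le> r + 1"
    proof -
      have "gl_cur (Suc N) q p = (if q \<in> {1..Suc N} \<and> p \<in> {1..Suc N} then cur q p else (\<lambda>m. 0))"
        by (auto simp: fun_eq_iff)
      then show ?thesis using smooth_cur that by (simp del: gl_cur.simps)
    qed
  qed
qed

theorem gl_currents_gl_cur: "gl_currents (n + 1) (\<gamma>\<^sup>2 - of_nat (r + 1)) \<mu> (gl_cur (n + 1))"
proof -
  have "level r \<gamma> (n + 1) = \<gamma>\<^sup>2 - of_nat (r + 1)" using r by (simp add: level_def)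
  moreover have "gl_currents (n + 1) (level r \<gamma> (n + 1)) \<mu> (gl_cur (n + 1))"
    using invariant[OF order_refl] unfolding invariant_def by blast
  ultimately show ?thesis by (simp only:)
qed

section \<open>Closed form of the currents\<close>

abbreviation Qc :: "nat \<Rightarrow> nat \<Rightarrow> nat \<Rightarrow> int \<Rightarrow> lop" where
  "Qc j q p \<equiv> nprod (j \<le> r) (opd r q j) (opa r p j)"

lemma gl_cur_Suc:
  assumes "N \<le> n"
  shows "q \<in> {1..N} \<Longrightarrow> p \<in> {1..N} \<Longrightarrow> gl_cur (Suc N) q p m = gl_cur N q p m + Qc N q p m"
    and "p \<in> {1..N} \<Longrightarrow> gl_cur (Suc N) (Suc N) p m = opa r p N m"
    and "gl_cur (Suc N) (Suc N) (Suc N) m = opB n e lam (Suc N) m - (\<Sum>s=1..N. Qc N s s m)"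
    and "q \<in> {1..N} \<Longrightarrow> gl_cur (Suc N) q (Suc N) m =
      - nprod (N \<le> r) (opd r q N) (\<lambda>m. \<Sum>s=1..N. Qc N s s m) m
      - (\<Sum>s=1..N. nprod (N \<le> r) (opd r s N) (gl_cur N q s) m)
      + nprod (N \<le> r) (opd r q N) (opB n e lam (Suc N)) m
      - sc (level r \<gamma> (Suc N) * of_int m) * opd r q N m"
proof -
  interpret column_step N "N \<le> r" "\<lambda>p. opa r p N" "\<lambda>p. opd r p N" "Chg (charge r N)" "gl_cur N"
    "opB n e lam (Suc N)" "level r \<gamma> N" \<mu>
    using assms by (intro column_step invariant) auto
  have lev: "\<kappa>' = level r \<gamma> (Suc N)" by (simp only: \<kappa>'_def level_Suc)
  show "q \<in> {1..N} \<Longrightarrow> p \<in> {1..N} \<Longrightarrow> gl_cur (Suc N) q p m = gl_cur N q p m + Qc N q p m"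
    by (auto simp: cur_def cur_G_def Q_def)
  show "p \<in> {1..N} \<Longrightarrow> gl_cur (Suc N) (Suc N) p m = opa r p N m"
    by (auto simp: cur_def)
  show "gl_cur (Suc N) (Suc N) (Suc N) m = opB n e lam (Suc N) m - (\<Sum>s=1..N. Qc N s s m)"
    by (simp add: cur_def cur_D_def C_def Q_def)
  show "q \<in> {1..N} \<Longrightarrow> gl_cur (Suc N) q (Suc N) m =
      - nprod (N \<le> r) (opd r q N) (\<lambda>m. \<Sum>s=1..N. Qc N s s m) m
      - (\<Sum>s=1..N. nprod (N \<le> r) (opd r s N) (gl_cur N q s) m)
      + nprod (N \<le> r) (opd r q N) (opB n e lam (Suc N)) m
      - sc (level r \<gamma> (Suc N) * of_int m) * opd r q N m"
    by (auto simp: cur_def cur_U_def C_def[abs_def] Q_def lev)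
qed

text \<open>Once a current exists, later columns add only their bilinear terms. They become the sums
  running up to \<open>n\<close> in the generating functions.\<close>

lemma gl_cur_later:
  assumes "N \<le> M" "M \<le> n + 1" "q \<in> {1..N}" "p \<in> {1..N}"
  shows "gl_cur M q p m = gl_cur N q p m + (\<Sum>j=N..<M. Qc j q p m)"
  using assms
proof (induction M rule: dec_induct)
  case (step M)
  then have "gl_cur (Suc M) q p m = gl_cur M q p m + Qc M q p m"
    by (intro gl_cur_Suc(1)) auto
  then show ?case using step by simp
qed simp

end

section \<open>The generating functions as modes of the currents\<close>

lemma Sum_any_int_shift: "Sum_any (\<lambda>p :: int. g (p + c)) = Sum_any g"
  and Sum_any_int_neg: "Sum_any (\<lambda>p :: int. g (- p)) = Sum_any g"
proof -
  have "bij (\<lambda>p :: int. p + c)"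
    using bij_int_plus[of c] by (simp add: add.commute)
  moreover have "bij (uminus :: int \<Rightarrow> int)" by (rule o_bij[of uminus]) auto
  ultimately
  show "Sum_any (\<lambda>p :: int. g (p + c)) = Sum_any g" "Sum_any (\<lambda>p :: int. g (- p)) = Sum_any g"
    using Sum_any.reindex_cong[of "\<lambda>p. p + c" g "\<lambda>p. g (p + c)"]
      Sum_any.reindex_cong[of uminus g "\<lambda>p. g (- p)"]
    by (simp_all add: comp_def)
qed

lemma finite_int_shift: "finite {p :: int. P (p + c)} \<Longrightarrow> finite {p. P p}"
  and finite_int_neg: "finite {p :: int. P (- p)} \<Longrightarrow> finite {p. P p}"
proof -
  assume "finite {p :: int. P (p + c)}"
  then have "finite ((\<lambda>p. p + c) ` {p :: int. P (p + c)})" by simp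
  moreover have "{p. P p} \<subseteq> (\<lambda>p. p + c) ` {p :: int. P (p + c)}"
  proof
    fix p assume "p \<in> {p. P p}"
    then show "p \<in> (\<lambda>p. p + c) ` {p :: int. P (p + c)}" by (intro image_eqI[of _ _ "p - c"]) auto
  qed
  ultimately show "finite {p. P p}" by (rule finite_subset[rotated])
next
  assume "finite {p :: int. P (- p)}"
  then have "finite (uminus ` {p :: int. P (- p)})" by simp
  moreover have "{p. P p} \<subseteq> uminus ` {p :: int. P (- p)}"
  proof
    fix p assume "p \<in> {p. P p}"
    then show "p \<in> uminus ` {p :: int. P (- p)}" by (intro image_eqI[of _ _ "- p"]) auto
  qed
  ultimately show "finite {p. P p}" by (rule finite_subset[rotated])
qed

lemma mode_apply: "mode (A + A') m v = mode A m v + mode A' m v"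
  "mode (A - A') m v = mode A m v - mode A' m v"
  "mode (dscale s A) m v = pscale s (mode A m v)"
  "mode (dderiv A) m v = pscale (of_int (- m)) (A (- m) v)"
  "mode (sum f I) m v = (\<Sum>i\<in>I. mode (f i) m v)"
  by (simp_all add: mode_def dscale_def dderiv_def sum_distr_apply)

context
  fixes r :: nat
begin

lemma lf_nprod_opd:
  "admissible (j \<le> r) Y \<Longrightarrow> lf (\<lambda>s. ordered (j \<le> r) s (opd r q j s) (Y (m - s)))"
  by (rule column.lf_ord[OF column])

lemma admissible_opa: "j' \<le> j \<Longrightarrow> admissible (j \<le> r) (opa r i j')"
  by (simp add: admissible_def smooth_opa)

text \<open>When the factors commute, normal ordering has no effect. The two forms match the orders
  of the products of \<open>fa\<close> with \<open>fas\<close> and of \<open>fas\<close> with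
  \<open>fb\<close>.\<close>

lemma app_nprod_commute:
  assumes "admissible (j \<le> r) Y" "\<And>s l. cm (opd r q j s) (Y l) = 0"
  shows "app (nprod (j \<le> r) (opd r q j) Y m) v = Sum_any (\<lambda>s. app (Y (m - s)) (op_as r q j s v))"
    and "app (nprod (j \<le> r) (opd r q j) Y m) v = Sum_any (\<lambda>s. op_as r q j s (app (Y (m - s)) v))"
proof -
  have *: "opd r q j s * Y l = Y l * opd r q j s" for s l
    using assms(2) by (simp add: cm_eq_0_iff)
  then have **: "app (opd r q j s) (app (Y l) v) = app (Y l) (app (opd r q j s) v)" for s l v
    by (metis app_simps(6))
  have o: "app (ordered (j \<le> r) s (opd r q j s) (Y l)) v = app (Y l) (app (opd r q j s) v)" for s l
    by (simp add: ordered_def **)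
  show "app (nprod (j \<le> r) (opd r q j) Y m) v = Sum_any (\<lambda>s. app (Y (m - s)) (op_as r q j s v))"
    "app (nprod (j \<le> r) (opd r q j) Y m) v = Sum_any (\<lambda>s. op_as r q j s (app (Y (m - s)) v))"
    using app_lsum[OF lf_nprod_opd[OF assms(1)], of q m v]
    by (simp_all add: nprod_def o ** flip: app_opd)
qed

text \<open>The order of the columns matters for convergence: if column j' is standard, so is column
  j, and then \<open>opa r i j\<close> is smooth.\<close>

lemma mode_fa_fas:
  assumes "(i, j) \<noteq> (i', j')" "j \<le> j'"
  shows "mode (fa r i j \<odot> fas r i' j') m v = app (nprod (j' \<le> r) (opd r i' j') (opa r i j) m) v"
proof -
  \<comment> \<open>The total power of z is -m - 1, so power p in \<open>fa\<close> leaves the mode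
    p + m + 1 for a*.\<close>
  have "mode (fa r i j \<odot> fas r i' j') m v = Sum_any (\<lambda>p. op_a r i j (m - (p + (m + 1))) (op_as r i' j' (p + (m + 1)) v))"
    by (simp add: mode_def dmult_def fa_def fas_def algebra_simps)
  also have "\<dots> = Sum_any (\<lambda>s. op_a r i j (m - s) (op_as r i' j' s v))"
    by (rule Sum_any_int_shift)
  also have "\<dots> = app (nprod (j' \<le> r) (opd r i' j') (opa r i j) m) v"
    using assms by (subst app_nprod_commute(1)) (auto simp: admissible_opa cm_opd_opa app_opa)
  finally show ?thesis .
qed

lemma mode_fas_fb:
  "mode (fas r i i \<odot> fb n e lam i) m v = app (nprod (i \<le> r) (opd r i i) (opb n e lam i) m) v"
proof -
  have "mode (fas r i i \<odot> fb n e lam i) m v = Sum_any (\<lambda>p. op_as r i i (- p) (op_b n e lam i (m - (- p)) v))"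
    by (simp add: mode_def dmult_def fb_def fas_def algebra_simps)
  also have "\<dots> = Sum_any (\<lambda>s. op_as r i i s (op_b n e lam i (m - s) v))"
    by (rule Sum_any_int_neg)
  also have "\<dots> = app (nprod (i \<le> r) (opd r i i) (opb n e lam i) m) v"
    by (subst app_nprod_commute(2))
      (auto simp: admissible_def smooth_opb app_opb cm_eq_0_swap[OF cm_opb_opd])
  finally show ?thesis .
qed

lemma mode_aas: "mode (aas r i j) m v = app (nprod (j \<le> r) (opd r i j) (opa r i j) m) v"
proof -
  define g1 where "g1 s = (if j \<le> r \<and> s \<le> m then 0 else op_a r i j (m - s) (op_as r i j s v))" for s
  define g2 where "g2 s = (if j \<le> r \<and> s \<le> m then op_as r i j s (op_a r i j (m - s) v) else 0)" for s
  have 1: "a_plus r i j p (fas r i j (- m - 1 - p) v) = g1 (p + (m + 1))" for p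
    by (auto simp: a_plus_def fa_def fas_def g1_def algebra_simps minus_diff_commute)
  have 2: "fas r i j p (a_minus r i j (- m - 1 - p) v) = g2 (- p)" for p
    by (auto simp: a_minus_def fa_def fas_def g2_def op_as_def algebra_simps)
  have "finite {p. g1 (p + (m + 1)) \<noteq> 0}"
    using aas_locally_finite(1)[of r i j] unfolding locally_finite_def 1[symmetric] by blast
  then have f1: "finite {s. g1 s \<noteq> 0}" by (rule finite_int_shift)
  have "finite {p. g2 (- p) \<noteq> 0}"
    using aas_locally_finite(2)[of r i j] unfolding locally_finite_def 2[symmetric] by blast
  then have f2: "finite {s. g2 s \<noteq> 0}" by (rule finite_int_neg)
  have "mode (aas r i j) m v = Sum_any (\<lambda>p. g1 (p + (m + 1))) + Sum_any (\<lambda>p. g2 (- p))"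
    by (simp add: mode_def aas_def nord_def dmult_def 1 2)
  also have "\<dots> = Sum_any g1 + Sum_any g2"
    unfolding Sum_any_int_shift[of g1] Sum_any_int_neg[of g2] ..
  also have "\<dots> = Sum_any (\<lambda>s. g1 s + g2 s)"
    by (rule Sum_any.distrib[OF f1 f2, symmetric])
  also have "(\<lambda>s. g1 s + g2 s) = (\<lambda>s. app (ordered (j \<le> r) s (opd r i j s) (opa r i j (m - s))) v)"
  proof
    fix s
    \<comment> \<open>The thresholds are s \<le> m in \<open>aas\<close> and s \<le> 0 in
      \<open>ordered\<close>: for m = 0 they coincide, otherwise the factors commute.\<close>
    have "opd r i j s * opa r i j (m - s) = opa r i j (m - s) * opd r i j s" if "m \<noteq> 0"
      using cm_opd_opa[of r i j s i j "m - s"] that by (simp add: cm_eq_0_iff)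
    then have "app (opd r i j s) (app (opa r i j (m - s)) v) = app (opa r i j (m - s)) (app (opd r i j s) v)"
      if "m \<noteq> 0" using that by (metis app_simps(6))
    then show "g1 s + g2 s = app (ordered (j \<le> r) s (opd r i j s) (opa r i j (m - s))) v"
      by (cases "m = 0") (auto simp: g1_def g2_def ordered_def app_opa app_opd)
  qed
  also have "Sum_any \<dots> = app (nprod (j \<le> r) (opd r i j) (opa r i j) m) v"
    unfolding nprod_def by (subst app_lsum[OF lf_nprod_opd]) (simp_all add: admissible_opa)
  finally show ?thesis .
qed

text \<open>Here the splitting is by the mode of a*, as in \<open>ordered\<close>, so the terms
  agree one by one without moving \<open>Y\<close> past a*.\<close>

lemma mode_nord_as:
  assumes Y: "admissible (i \<le> r) Y" and C: "\<And>m v. mode C m v = app (Y m) v"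
    and fin: "locally_finite (as_plus r i i) C" "locally_finite C (as_minus r i i)"
  shows "mode (nord (as_plus r i i) (as_minus r i i) C) m v = app (nprod (i \<le> r) (opd r i i) Y m) v"
proof -
  have C': "C k v = app (Y (- k - 1)) v" for k v using C[of "- k - 1" v] by (simp add: mode_def)
  define g1 where "g1 s = (if i \<le> r \<and> s \<le> 0 then op_as r i i s (app (Y (m - s)) v) else 0)" for s
  define g2 where "g2 s = (if i \<le> r \<and> s \<le> 0 then 0 else app (Y (m - s)) (op_as r i i s v))" for s
  have 1: "as_plus r i i p (C (- m - 1 - p) v) = g1 (- p)" for p
    by (auto simp: as_plus_def fas_def g1_def C' algebra_simps)
  have 2: "C p (as_minus r i i (- m - 1 - p) v) = g2 (p + (m + 1))" for p
    by (auto simp: as_minus_def fas_def g2_def C' algebra_simps minus_diff_commute)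
  have "finite {p. g1 (- p) \<noteq> 0}"
    using fin(1) unfolding locally_finite_def 1[symmetric] by blast
  then have f1: "finite {s. g1 s \<noteq> 0}" by (rule finite_int_neg)
  have "finite {p. g2 (p + (m + 1)) \<noteq> 0}"
    using fin(2) unfolding locally_finite_def 2[symmetric] by blast
  then have f2: "finite {s. g2 s \<noteq> 0}" by (rule finite_int_shift)
  have "mode (nord (as_plus r i i) (as_minus r i i) C) m v = Sum_any (\<lambda>p. g1 (- p)) + Sum_any (\<lambda>p. g2 (p + (m + 1)))"
    by (simp add: mode_def nord_def dmult_def 1 2)
  also have "\<dots> = Sum_any g1 + Sum_any g2"
    unfolding Sum_any_int_shift[of g2] Sum_any_int_neg[of g1] ..
  also have "\<dots> = Sum_any (\<lambda>s. g1 s + g2 s)"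
    by (rule Sum_any.distrib[OF f1 f2, symmetric])
  also have "(\<lambda>s. g1 s + g2 s) = (\<lambda>s. app (ordered (i \<le> r) s (opd r i i s) (Y (m - s))) v)"
    by (auto simp: fun_eq_iff g1_def g2_def ordered_def app_opd)
  also have "Sum_any \<dots> = app (nprod (i \<le> r) (opd r i i) Y m) v"
    unfolding nprod_def by (subst app_lsum[OF lf_nprod_opd[OF Y]]) simp
  finally show ?thesis .
qed

end

context wakimoto
begin

lemma mode_rho_F:
  assumes "i \<in> {1..n}"
  shows "mode (rho_F n r i) m v = app (gl_cur (n + 1) (i + 1) i m) v"
proof -
  have "gl_cur (n + 1) (i + 1) i m = gl_cur (Suc i) (Suc i) i m + (\<Sum>j=Suc i..<n+1. Qc j (Suc i) i m)"
    using assms gl_cur_later[of "Suc i" "n + 1" "Suc i" i m] by (simp del: gl_cur.simps)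
  also have "gl_cur (Suc i) (Suc i) i m = opa r i i m"
    using assms by (intro gl_cur_Suc) auto
  also have "{Suc i..<n+1} = {i+1..n}" by auto
  finally have "app (gl_cur (n + 1) (i + 1) i m) v = op_a r i i m v + (\<Sum>j=i+1..n. app (Qc j (i + 1) i m) v)"
    by (simp add: app_opa app_sum_left)
  moreover have "mode (fa r i i) m v = op_a r i i m v" by (simp add: mode_def fa_def)
  ultimately show ?thesis by (simp add: rho_F_def mode_apply mode_fa_fas)
qed

lemma gl_cur_diag:
  assumes "N \<le> n"
  shows "gl_cur (n + 1) (Suc N) (Suc N) m =
    opB n e lam (Suc N) m - (\<Sum>s=1..N. Qc N s s m) + (\<Sum>j=Suc N..n. Qc j (Suc N) (Suc N) m)"
proof -
  have "gl_cur (n + 1) (Suc N) (Suc N) m = gl_cur (Suc N) (Suc N) (Suc N) m + (\<Sum>j=Suc N..<n+1. Qc j (Suc N) (Suc N) m)"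
    using assms by (intro gl_cur_later) auto
  also have "{Suc N..<n+1} = {Suc N..n}" by auto
  finally show ?thesis using gl_cur_Suc(3)[OF assms, of m] by (simp del: gl_cur.simps)
qed

lemma mode_fb: "mode (fb n e lam i) m v = app (opb n e lam i m) v"
  by (simp add: mode_def fb_def app_opb)

text \<open>The factor 2 arises because \<open>Qc i i i\<close> enters E_ii as the term added by
  column i, and E_(i+1,i+1) through minus the trace of column i.\<close>

lemma mode_rho_H:
  assumes "i \<in> {1..n}"
  shows "mode (rho_H n r e lam i) m v = app (gl_cur (n + 1) i i m - gl_cur (n + 1) (i + 1) (i + 1) m) v"
proof -
  obtain N where N: "i = Suc N" using assms by (cases i) auto
  have Nn: "N \<le> n" "Suc N \<le> n" using assms N by auto
  have b: "opB n e lam i m - opB n e lam (i + 1) m = opb n e lam i m"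
    using assms by (rule opB_diff)
  have s1: "(\<Sum>s=1..i. Qc i s s m) = (\<Sum>s=1..<i. Qc i s s m) + Qc i i i m"
    using assms by (simp add: N sum.atLeast_Suc_atMost_Suc_shift atLeastLessThanSuc_atLeastAtMost)
  have s2: "(\<Sum>s=1..N. Qc N s s m) = (\<Sum>s=1..<i. Qc N s s m)"
    by (simp add: N atLeastLessThanSuc_atLeastAtMost)
  have s3: "(\<Sum>j=Suc N..n. Qc j i i m) = Qc i i i m + (\<Sum>j=i+1..n. Qc j i i m)"
    using assms by (simp add: N sum.atLeast_Suc_atMost)
  have "gl_cur (n + 1) i i m - gl_cur (n + 1) (i + 1) (i + 1) m =
      (opB n e lam i m - opB n e lam (i + 1) m) + (\<Sum>s=1..i. Qc i s s m) - (\<Sum>s=1..N. Qc N s s m)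
      + (\<Sum>j=Suc N..n. Qc j i i m) - (\<Sum>j=i+1..n. Qc j (i + 1) (i + 1) m)"
    using gl_cur_diag[OF Nn(1), of m] gl_cur_diag[OF Nn(2), of m] unfolding N by (simp del: gl_cur.simps)
  also have "\<dots> = opb n e lam i m + (\<Sum>s=1..<i. Qc i s s m - Qc (i - 1) s s m) + (Qc i i i m + Qc i i i m)
      + (\<Sum>j=i+1..n. Qc j i i m - Qc j (i + 1) (i + 1) m)"
    unfolding b s1 s2 s3 sum_subtractf by (simp add: N)
  finally have "app (gl_cur (n + 1) i i m - gl_cur (n + 1) (i + 1) (i + 1) m) v =
      app (opb n e lam i m) v + (\<Sum>s=1..<i. app (Qc i s s m) v - app (Qc (i - 1) s s m) v)
      + pscale 2 (app (Qc i i i m) v)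
      + (\<Sum>j=i+1..n. app (Qc j i i m) v - app (Qc j (i + 1) (i + 1) m) v)"
    using pscale_add_left[of 1 1 "app (Qc i i i m) v"]
    by (simp only: app_simps app_sum_left) simp
  then show ?thesis by (simp add: rho_H_def mode_apply mode_aas mode_fb)
qed

text \<open>The current appears first at the step N = i. There \<open>gl_cur i i s\<close> is
  a_(s,i-1) for s < i, giving the sum over a_(k,i-1) a*_(ki). For s = i it is B_i minus the trace of
  column i - 1; with the remaining terms this leaves the difference of the traces of columns i - 1
  and i, minus b_i. Later columns add the sum over k > i.\<close>

lemma mode_rho_E:
  assumes "i \<in> {1..n}"
  shows "mode (rho_E n r \<gamma> e lam i) m v = app (gl_cur (n + 1) i (i + 1) m) v"
proof -
  obtain N where N: "i = Suc N" using assms by (cases i) auto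
  have Nn: "N \<le> n" "i \<le> n" using assms N by auto
  let ?P = "\<lambda>Y. nprod (i \<le> r) (opd r i i) Y m"
  define CN where "CN m = (\<Sum>s=1..N. Qc N s s m)" for m
  define Ci where "Ci m = (\<Sum>s=1..i. Qc i s s m)" for m
  define b where "b = opb n e lam i"
  have CN: "admissible (i \<le> r) CN" and Ci: "admissible (i \<le> r) Ci"
    using column.adm_C[OF column[of N r]] column.adm_C[OF column[of i r]] N
    unfolding CN_def[abs_def] Ci_def[abs_def]
    by (auto simp: admissible_def column.C_def[OF column, abs_def] column.Q_def[OF column])
  have b: "admissible (i \<le> r) b" and B: "admissible (i \<le> r) (opB n e lam p)" for p
    by (simp_all add: b_def admissible_def smooth_opb smooth_opB)
  note adm = CN Ci b B column.adm_intros[OF column[of i r]]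
  note wick_diff = column.wick_diff[OF column[of i r]]
  have B_diff: "(\<lambda>m. opB n e lam i m - opB n e lam (Suc i) m) = b"
    using opB_diff[OF assms, of e lam] by (simp add: b_def fun_eq_iff)
  have s: "(\<Sum>s=1..i. nprod (i \<le> r) (opd r s i) (gl_cur i i s) m) =
      (\<Sum>s=1..<i. nprod (i \<le> r) (opd r s i) (opa r s (i - 1)) m) + ?P (\<lambda>m. opB n e lam i m - CN m)"
  proof -
    have "gl_cur i i s = opa r s N" if "s \<in> {1..N}" for s
      unfolding N using gl_cur_Suc(2)[OF Nn(1) that] by (intro ext)
    moreover have "gl_cur i i i = (\<lambda>m. opB n e lam i m - CN m)"
      unfolding N CN_def using gl_cur_Suc(3)[OF Nn(1)] by (intro ext)
    ultimately show ?thesis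
      by (simp add: N atLeastLessThanSuc_atLeastAtMost del: gl_cur.simps)
  qed
  have "gl_cur (n + 1) i (i + 1) m = gl_cur (Suc i) i (Suc i) m + (\<Sum>j=Suc i..<n+1. Qc j i (Suc i) m)"
    using assms gl_cur_later[of "Suc i" "n + 1" i "Suc i" m] by (simp del: gl_cur.simps)
  also have "{Suc i..<n+1} = {i+1..n}" by auto
  also have "gl_cur (Suc i) i (Suc i) m = - ?P Ci - (\<Sum>s=1..i. nprod (i \<le> r) (opd r s i) (gl_cur i i s) m)
      + ?P (opB n e lam (Suc i)) - sc (level r \<gamma> (Suc i) * of_int m) * opd r i i m"
    unfolding Ci_def using assms by (intro gl_cur_Suc(4)) auto
  also have "\<dots> = ?P (\<lambda>m. CN m - Ci m) - ?P b - (\<Sum>s=1..<i. nprod (i \<le> r) (opd r s i) (opa r s (i - 1)) m)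
      - sc (level r \<gamma> (Suc i) * of_int m) * opd r i i m"
    unfolding s B_diff[symmetric] by (simp add: wick_diff adm)
  finally have "app (gl_cur (n + 1) i (i + 1) m) v = app (?P (\<lambda>m. CN m - Ci m)) v - app (?P b) v
      - (\<Sum>s=1..<i. app (nprod (i \<le> r) (opd r s i) (opa r s (i - 1)) m) v)
      - pscale (level r \<gamma> (Suc i) * of_int m) (op_as r i i m v) + (\<Sum>j=i+1..n. app (Qc j i (i + 1) m) v)"
    by (simp add: app_sum_left app_opd)
  moreover have "mode (nord (as_plus r i i) (as_minus r i i) ((\<Sum>k=1..<i. aas r k (i - 1)) - (\<Sum>k=1..i. aas r k i))) m v
      = app (?P (\<lambda>m. CN m - Ci m)) v"
  proof (rule mode_nord_as)
    show "admissible (i \<le> r) (\<lambda>m. CN m - Ci m)" by (intro adm)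
    show "mode ((\<Sum>k=1..<i. aas r k (i - 1)) - (\<Sum>k=1..i. aas r k i)) m v = app (CN m - Ci m) v" for m v
      by (simp add: mode_apply mode_aas CN_def Ci_def app_sum_left N atLeastLessThanSuc_atLeastAtMost)
  qed (rule aas_sum_locally_finite)+
  moreover have "mode (fas r i i \<odot> fb n e lam i) m v = app (?P b) v"
    unfolding b_def by (rule mode_fas_fb)
  moreover have "pscale ((if i > r then of_nat (r + 1) else 0) + (if i \<le> r then of_nat (i + 1) else 0) - \<gamma>\<^sup>2)
      (mode (dderiv (fas r i i)) m v) = pscale (level r \<gamma> (Suc i) * of_int m) (op_as r i i m v)"
  proof -
    \<comment> \<open>The two indicators together give the minimum of i + 1 and r + 1, so the
      coefficient of the derivative is minus the level after column i.\<close>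
    have "(if i > r then of_nat (r + 1) else 0) + (if i \<le> r then of_nat (i + 1) else 0) - \<gamma>\<^sup>2 = - level r \<gamma> (Suc i)"
      by (simp add: level_def)
    then show ?thesis by (simp add: mode_apply fas_def pscale_pscale)
  qed
  moreover have "mode (fa r (i + 1) k \<odot> fas r i k) m v = app (Qc k i (i + 1) m) v" for k
    by (rule mode_fa_fas) auto
  moreover have "mode (fa r k (i - 1) \<odot> fas r k i) m v = app (nprod (i \<le> r) (opd r k i) (opa r k (i - 1)) m) v" for k
    using N by (intro mode_fa_fas) auto
  ultimately show ?thesis by (simp add: rho_E_def mode_apply)
qed

end

section \<open>Invariance of the Fock space\<close>

lemma fock_iff: "v \<in> fock n \<longleftrightarrow> pvars v \<subseteq> indets n"
  by (auto simp: fock_def pvars_def)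

definition preserves :: "nat \<Rightarrow> lop \<Rightarrow> bool" where
  "preserves n X \<longleftrightarrow> (\<forall>v\<in>fock n. app X v \<in> fock n)"

lemma fock_0: "0 \<in> fock n" and fock_add: "u \<in> fock n \<Longrightarrow> v \<in> fock n \<Longrightarrow> u + v \<in> fock n"
  and fock_uminus: "v \<in> fock n \<Longrightarrow> - v \<in> fock n" and fock_pscale: "v \<in> fock n \<Longrightarrow> pscale s v \<in> fock n"
  using pvars_add[of u v] pvars_pscale[of s v] by (auto simp: fock_iff)

lemma fock_diff: "u \<in> fock n \<Longrightarrow> v \<in> fock n \<Longrightarrow> u - v \<in> fock n"
  using fock_add[OF _ fock_uminus, of u n v] by simp

lemma fock_sum: "(\<And>i. i \<in> I \<Longrightarrow> f i \<in> fock n) \<Longrightarrow> sum f I \<in> fock n"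
  by (induction I rule: infinite_finite_induct) (simp_all add: fock_0 fock_add)

lemma preserves_add: "preserves n X \<Longrightarrow> preserves n Y \<Longrightarrow> preserves n (X + Y)"
  and preserves_diff: "preserves n X \<Longrightarrow> preserves n Y \<Longrightarrow> preserves n (X - Y)"
  and preserves_uminus: "preserves n X \<Longrightarrow> preserves n (- X)"
  and preserves_mult: "preserves n X \<Longrightarrow> preserves n Y \<Longrightarrow> preserves n (X * Y)"
  and preserves_sc: "preserves n (sc s)"
  by (simp_all add: preserves_def fock_0 fock_add fock_diff fock_uminus fock_pscale)

lemma preserves_sum: "(\<And>i. i \<in> I \<Longrightarrow> preserves n (F i)) \<Longrightarrow> preserves n (sum F I)"
  by (simp add: preserves_def app_sum_left fock_sum)

text \<open>All default values, of \<open>lsum\<close> and of infinite sums, are 0 and thus in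
  \<open>fock n\<close>, so convergence plays no part.\<close>

lemma preserves_lsum: "(\<And>i. preserves n (F i)) \<Longrightarrow> preserves n (lsum F)"
  by (simp add: preserves_def lsum.rep_eq fock_0 Sum_any.expand_set fock_sum)

lemma preserves_nprod:
  "(\<And>j. preserves n (X j)) \<Longrightarrow> (\<And>j. preserves n (Y j)) \<Longrightarrow> preserves n (nprod std X Y m)"
  by (simp add: nprod_def ordered_def preserves_lsum preserves_mult)

lemma preserves_Mul: "x \<in> indets n \<Longrightarrow> preserves n (Mul x)"
  using pvars_pmult by (fastforce simp: preserves_def fock_iff Mul.rep_eq)

lemma pvars_pdiff: "pvars (pdiff x f) \<subseteq> pvars f"
proof
  fix y assume "y \<in> pvars (pdiff x f)"
  then obtain \<mu> where \<mu>: "lk (pdiff x f) \<mu> \<noteq> 0" "lk \<mu> y \<noteq> 0"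
    by (auto simp: pvars_def in_keys_iff)
  then have "lk f (\<mu> + Poly_Mapping.single x 1) \<noteq> 0" "lk (\<mu> + Poly_Mapping.single x 1) y \<noteq> 0"
    by (auto simp: lookup_pdiff lookup_add)
  then show "y \<in> pvars f" unfolding pvars_def in_keys_iff[symmetric] by blast
qed

lemma preserves_Der: "preserves n (Der x)"
  using pvars_pdiff by (fastforce simp: preserves_def fock_iff Der.rep_eq)

lemma preserves_opa: "i \<in> {1..j} \<Longrightarrow> j \<le> n \<Longrightarrow> preserves n (opa r i j m)"
  and preserves_opd: "i \<in> {1..j} \<Longrightarrow> j \<le> n \<Longrightarrow> preserves n (opd r i j m)"
  by (auto simp: opa_def opd_def indets_def intro!: preserves_Mul preserves_Der preserves_uminus)

lemma preserves_opB: "preserves n (opB n e lam p m)"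
  unfolding opB_def opb_def
  by (auto simp: indets_def intro!: preserves_sum preserves_mult preserves_sc preserves_Mul preserves_Der)

text \<open>Puts the central terms into the shape of scalars times indicators, ready for summation
  over four matrix indices.\<close>

lemma sc_mult_anomaly:
  "sc c * (X - Y + (if P then sc (m * ((if A then u else 0) + (if B then u' else 0))) else 0)) =
    sc c * X - sc c * Y + (if P then sc (m * u) * (sc c * (if A then 1 else 0))
      + sc (m * u') * (sc c * (if B then 1 else 0)) else 0)"
proof -
  have *: "sc (m * z) * sc c = sc c * sc (m * z)" for z by (rule sc_commute[symmetric])
  show ?thesis
    by (cases P; cases A; cases B) (simp_all add: distrib_left right_diff_distrib sc_add *)
qed

context wakimoto
begin

lemma preserves_gl_cur:
  "N \<le> n + 1 \<Longrightarrow> q \<in> {1..N} \<Longrightarrow> p \<in> {1..N} \<Longrightarrow> preserves n (gl_cur N q p m)"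
proof (induction N arbitrary: q p m)
  case (Suc N)
  then have N: "N \<le> n" by simp
  have IH: "preserves n (gl_cur N q p m)" if "q \<in> {1..N}" "p \<in> {1..N}" for q p m
    using Suc.IH that N by simp
  note pres = preserves_add preserves_diff preserves_uminus preserves_mult preserves_sc
    preserves_nprod preserves_sum preserves_opa[OF _ N] preserves_opd[OF _ N] preserves_opB IH
  have Q: "preserves n (Qc N q p m)" if "q \<in> {1..N}" "p \<in> {1..N}" for q p m
    using that by (intro pres)
  have "q \<in> {1..N} \<or> q = Suc N" "p \<in> {1..N} \<or> p = Suc N" using Suc.prems by auto
  then consider "q \<in> {1..N}" "p \<in> {1..N}" | "q = Suc N" "p \<in> {1..N}" | "q = Suc N" "p = Suc N"
    | "q \<in> {1..N}" "p = Suc N" by blast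
  then show ?case
  proof cases
    case 1
    show ?thesis unfolding gl_cur_Suc(1)[OF N 1] using 1 by (intro pres)
  next
    case 2
    show ?thesis unfolding 2(1) gl_cur_Suc(2)[OF N 2(2)] using 2(2) by (intro pres)
  next
    case 3
    show ?thesis unfolding 3 gl_cur_Suc(3)[OF N] by (intro pres)
  next
    case 4
    show ?thesis unfolding 4(2) gl_cur_Suc(4)[OF N 4(1)] using 4(1) by (intro pres)
  qed
qed simp


section \<open>The representation\<close>

abbreviation k :: complex where "k \<equiv> \<gamma>\<^sup>2 - of_nat (r + 1)"

declare gl_cur.simps [simp del]

abbreviation R :: "nat \<Rightarrow> nat \<Rightarrow> int \<Rightarrow> lop" where
  "R i j m \<equiv> gl_cur (n + 1) (Suc i) (Suc j) m"

definition loop_op :: "complex mat \<Rightarrow> int \<Rightarrow> lop" where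
  "loop_op A m = (\<Sum>i<n+1. \<Sum>j<n+1. sc (A $$ (i, j)) * R i j m)"

lemma cm_R:
  assumes "i < n + 1" "j < n + 1" "s < n + 1" "t < n + 1"
  shows "cm (R i j m) (R s t l) = (if j = s then R i t (m + l) else 0) - (if i = t then R s j (m + l) else 0)
    + (if m + l = 0 then sc (of_int m * ((if j = s \<and> i = t then k else 0)
        + (if i = j \<and> s = t then \<mu> else 0))) else 0)"
proof -
  have "Suc x \<in> {1..n + 1}" if "x < n + 1" for x using that by simp
  then show ?thesis
    using gl_currents_gl_cur assms unfolding gl_currents_def by (simp del: atLeastAtMost_iff)
qed

lemma loop_op_add: "A \<in> carrier_mat (n + 1) (n + 1) \<Longrightarrow> B \<in> carrier_mat (n + 1) (n + 1) \<Longrightarrow>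
    loop_op (A + B) m = loop_op A m + loop_op B m"
  and loop_op_diff: "A \<in> carrier_mat (n + 1) (n + 1) \<Longrightarrow> B \<in> carrier_mat (n + 1) (n + 1) \<Longrightarrow>
    loop_op (A - B) m = loop_op A m - loop_op B m"
  and loop_op_smult: "A \<in> carrier_mat (n + 1) (n + 1) \<Longrightarrow> loop_op (s \<cdot>\<^sub>m A) m = sc s * loop_op A m"
  unfolding loop_op_def sum_distrib_left
  by (auto simp: sum.distrib[symmetric] sum_subtractf[symmetric] sc_add sc_diff sc_mult distrib_right
      left_diff_distrib mult.assoc intro!: sum.cong)

lemma loop_op_0 [simp]: "loop_op (0\<^sub>m (Suc n) (Suc n)) m = 0"
  by (simp add: loop_op_def)

lemma loop_op_matE:
  assumes "i \<in> {1..n + 1}" "j \<in> {1..n + 1}"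
  shows "loop_op (matE n i j) m = gl_cur (n + 1) i j m"
proof -
  obtain i' j' where ij: "i = Suc i'" "j = Suc j'" using assms by (cases i; cases j) auto
  have "loop_op (matE n i j) m = (\<Sum>s<n+1. \<Sum>t<n+1. if t = j' then if s = i' then R i' j' m else 0 else 0)"
    unfolding loop_op_def by (intro sum.cong refl) (auto simp: matE_def ij)
  then show ?thesis using assms by (simp add: ij)
qed

lemma mult_mat_index:
  "A \<in> carrier_mat (n + 1) (n + 1) \<Longrightarrow> B \<in> carrier_mat (n + 1) (n + 1) \<Longrightarrow> i < n + 1 \<Longrightarrow> j < n + 1 \<Longrightarrow>
    (A * B) $$ (i, j) = (\<Sum>s<n+1. A $$ (i, s) * B $$ (s, j) :: complex)"
  by (auto simp: scalar_prod_def lessThan_atLeast0 intro!: sum.cong)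

text \<open>Contracting the indices yields A B, B A and tr(A B). The part with \<mu> is a multiple
  of tr(A) tr(B), which vanishes on sl(n + 1), so that the level \<open>k\<close> alone
  survives.\<close>

lemma cm_loop_op:
  assumes A: "A \<in> sl n" and B: "B \<in> sl n"
  shows "cm (loop_op A m) (loop_op B l) = loop_op (mcomm A B) (m + l)
    + (if m + l = 0 then sc (of_int m * mtrace (A * B) * k) else 0)"
proof -
  let ?d = "n + 1"
  note [simp del] = sum.lessThan_Suc
  have cA: "A \<in> carrier_mat ?d ?d" and cB: "B \<in> carrier_mat ?d ?d"
    and tA: "(\<Sum>i<?d. A $$ (i, i)) = 0" and tB: "(\<Sum>i<?d. B $$ (i, i)) = 0"
    using A B by (auto simp: sl_def mtrace_def)
  let ?S = "\<lambda>f. \<Sum>i<?d. \<Sum>j<?d. \<Sum>s<?d. \<Sum>t<?d. sc (A $$ (i, j) * B $$ (s, t)) * f i j s t"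
  have "cm (loop_op A m) (loop_op B l) = ?S (\<lambda>i j s t. cm (R i j m) (R s t l))"
    unfolding loop_op_def cm_sum_left cm_sc_left unfolding cm_sum_right cm_sc_right sum_distrib_left
    by (simp only: sc_mult mult.assoc)
  also have "\<dots> = ?S (\<lambda>i j s t. if j = s then R i t (m + l) else 0)
      - ?S (\<lambda>i j s t. if i = t then R s j (m + l) else 0)
      + (if m + l = 0 then
          sc (of_int m * k) * ?S (\<lambda>i j s t. if j = s \<and> i = t then 1 else 0)
          + sc (of_int m * \<mu>) * ?S (\<lambda>i j s t. if i = j \<and> s = t then 1 else 0) else 0)"
  proof -
    have "sc (A $$ (i, j) * B $$ (s, t)) * cm (R i j m) (R s t l) =
        sc (A $$ (i, j) * B $$ (s, t)) * (if j = s then R i t (m + l) else 0)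
        - sc (A $$ (i, j) * B $$ (s, t)) * (if i = t then R s j (m + l) else 0)
        + (if m + l = 0 then
            sc (of_int m * k) * (sc (A $$ (i, j) * B $$ (s, t)) * (if j = s \<and> i = t then 1 else 0))
            + sc (of_int m * \<mu>) * (sc (A $$ (i, j) * B $$ (s, t)) * (if i = j \<and> s = t then 1 else 0)) else 0)"
      if "i < ?d" "j < ?d" "s < ?d" "t < ?d" for i j s t
      unfolding cm_R[OF that] by (rule sc_mult_anomaly)
    then have "?S (\<lambda>i j s t. cm (R i j m) (R s t l)) = (\<Sum>i<?d. \<Sum>j<?d. \<Sum>s<?d. \<Sum>t<?d.
        sc (A $$ (i, j) * B $$ (s, t)) * (if j = s then R i t (m + l) else 0)
        - sc (A $$ (i, j) * B $$ (s, t)) * (if i = t then R s j (m + l) else 0)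
        + (if m + l = 0 then
            sc (of_int m * k) * (sc (A $$ (i, j) * B $$ (s, t)) * (if j = s \<and> i = t then 1 else 0))
            + sc (of_int m * \<mu>) * (sc (A $$ (i, j) * B $$ (s, t)) * (if i = j \<and> s = t then 1 else 0)) else 0))"
      by (intro sum.cong refl) simp
    then show ?thesis
      by (cases "m + l = 0") (simp_all only: sum.distrib sum_subtractf sum_distrib_left if_True if_False add_0_right simp_thms)
  qed
  also have "?S (\<lambda>i j s t. if j = s then R i t (m + l) else 0) = loop_op (A * B) (m + l)"
  proof -
    have "?S (\<lambda>i j s t. if j = s then R i t (m + l) else 0) =
        (\<Sum>i<?d. \<Sum>j<?d. \<Sum>s<?d. if s = j then \<Sum>t<?d. sc (A $$ (i, j) * B $$ (j, t)) * R i t (m + l) else 0)"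
      by (intro sum.cong refl) auto
    also have "\<dots> = (\<Sum>i<?d. \<Sum>j<?d. \<Sum>t<?d. sc (A $$ (i, j) * B $$ (j, t)) * R i t (m + l))"
      by (rule sum.cong[OF refl], rule sum.cong[OF refl]) simp
    also have "\<dots> = (\<Sum>i<?d. \<Sum>t<?d. \<Sum>j<?d. sc (A $$ (i, j) * B $$ (j, t)) * R i t (m + l))"
      by (intro sum.cong refl sum.swap)
    also have "\<dots> = loop_op (A * B) (m + l)"
      unfolding loop_op_def
      by (intro sum.cong refl) (simp add: mult_mat_index[OF cA cB] sc_sum sum_distrib_right)
    finally show ?thesis .
  qed
  also have "?S (\<lambda>i j s t. if i = t then R s j (m + l) else 0) = loop_op (B * A) (m + l)"
  proof -
    have "?S (\<lambda>i j s t. if i = t then R s j (m + l) else 0) =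
        (\<Sum>i<?d. \<Sum>j<?d. \<Sum>s<?d. \<Sum>t<?d. if t = i then sc (A $$ (i, j) * B $$ (s, i)) * R s j (m + l) else 0)"
      by (intro sum.cong refl) auto
    also have "\<dots> = (\<Sum>i<?d. \<Sum>j<?d. \<Sum>s<?d. sc (A $$ (i, j) * B $$ (s, i)) * R s j (m + l))"
      by (intro sum.cong refl) simp
    also have "\<dots> = (\<Sum>i<?d. \<Sum>s<?d. \<Sum>j<?d. sc (A $$ (i, j) * B $$ (s, i)) * R s j (m + l))"
      by (intro sum.cong refl sum.swap)
    also have "\<dots> = (\<Sum>s<?d. \<Sum>i<?d. \<Sum>j<?d. sc (A $$ (i, j) * B $$ (s, i)) * R s j (m + l))"
      by (rule sum.swap)
    also have "\<dots> = (\<Sum>s<?d. \<Sum>j<?d. \<Sum>i<?d. sc (A $$ (i, j) * B $$ (s, i)) * R s j (m + l))"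
      by (intro sum.cong refl sum.swap)
    also have "\<dots> = loop_op (B * A) (m + l)"
      unfolding loop_op_def
      by (intro sum.cong refl)
        (simp add: mult_mat_index[OF cB cA] sc_sum sum_distrib_right mult.commute[of "A $$ _"])
    finally show ?thesis .
  qed
  also have "?S (\<lambda>i j s t. if j = s \<and> i = t then 1 else 0) = sc (mtrace (A * B))"
  proof -
    have "?S (\<lambda>i j s t. if j = s \<and> i = t then 1 else 0) =
        (\<Sum>i<?d. \<Sum>j<?d. \<Sum>s<?d. \<Sum>t<?d. if t = i then if s = j then sc (A $$ (i, j) * B $$ (j, i)) else 0 else 0)"
      by (intro sum.cong refl) auto
    also have "\<dots> = (\<Sum>i<?d. \<Sum>j<?d. sc (A $$ (i, j) * B $$ (j, i)))"
      by (intro sum.cong refl) simp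
    also have "\<dots> = sc (mtrace (A * B))"
      using cA unfolding mtrace_def sc_sum by (auto simp: mult_mat_index[OF cA cB] sc_sum intro!: sum.cong)
    finally show ?thesis .
  qed
  also have "?S (\<lambda>i j s t. if i = j \<and> s = t then 1 else 0) = 0"
  proof -
    have "?S (\<lambda>i j s t. if i = j \<and> s = t then 1 else 0) =
        (\<Sum>i<?d. \<Sum>j<?d. if j = i then \<Sum>s<?d. sc (A $$ (i, i) * B $$ (s, s)) else 0)"
      by (rule sum.cong[OF refl], rule sum.cong[OF refl]) (auto simp: if_distrib[of "(*) _"] cong: if_cong)
    also have "\<dots> = (\<Sum>i<?d. \<Sum>s<?d. sc (A $$ (i, i) * B $$ (s, s)))"
      by (rule sum.cong[OF refl]) simp
    also have "\<dots> = sc ((\<Sum>i<?d. A $$ (i, i)) * (\<Sum>s<?d. B $$ (s, s)))"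
      by (simp only: sum_product sc_sum)
    finally show ?thesis unfolding tA by simp
  qed
  finally show ?thesis
    using cA cB by (simp add: mcomm_def loop_op_diff[of "A * B" "B * A"] mult_ac flip: sc_mult)
qed

section \<open>From loop elements to the affine algebra\<close>

definition rep_op :: "aff \<Rightarrow> lop" where
  "rep_op x = (\<Sum>m\<in>loop_support n (fst x). loop_op (fst x m) m) + sc (snd x * k)"

text \<open>Cancellation can shrink the supports of sums, multiples and brackets, so both sides of
  an identity are summed over a common larger set.\<close>

lemma rep_op_superset:
  assumes "finite S" "\<And>m. m \<notin> S \<Longrightarrow> fst x m = 0\<^sub>m (n + 1) (n + 1)"
  shows "rep_op x = (\<Sum>m\<in>S. loop_op (fst x m) m) + sc (snd x * k)"
proof -
  have "(\<Sum>m\<in>loop_support n (fst x). loop_op (fst x m) m) = (\<Sum>m\<in>S. loop_op (fst x m) m)"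
    using assms by (intro sum.mono_neutral_left) (auto simp: loop_support_def)
  then show ?thesis by (simp add: rep_op_def)
qed

lemma affine_slD:
  assumes "x \<in> affine_sl n"
  shows "fst x m \<in> sl n" "fst x m \<in> carrier_mat (n + 1) (n + 1)" "finite (loop_support n (fst x))"
  using assms by (auto simp: affine_sl_def sl_def)

lemma rep_op_add:
  assumes x: "x \<in> affine_sl n" and y: "y \<in> affine_sl n"
  shows "rep_op (aff_add x y) = rep_op x + rep_op y"
proof -
  define S where "S = loop_support n (fst x) \<union> loop_support n (fst y)"
  have S: "finite S" using x y by (simp add: S_def affine_slD)
  have "rep_op z = (\<Sum>m\<in>S. loop_op (fst z m) m) + sc (snd z * k)" if "z \<in> {x, y, aff_add x y}" for z
    using that by (intro rep_op_superset S) (auto simp: S_def loop_support_def aff_add_def)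
  then show ?thesis
    by (simp add: loop_op_add[OF affine_slD(2)[OF x] affine_slD(2)[OF y]] aff_add_def sum.distrib
        distrib_right sc_add)
qed

lemma rep_op_scale:
  assumes x: "x \<in> affine_sl n"
  shows "rep_op (aff_scale s x) = sc s * rep_op x"
proof -
  have "rep_op (aff_scale s x) = (\<Sum>m\<in>loop_support n (fst x). loop_op (s \<cdot>\<^sub>m fst x m) m) + sc (s * snd x * k)"
    using rep_op_superset[OF affine_slD(3)[OF x], of "aff_scale s x"]
    by (auto simp: aff_scale_def loop_support_def)
  then show ?thesis
    by (simp add: loop_op_smult[OF affine_slD(2)[OF x]] rep_op_def distrib_left sum_distrib_left sc_mult mult.assoc)
qed

lemma loop_op_sum:
  "loop_op (mat (n + 1) (n + 1) (\<lambda>ij. \<Sum>p\<in>S. f p $$ ij)) m = (\<Sum>p\<in>S. loop_op (f p) m)"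
proof -
  have "loop_op (mat (n + 1) (n + 1) (\<lambda>ij. \<Sum>p\<in>S. f p $$ ij)) m =
      (\<Sum>i<n+1. \<Sum>j<n+1. \<Sum>p\<in>S. sc (f p $$ (i, j)) * R i j m)"
    unfolding loop_op_def by (intro sum.cong refl) (simp add: sc_sum sum_distrib_right)
  also have "\<dots> = (\<Sum>p\<in>S. loop_op (f p) m)"
    unfolding loop_op_def by (subst sum.swap, intro sum.cong refl, subst sum.swap) auto
  finally show ?thesis .
qed

lemma rep_op_bracket:
  assumes x: "x \<in> affine_sl n" and y: "y \<in> affine_sl n"
  shows "rep_op (aff_bracket n x y) = cm (rep_op x) (rep_op y)"
proof -
  let ?Z = "0\<^sub>m (n + 1) (n + 1) :: complex mat"
  define Sx Sy where "Sx = loop_support n (fst x)" and "Sy = loop_support n (fst y)"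
  have fin: "finite Sx" "finite Sy" using x y by (simp_all add: Sx_def Sy_def affine_slD)
  have y0: "fst y l = ?Z" if "l \<notin> Sy" for l using that by (simp add: Sy_def loop_support_def)
  \<comment> \<open>The sumset of the supports contains the support of the bracket, possibly
    properly.\<close>
  define W where "W = (\<lambda>(p, l). p + l) ` (Sx \<times> Sy)"
  have W: "finite W" using fin by (simp add: W_def)
  note cx = affine_slD(2)[OF x] and cy = affine_slD(2)[OF y]
  have c0: "mcomm (fst x p) ?Z = ?Z" "mtrace (fst x p * ?Z) = 0" for p
    using cx[of p] by (auto simp: mcomm_def mtrace_def)
  let ?g = "\<lambda>m. mat (n + 1) (n + 1) (\<lambda>kl. \<Sum>p\<in>Sx. mcomm (fst x p) (fst y (m - p)) $$ kl)"
  have g0: "?g m = ?Z" if "m \<notin> W" for m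
  proof -
    have "fst y (m - p) = ?Z" if "p \<in> Sx" for p
    proof (rule y0)
      show "m - p \<notin> Sy"
      proof
        assume "m - p \<in> Sy"
        then have "m \<in> W" using that unfolding W_def by (intro image_eqI[of _ _ "(p, m - p)"]) auto
        then show False using \<open>m \<notin> W\<close> by simp
      qed
    qed
    then show ?thesis by (intro eq_matI) (auto simp: c0[simplified])
  qed
  have "rep_op (aff_bracket n x y) = (\<Sum>m\<in>W. loop_op (?g m) m)
      + sc ((\<Sum>p\<in>Sx. of_int p * mtrace (fst x p * fst y (- p))) * k)"
    using rep_op_superset[OF W, of "aff_bracket n x y"] g0 by (simp add: aff_bracket_def Sx_def)
  also have "(\<Sum>m\<in>W. loop_op (?g m) m) = (\<Sum>p\<in>Sx. \<Sum>l\<in>Sy. loop_op (mcomm (fst x p) (fst y l)) (p + l))"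
  proof -
    have "(\<Sum>m\<in>W. loop_op (?g m) m) = (\<Sum>p\<in>Sx. \<Sum>m\<in>W. loop_op (mcomm (fst x p) (fst y (m - p))) m)"
      unfolding loop_op_sum by (rule sum.swap)
    also have "\<dots> = (\<Sum>p\<in>Sx. \<Sum>l\<in>Sy. loop_op (mcomm (fst x p) (fst y l)) (p + l))"
    proof (rule sum.cong[OF refl])
      fix p assume p: "p \<in> Sx"
      have "(\<Sum>l\<in>Sy. loop_op (mcomm (fst x p) (fst y l)) (p + l)) =
          (\<Sum>m\<in>(+) p ` Sy. loop_op (mcomm (fst x p) (fst y (m - p))) m)"
        by (subst sum.reindex) (auto simp: inj_on_def)
      also have "\<dots> = (\<Sum>m\<in>W. loop_op (mcomm (fst x p) (fst y (m - p))) m)"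
      proof (rule sum.mono_neutral_left[OF W])
        show "(+) p ` Sy \<subseteq> W" using p by (auto simp: W_def)
        show "\<forall>m\<in>W - (+) p ` Sy. loop_op (mcomm (fst x p) (fst y (m - p))) m = 0"
        proof
          fix m assume "m \<in> W - (+) p ` Sy"
          then have "m - p \<notin> Sy" by (auto intro: image_eqI[of _ _ "m - p"])
          then show "loop_op (mcomm (fst x p) (fst y (m - p))) m = 0" using y0 c0 by simp
        qed
      qed
      finally show "(\<Sum>m\<in>W. loop_op (mcomm (fst x p) (fst y (m - p))) m) =
        (\<Sum>l\<in>Sy. loop_op (mcomm (fst x p) (fst y l)) (p + l))" ..
    qed
    finally show ?thesis .
  qed
  also have "sc ((\<Sum>p\<in>Sx. of_int p * mtrace (fst x p * fst y (- p))) * k) =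
      (\<Sum>p\<in>Sx. \<Sum>l\<in>Sy. if p + l = 0 then sc (of_int p * mtrace (fst x p * fst y l) * k) else 0)"
  proof -
    have "(\<Sum>l\<in>Sy. if p + l = 0 then sc (of_int p * mtrace (fst x p * fst y l) * k) else 0) =
        sc (of_int p * mtrace (fst x p * fst y (- p)) * k)" for p
    proof -
      have "(\<Sum>l\<in>Sy. if p + l = 0 then sc (of_int p * mtrace (fst x p * fst y l) * k) else 0) =
          (\<Sum>l\<in>Sy. if l = - p then sc (of_int p * mtrace (fst x p * fst y (- p)) * k) else 0)"
        by (intro sum.cong refl) (auto simp: add_eq_0_iff)
      then show ?thesis using fin y0[of "- p"] c0 by auto
    qed
    then show ?thesis by (simp add: sum_distrib_right sc_sum)
  qed
  also have "(\<Sum>p\<in>Sx. \<Sum>l\<in>Sy. loop_op (mcomm (fst x p) (fst y l)) (p + l))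
      + (\<Sum>p\<in>Sx. \<Sum>l\<in>Sy. if p + l = 0 then sc (of_int p * mtrace (fst x p * fst y l) * k) else 0) =
      cm (rep_op x) (rep_op y)"
    unfolding rep_op_def Sx_def[symmetric] Sy_def[symmetric]
    by (simp add: cm_linear cm_sum_left cm_sum_right cm_loop_op[OF affine_slD(1)[OF x] affine_slD(1)[OF y]]
        sum.distrib sum.swap[of _ Sy Sx])
  finally show ?thesis .
qed

lemma rep_op_loop_elem: "rep_op (loop_elem n A m) = loop_op A m"
  using rep_op_superset[of "{m}" "loop_elem n A m"] by (simp add: loop_elem_def)

lemma rep_op_central: "rep_op (central_elem n) = sc k"
  by (simp add: rep_op_def central_elem_def loop_support_def)

lemma preserves_rep_op: "preserves n (rep_op x)"
  unfolding rep_op_def loop_op_def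
  by (intro preserves_add preserves_sum preserves_mult preserves_sc preserves_gl_cur) auto

lemma affine_representation: "affine_representation n (fock n) (\<lambda>x. app (rep_op x))"
  using preserves_rep_op
  by (auto simp: affine_representation_def preserves_def app_add app_pscale rep_op_add rep_op_scale
      rep_op_bracket cm_def)

lemma rep_op_generators:
  assumes i: "i \<in> {1..n}"
  shows "app (rep_op (loop_elem n (genE n i) m)) v = mode (rho_E n r \<gamma> e lam i) m v"
    and "app (rep_op (loop_elem n (genF n i) m)) v = mode (rho_F n r i) m v"
    and "app (rep_op (loop_elem n (genH n i) m)) v = mode (rho_H n r e lam i) m v"
proof -
  have i': "i \<in> {1..n + 1}" "i + 1 \<in> {1..n + 1}" using i by auto
  show "app (rep_op (loop_elem n (genE n i) m)) v = mode (rho_E n r \<gamma> e lam i) m v"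
    unfolding rep_op_loop_elem genE_def loop_op_matE[OF i'(1,2)] mode_rho_E[OF i] ..
  show "app (rep_op (loop_elem n (genF n i) m)) v = mode (rho_F n r i) m v"
    unfolding rep_op_loop_elem genF_def loop_op_matE[OF i'(2,1)] mode_rho_F[OF i] ..
  have "matE n i j \<in> carrier_mat (n + 1) (n + 1)" for i j by (simp add: matE_def)
  then show "app (rep_op (loop_elem n (genH n i) m)) v = mode (rho_H n r e lam i) m v"
    unfolding rep_op_loop_elem genH_def mode_rho_H[OF i]
    by (simp only: loop_op_diff loop_op_matE[OF i'(1,1)] loop_op_matE[OF i'(2,2)])
qed

end

theorem theorem3p1:
  fixes n r :: nat
    and \<gamma> :: complex
    and lam :: "complex mat \<Rightarrow> complex"
    and e :: "nat \<Rightarrow> nat \<Rightarrow> complex"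
  assumes n: "1 \<le> n"
    and r: "r \<le> n"
    and gamma: "\<gamma> \<noteq> 0"
    and lam: "lam \<in> cartan_dual n"
    and e: "\<And>i j. i \<in> {1..n} \<Longrightarrow> j \<in> {1..n} \<Longrightarrow> (\<Sum>l=1..n. e i l * e j l) = frakB r \<gamma> i j"
  shows "\<exists>\<rho>. affine_representation n (fock n) \<rho> \<and>
    (\<forall>i\<in>{1..n}. \<forall>m. \<forall>v\<in>fock n.
       \<rho> (loop_elem n (genE n i) m) v = mode (rho_E n r \<gamma> e (\<lambda>i. lam (genH n i)) i) m v \<and>
       \<rho> (loop_elem n (genF n i) m) v = mode (rho_F n r i) m v \<and>
       \<rho> (loop_elem n (genH n i) m) v = mode (rho_H n r e (\<lambda>i. lam (genH n i)) i) m v) \<and>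
    (\<forall>v\<in>fock n. \<rho> (central_elem n) v = pscale (\<gamma>\<^sup>2 - of_nat (r + 1)) v)"
proof -
  interpret wakimoto n r \<gamma> "\<lambda>i. lam (genH n i)" e
    using r e by unfold_locales
  show ?thesis
  proof (intro exI conjI ballI allI)
    show "affine_representation n (fock n) (\<lambda>x. app (rep_op x))" by (rule affine_representation)
    show "app (rep_op (central_elem n)) v = pscale (\<gamma>\<^sup>2 - of_nat (r + 1)) v" for v
      unfolding rep_op_central by (rule app_simps)
  qed (rule rep_op_generators; assumption)+
qed

end
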